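(* For every $\alpha\in\mathbb N^E$ and every tope $B\in\mathcal T(\mathcal M)$, $$\mathrm{MH}_{k,\alpha}(\mathcal G;\mathbb Z)_{\bullet\to B}\cong\begin{cases}\mathbb Z,&\text{if }k=\kappa_M(\alpha)\text{ and }(\alpha,B)\text{ is tope-admissible},\\0,&\text{otherwise.}\end{cases}$$ In particular, all integral magnitude homology groups of $\mathcal G$ are torsion-free.
   Context: Arrangement. Let $E$ be a finite set and let $\mathcal A=\{H_e\}_{e\in E}$ be a finite central real hyperplane arrangement in a finite-dimensional real vector space $V$: the $H_e=\ker\varphi_e$ ($0\neq\varphi_e\in V^*$) are pairwise distinct linear hyperplanes. Its oriented matroid $\mathcal M$ has covector set $\mathcal L(\mathcal M)=\{(\operatorname{sgn}\varphi_e(x))_{e\in E}\mid x\in V\}\subseteq\{+,-,0\}^E$. The topes (chambers) are the covectors with no zero entry; $\mathcal T(\mathcal M)$ is the set of topes. The underlying matroid $M$ on $E$ has rank function $\operatorname{rk}S=\dim\operatorname{span}\{\varphi_e\mid e\in S\}$; it is simple. For a sign vector $X$ and $S\subseteq E$, $X\setminus S$ is obtained from $X$ by replacing the entries indexed by $S$ by $0$. Tope graph. $\mathcal G$ is the graph with vertex set $\mathcal T(\mathcal M)$, two topes being adjacent iff they differ in exactly one coordinate; its path metric is $d(A,B)=|\operatorname{Sep}(A,B)|$ with $\operatorname{Sep}(A,B)=\{e\in E\mid A_e\ne B_e\}$. Magnitude homology. A proper $k$-chain is a tuple $\boldsymbol A=(A_0,\dots,A_k)$ of topes with $A_{i-1}\ne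 A_i$ for all $i$; its crossing vector is $\sum_{i=1}^k\mathbf 1_{\operatorname{Sep}(A_{i-1},A_i)}\in\mathbb N^E$ ($\mathbb N$ contains $0$) and its length is $\sum_{i=1}^kd(A_{i-1},A_i)$. $\mathrm{MC}_{k,\alpha}(\mathcal G;\mathbb Z)$ (resp. $\mathrm{MC}_{k,\ell}(\mathcal G;\mathbb Z)$) is the free abelian group on the proper $k$-chains with crossing vector $\alpha$ (resp. length $\ell$), with differential $\partial=\sum_{i=1}^{k-1}(-1)^i\partial_i$, where $\partial_i$ deletes $A_i$ if $d(A_{i-1},A_{i+1})=d(A_{i-1},A_i)+d(A_i,A_{i+1})$ and is $0$ otherwise. The homology groups are $\mathrm{MH}_{k,\alpha}(\mathcal G;\mathbb Z)$ and $\mathrm{MH}_{k,\ell}(\mathcal G;\mathbb Z)$. The subscript $\bullet\to B$ denotes the homology of the subcomplex spanned by the chains with last entry $A_k=B$ (and arbitrary first entry). Admissibility. For $\alpha\in\mathbb N^E$ put $m(\alpha)=\max_e\alpha_e$, $U_j(\alpha)=\{e\in E\mid\alpha_e\ge j\}$ for $1\le j\le m(\alpha)$, and $\kappa_M(\alpha)=\sum_{j=1}^{m(\alpha)}\operatorname{rk}U_j(\alpha)$, with $\kappa_M(\mathbf 0)=0$. $\alpha$ is $M$-admissible if every nonempty $U_j(\alpha)$ is a flat of $M$. The pair $(\alpha,B)$ is tope-admissible if $\alpha$ is $M$-admissible and $B\setminus U_j(\alpha)\in\mathcal L(\mathcal M)$ for every $j$. *)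

theory Defs
  imports
    Complex_Main
    "HOL-Library.Function_Algebras"
    "HOL-Algebra.Free_Abelian_Groups"
begin

section \<open>Central hyperplane arrangements and their oriented matroids\<close>

text \<open>Linear functionals are plain functions \<open>'v \<Rightarrow> real\<close>; this makes the space containing them
  a real vector space, so that spans and dimensions in the dual space are available.\<close>

global_interpretation functional: vector_space "\<lambda>(c::real) (f :: 'v \<Rightarrow> real) x. c * f x"
  by unfold_locales (auto simp: fun_eq_iff algebra_simps)

definition central_arrangement :: "'e set \<Rightarrow> ('e \<Rightarrow> 'v::real_vector \<Rightarrow> real) \<Rightarrow> bool" where
  "central_arrangement E \<phi> \<longleftrightarrow>
     finite E \<and>
     (\<exists>b :: 'v set. finite b \<and> span b = UNIV) \<and>
     (\<forall>e\<in>E. linear (\<phi> e) \<and> \<phi> e \<noteq> (\<lambda>x. 0)) \<and>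
     inj_on (\<lambda>e. {x. \<phi> e x = 0}) E"

text \<open>A sign vector on \<open>E\<close> is a function into the reals with values in \<open>{-1, 0, 1}\<close> that is \<open>0\<close>
  outside \<open>E\<close>; likewise, an element of \<open>\<nat>\<^sup>E\<close> is a function \<open>'e \<Rightarrow> nat\<close> vanishing outside \<open>E\<close>.
  This makes equality of functions agree with equality on \<open>E\<close>.\<close>

type_synonym 'e sign_vector = "'e \<Rightarrow> real"

definition covectors :: "'e set \<Rightarrow> ('e \<Rightarrow> 'v \<Rightarrow> real) \<Rightarrow> 'e sign_vector set" where
  "covectors E \<phi> = {(\<lambda>e. if e \<in> E then sgn (\<phi> e x) else 0) | x. True}"

definition topes :: "'e set \<Rightarrow> ('e \<Rightarrow> 'v \<Rightarrow> real) \<Rightarrow> 'e sign_vector set" where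
  "topes E \<phi> = {X \<in> covectors E \<phi>. \<forall>e\<in>E. X e \<noteq> 0}"

definition zero_on :: "'e sign_vector \<Rightarrow> 'e set \<Rightarrow> 'e sign_vector" where
  "zero_on X S = (\<lambda>e. if e \<in> S then 0 else X e)"

definition matroid_rank :: "('e \<Rightarrow> 'v \<Rightarrow> real) \<Rightarrow> 'e set \<Rightarrow> nat" where
  "matroid_rank \<phi> S = functional.dim (functional.span (\<phi> ` S))"

definition flat :: "'e set \<Rightarrow> ('e \<Rightarrow> 'v \<Rightarrow> real) \<Rightarrow> 'e set \<Rightarrow> bool" where
  "flat E \<phi> F \<longleftrightarrow> F \<subseteq> E \<and> (\<forall>e\<in>E - F. matroid_rank \<phi> F < matroid_rank \<phi> (insert e F))"

section \<open>The tope graph\<close>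

definition Sep :: "'e set \<Rightarrow> 'e sign_vector \<Rightarrow> 'e sign_vector \<Rightarrow> 'e set" where
  "Sep E A B = {e \<in> E. A e \<noteq> B e}"

definition tope_graph ::
  "'e set \<Rightarrow> ('e \<Rightarrow> 'v \<Rightarrow> real) \<Rightarrow> ('e sign_vector \<times> 'e sign_vector) set" where
  "tope_graph E \<phi> = {(A, B). A \<in> topes E \<phi> \<and> B \<in> topes E \<phi> \<and> card (Sep E A B) = 1}"

text \<open>Path metric of a graph given by its adjacency relation. It is only meaningful for vertices
  in the same connected component; tope graphs are connected.\<close>

definition path_dist :: "('a \<times> 'a) set \<Rightarrow> 'a \<Rightarrow> 'a \<Rightarrow> nat" where
  "path_dist R x y = (LEAST n. (x, y) \<in> R ^^ n)"

section \<open>Magnitude chains\<close>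

definition proper_chains :: "'a set \<Rightarrow> nat \<Rightarrow> 'a list set" where
  "proper_chains X k =
     {A. length A = k + 1 \<and> set A \<subseteq> X \<and> (\<forall>i\<in>{1..k}. A ! (i - 1) \<noteq> A ! i)}"

definition chain_length :: "('a \<times> 'a) set \<Rightarrow> 'a list \<Rightarrow> nat" where
  "chain_length R A = (\<Sum>i=1..length A - 1. path_dist R (A ! (i - 1)) (A ! i))"

definition crossing_vector :: "'e set \<Rightarrow> 'e sign_vector list \<Rightarrow> 'e \<Rightarrow> nat" where
  "crossing_vector E A =
     (\<lambda>e. \<Sum>i=1..length A - 1. if e \<in> Sep E (A ! (i - 1)) (A ! i) then 1 else 0)"

definition delete_nth :: "nat \<Rightarrow> 'a list \<Rightarrow> 'a list" where
  "delete_nth i A = take i A @ drop (Suc i) A"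

definition magnitude_face :: "('a \<times> 'a) set \<Rightarrow> nat \<Rightarrow> 'a list \<Rightarrow> 'a list \<Rightarrow>\<^sub>0 int" where
  "magnitude_face R i A =
     (if path_dist R (A ! (i - 1)) (A ! (i + 1)) =
         path_dist R (A ! (i - 1)) (A ! i) + path_dist R (A ! i) (A ! (i + 1))
      then frag_of (delete_nth i A) else 0)"

definition magnitude_boundary :: "('a \<times> 'a) set \<Rightarrow> ('a list \<Rightarrow>\<^sub>0 int) \<Rightarrow> 'a list \<Rightarrow>\<^sub>0 int" where
  "magnitude_boundary R =
     frag_extend (\<lambda>A. \<Sum>i\<in>{1..<length A - 1}. frag_cmul ((-1) ^ i) (magnitude_face R i A))"

section \<open>Magnitude homology\<close>

text \<open>\<open>S k\<close> is the set of \<open>k\<close>-chains freely generating the complex in degree \<open>k\<close>. As usual in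
  HOL-Algebra, the groups are written multiplicatively.\<close>

definition magnitude_homology ::
  "('a \<times> 'a) set \<Rightarrow> (nat \<Rightarrow> 'a list set) \<Rightarrow> nat \<Rightarrow> ('a list \<Rightarrow>\<^sub>0 int) set monoid" where
  "magnitude_homology R S k =
     subgroup_generated (free_Abelian_group (S k))
       {c \<in> carrier (free_Abelian_group (S k)). magnitude_boundary R c = 0}
     Mod (magnitude_boundary R ` carrier (free_Abelian_group (S (Suc k))))"

definition MH_crossing ::
  "'e set \<Rightarrow> ('e \<Rightarrow> 'v \<Rightarrow> real) \<Rightarrow> nat \<Rightarrow> ('e \<Rightarrow> nat) \<Rightarrow> ('e sign_vector list \<Rightarrow>\<^sub>0 int) set monoid" where
  "MH_crossing E \<phi> k \<alpha> =
     magnitude_homology (tope_graph E \<phi>)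
       (\<lambda>j. {A \<in> proper_chains (topes E \<phi>) j. crossing_vector E A = \<alpha>}) k"

definition MH_crossing_to ::
  "'e set \<Rightarrow> ('e \<Rightarrow> 'v \<Rightarrow> real) \<Rightarrow> nat \<Rightarrow> ('e \<Rightarrow> nat) \<Rightarrow> 'e sign_vector \<Rightarrow>
     ('e sign_vector list \<Rightarrow>\<^sub>0 int) set monoid" where
  "MH_crossing_to E \<phi> k \<alpha> B =
     magnitude_homology (tope_graph E \<phi>)
       (\<lambda>j. {A \<in> proper_chains (topes E \<phi>) j. crossing_vector E A = \<alpha> \<and> last A = B}) k"

definition MH_length ::
  "'e set \<Rightarrow> ('e \<Rightarrow> 'v \<Rightarrow> real) \<Rightarrow> nat \<Rightarrow> nat \<Rightarrow> ('e sign_vector list \<Rightarrow>\<^sub>0 int) set monoid" where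
  "MH_length E \<phi> k l =
     magnitude_homology (tope_graph E \<phi>)
       (\<lambda>j. {A \<in> proper_chains (topes E \<phi>) j. chain_length (tope_graph E \<phi>) A = l}) k"

definition torsion_free :: "('a, 'b) monoid_scheme \<Rightarrow> bool" where
  "torsion_free G \<longleftrightarrow>
     (\<forall>x\<in>carrier G. \<forall>n::nat. 0 < n \<longrightarrow> x [^]\<^bsub>G\<^esub> n = \<one>\<^bsub>G\<^esub> \<longrightarrow> x = \<one>\<^bsub>G\<^esub>)"

section \<open>Admissibility\<close>

definition nat_vectors :: "'e set \<Rightarrow> ('e \<Rightarrow> nat) set" where
  "nat_vectors E = {\<alpha>. \<forall>e. e \<notin> E \<longrightarrow> \<alpha> e = 0}"

text \<open>Inserting \<open>0\<close> only matters for \<open>E = {}\<close>.\<close>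

definition max_entry :: "'e set \<Rightarrow> ('e \<Rightarrow> nat) \<Rightarrow> nat" where
  "max_entry E \<alpha> = Max (insert 0 (\<alpha> ` E))"

definition level_set :: "'e set \<Rightarrow> ('e \<Rightarrow> nat) \<Rightarrow> nat \<Rightarrow> 'e set" where
  "level_set E \<alpha> j = {e \<in> E. j \<le> \<alpha> e}"

definition kappa :: "'e set \<Rightarrow> ('e \<Rightarrow> 'v \<Rightarrow> real) \<Rightarrow> ('e \<Rightarrow> nat) \<Rightarrow> nat" where
  "kappa E \<phi> \<alpha> = (\<Sum>j=1..max_entry E \<alpha>. matroid_rank \<phi> (level_set E \<alpha> j))"

definition matroid_admissible :: "'e set \<Rightarrow> ('e \<Rightarrow> 'v \<Rightarrow> real) \<Rightarrow> ('e \<Rightarrow> nat) \<Rightarrow> bool" where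
  "matroid_admissible E \<phi> \<alpha> \<longleftrightarrow>
     (\<forall>j\<in>{1..max_entry E \<alpha>}. level_set E \<alpha> j \<noteq> {} \<longrightarrow> flat E \<phi> (level_set E \<alpha> j))"

definition tope_admissible ::
  "'e set \<Rightarrow> ('e \<Rightarrow> 'v \<Rightarrow> real) \<Rightarrow> ('e \<Rightarrow> nat) \<Rightarrow> 'e sign_vector \<Rightarrow> bool" where
  "tope_admissible E \<phi> \<alpha> B \<longleftrightarrow>
     matroid_admissible E \<phi> \<alpha> \<and>
     (\<forall>j\<in>{1..max_entry E \<alpha>}. zero_on B (level_set E \<alpha> j) \<in> covectors E \<phi>)"

end

theory Submission
  imports Defs
begin

text \<open>A deletion in a magnitude chain is allowed exactly when it preserves the crossing vector
  (\<open>geodesic_deletion_iff\<close>), so the chains with crossing vector \<open>\<alpha>\<close> and last entry \<open>B\<close> form a complex in which every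
  deletion that stays inside the given set of lists counts. For such complexes, subcomplexes, quotients
  and filtrations can be described by sets of lists alone.

  The homology is computed one layer of \<open>\<alpha>\<close> at a time. Let \<open>W\<close> be a face of a tope \<open>A\<close>, written as the set of
  hyperplanes containing it, and consider paths of topes continued to \<open>A\<close> by one more, possibly trivial step that crosses
  no hyperplane of \<open>W\<close>, with total crossing vector \<open>\<gamma>\<close>. For \<open>W = E\<close> these are the magnitude chains ending in
  \<open>A\<close>. This complex is resolved by pairs of an arbitrary path to \<open>A\<close> and a flag of faces of \<open>A\<close> in \<open>W\<close>, all of
  whose hyperplanes are crossed in the final step.

  If the path is fixed, the flags run through the faces of \<open>A\<close> that are visible from another chamber. The visible part of the
  boundary of a convex cone is a ball, so this complex is acyclic (\<open>acyclic_visible_faces\<close>), unless no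
  hyperplane of \<open>W\<close> is crossed in the final step and only the empty flag exists. Hence the resolution has the homology of
  the original complex (\<open>resolution_quasi_paths\<close>).

  If the flag is fixed and \<open>Z\<close> is its largest set, the final step may be routed through the reflection of \<open>A\<close> in \<open>Z\<close>. What
  remains is the complex of the same kind for this reflected tope, the face \<open>Z\<close>, and the crossing vector lowered by one
  on \<open>Z\<close>. By induction it is acyclic unless the support of \<open>\<gamma>\<close> is contained in \<open>Z\<close>. Since \<open>Z\<close> is itself crossed,
  only \<open>Z = U\<close>, the support of \<open>\<gamma>\<close>, contributes (\<open>resolution_quasi_flags\<close>). The flags of faces below \<open>U\<close> form a
  sphere of dimension \<open>rk U - 2\<close> (\<open>sphere_flag_complex\<close>), which raises the degree by \<open>rk U\<close>. Thus
  the homology survives exactly if each level set in turn is a face, and it then sits in degree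
  \<open>kappa\<close> (\<open>homology_tope_paths\<close>).

  Both facts about faces rest on \<open>first_crossing\<close>, which isolates one class of parallel hyperplanes at the end of a
  segment; it also shows that the distance in the tope graph is the number of separating hyperplanes. The complexes
  for fixed crossing vector or fixed length are direct sums of the ones for fixed \<open>\<alpha>\<close> and \<open>B\<close>, so
  their homology is torsion-free.\<close>

section \<open>Chain complexes spanned by lists\<close>

lemma length_delete_nth: "i < length l \<Longrightarrow> length (delete_nth i l) = length l - 1"
  by (simp add: delete_nth_def)

lemma nth_delete_nth:
  "i < length l \<Longrightarrow> k < length l - 1 \<Longrightarrow> delete_nth i l ! k = (if k < i then l ! k else l ! Suc k)"
  by (auto simp: delete_nth_def nth_append min_def)

lemma delete_nth_append:
  "delete_nth i (xs @ ys) = (if i < length xs then delete_nth i xs @ ys else xs @ delete_nth (i - length xs) ys)"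
  by (auto simp: delete_nth_def Suc_diff_le)

lemma delete_nth_map: "delete_nth i (map f xs) = map f (delete_nth i xs)"
  by (simp add: delete_nth_def take_map drop_map)

lemma delete_nth_middle: "delete_nth (length xs) (xs @ a # ys) = xs @ ys"
  by (simp add: delete_nth_def)

lemma set_delete_nth: "set (delete_nth i l) \<subseteq> set l"
  by (auto simp: delete_nth_def dest: in_set_takeD in_set_dropD)

lemma split_at_delete_nth:
  assumes "i < length l"
  obtains xs a ys where "l = xs @ a # ys" "length xs = i" "delete_nth i l = xs @ ys"
  using assms id_take_nth_drop[of i l] by (metis delete_nth_def length_take min.absorb4)

text \<open>The simplicial identity behind \<open>\<partial>\<^sup>2 = 0\<close>.\<close>

lemma delete_nth_delete_nth:
  assumes "j \<le> i" "Suc i < length l"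
  shows "delete_nth i (delete_nth j l) = delete_nth j (delete_nth (Suc i) l)"
  by (rule nth_equalityI) (use assms in \<open>auto simp: length_delete_nth nth_delete_nth\<close>)

text \<open>The boundary of the full simplex on a list, truncated to the lists of \<open>X\<close>. All complexes below
  have this form, graded by the length of the list, so that passing to subcomplexes and quotients only
  changes the set \<open>X\<close>. The positions are counted from \<open>0\<close>, as in the magnitude boundary.\<close>

definition deletion_boundary :: "'a list set \<Rightarrow> ('a list \<Rightarrow>\<^sub>0 int) \<Rightarrow> 'a list \<Rightarrow>\<^sub>0 int" where
  "deletion_boundary X = frag_extend (\<lambda>l. \<Sum>i<length l.
     if delete_nth i l \<in> X then frag_cmul ((-1) ^ i) (frag_of (delete_nth i l)) else 0)"

definition list_chains :: "'a list set \<Rightarrow> nat \<Rightarrow> ('a list \<Rightarrow>\<^sub>0 int) set" where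
  "list_chains X k = {c. Poly_Mapping.keys c \<subseteq> {l \<in> X. length l = k}}"

definition restrict_chain :: "'a set \<Rightarrow> ('a \<Rightarrow>\<^sub>0 int) \<Rightarrow> 'a \<Rightarrow>\<^sub>0 int" where
  "restrict_chain Y = frag_extend (\<lambda>l. if l \<in> Y then frag_of l else 0)"

text \<open>For such an \<open>X\<close> the truncated boundary squares to zero: whenever two entries can be deleted inside
  \<open>X\<close>, both orders of deletion stay inside \<open>X\<close>, so the terms still cancel in pairs.\<close>

definition convex_lists :: "'a list set \<Rightarrow> bool" where
  "convex_lists X \<longleftrightarrow> (\<forall>l\<in>X. \<forall>i<length l. \<forall>j<length l - 1.
     delete_nth j (delete_nth i l) \<in> X \<longrightarrow> delete_nth i l \<in> X)"

definition subcomplex :: "'a list set \<Rightarrow> 'a list set \<Rightarrow> bool" where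
  "subcomplex Y X \<longleftrightarrow> Y \<subseteq> X \<and> (\<forall>l\<in>Y. \<forall>i<length l. delete_nth i l \<in> X \<longrightarrow> delete_nth i l \<in> Y)"

definition exact_at :: "'a list set \<Rightarrow> nat \<Rightarrow> bool" where
  "exact_at X k \<longleftrightarrow> (\<forall>c\<in>list_chains X k. deletion_boundary X c = 0 \<longrightarrow>
     (\<exists>b\<in>list_chains X (Suc k). deletion_boundary X b = c))"

definition acyclic_lists :: "'a list set \<Rightarrow> bool" where
  "acyclic_lists X \<longleftrightarrow> (\<forall>k. exact_at X k)"

text \<open>The homology is infinite cyclic in degree \<open>n\<close> and vanishes in all other degrees; \<open>z\<close> is a
  generating cycle. For \<open>X\<close> consisting of a single list this holds with its length as degree.\<close>

definition sphere_lists :: "'a list set \<Rightarrow> nat \<Rightarrow> bool" where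
  "sphere_lists X n \<longleftrightarrow> (\<forall>k. k \<noteq> n \<longrightarrow> exact_at X k) \<and>
     (\<exists>z\<in>list_chains X n. deletion_boundary X z = 0 \<and>
        (\<forall>c\<in>list_chains X n. deletion_boundary X c = 0 \<longrightarrow>
           (\<exists>m. \<exists>b\<in>list_chains X (Suc n). c = frag_cmul m z + deletion_boundary X b)) \<and>
        (\<forall>m. \<forall>b\<in>list_chains X (Suc n). frag_cmul m z = deletion_boundary X b \<longrightarrow> m = 0))"

lemma sphere_listsE:
  assumes "sphere_lists X n"
  obtains z where "z \<in> list_chains X n" "deletion_boundary X z = 0"
    "\<And>c. c \<in> list_chains X n \<Longrightarrow> deletion_boundary X c = 0 \<Longrightarrow>
       \<exists>m. \<exists>b\<in>list_chains X (Suc n). c = frag_cmul m z + deletion_boundary X b"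
    "\<And>m b. b \<in> list_chains X (Suc n) \<Longrightarrow> frag_cmul m z = deletion_boundary X b \<Longrightarrow> m = 0"
  using assms that unfolding sphere_lists_def by (elim conjE bexE) blast

lemma deletion_boundary_of:
  "deletion_boundary X (frag_of l) = (\<Sum>i<length l.
     if delete_nth i l \<in> X then frag_cmul ((-1) ^ i) (frag_of (delete_nth i l)) else 0)"
  by (simp add: deletion_boundary_def)

lemma deletion_boundary_linear [simp]:
  "deletion_boundary X 0 = 0"
  "deletion_boundary X (a + b) = deletion_boundary X a + deletion_boundary X b"
  "deletion_boundary X (a - b) = deletion_boundary X a - deletion_boundary X b"
  "deletion_boundary X (frag_cmul m a) = frag_cmul m (deletion_boundary X a)"
  "deletion_boundary X (- a) = - deletion_boundary X a"
  by (simp_all add: deletion_boundary_def frag_extend_add frag_extend_diff frag_extend_cmul frag_extend_minus)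

lemma restrict_chain_linear [simp]:
  "restrict_chain X 0 = 0"
  "restrict_chain X (a + b) = restrict_chain X a + restrict_chain X b"
  "restrict_chain X (a - b) = restrict_chain X a - restrict_chain X b"
  "restrict_chain X (frag_cmul m a) = frag_cmul m (restrict_chain X a)"
  "restrict_chain X (- a) = - restrict_chain X a"
  by (simp_all add: restrict_chain_def frag_extend_add frag_extend_diff frag_extend_cmul frag_extend_minus)

lemma restrict_chain_of: "restrict_chain Y (frag_of l) = (if l \<in> Y then frag_of l else 0)"
  by (simp add: restrict_chain_def)

lemma restrict_chain_sum: "restrict_chain Y (sum f I) = (\<Sum>i\<in>I. restrict_chain Y (f i))"
  by (induction I rule: infinite_finite_induct) auto

lemma deletion_boundary_sum: "deletion_boundary Y (sum f I) = (\<Sum>i\<in>I. deletion_boundary Y (f i))"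
  by (induction I rule: infinite_finite_induct) auto

lemma frag_linear_eqI:
  assumes "Poly_Mapping.keys c \<subseteq> X"
    and "\<And>l. l \<in> X \<Longrightarrow> F (frag_of l) = G (frag_of l)"
    and "F 0 = G 0" "\<And>a b. F (a - b) = F a - F b" "\<And>a b. G (a - b) = G a - G b"
  shows "F c = G c"
  using assms(1)
proof (induction c rule: frag_induction)
  case (one x) then show ?case using assms(2) by simp
qed (auto simp: assms)

lemma lookup_restrict_chain:
  "Poly_Mapping.lookup (restrict_chain Y c) l = (if l \<in> Y then Poly_Mapping.lookup c l else 0)"
proof -
  have "Poly_Mapping.keys c \<subseteq> UNIV" by simp
  then show ?thesis
    by (induction c rule: frag_induction)
       (auto simp: restrict_chain_of lookup_minus lookup_single when_def)
qed

lemma keys_restrict_chain: "Poly_Mapping.keys (restrict_chain Y c) = Poly_Mapping.keys c \<inter> Y"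
  by (auto simp: in_keys_iff lookup_restrict_chain split: if_splits)

lemma restrict_chain_id: "Poly_Mapping.keys c \<subseteq> Y \<Longrightarrow> restrict_chain Y c = c"
  by (rule poly_mapping_eqI) (auto simp: lookup_restrict_chain in_keys_iff)

lemma restrict_chain_0: "Poly_Mapping.keys c \<inter> Y = {} \<Longrightarrow> restrict_chain Y c = 0"
  by (rule poly_mapping_eqI) (auto simp: lookup_restrict_chain in_keys_iff)

lemma keys_deletion_boundary:
  "Poly_Mapping.keys (deletion_boundary X c) \<subseteq>
     {l' \<in> X. \<exists>l\<in>Poly_Mapping.keys c. \<exists>i<length l. l' = delete_nth i l}"
proof -
  have *: "Poly_Mapping.keys (\<Sum>i<length l.
     if delete_nth i l \<in> X then frag_cmul ((-1) ^ i) (frag_of (delete_nth i l)) else 0)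
     \<subseteq> {l' \<in> X. \<exists>i<length l. l' = delete_nth i l}" for l
    by (rule order_trans[OF keys_sum]) (auto split: if_splits simp: in_keys_iff)
  show ?thesis
    unfolding deletion_boundary_def
    by (rule order_trans[OF keys_frag_extend]) (use * in blast)
qed

lemma deletion_boundary_chains':
  assumes "c \<in> list_chains X k" shows "deletion_boundary X c \<in> list_chains X (k - 1)"
  unfolding list_chains_def
proof (rule CollectI, rule subsetI)
  fix l' assume "l' \<in> Poly_Mapping.keys (deletion_boundary X c)"
  then obtain l i where "l \<in> Poly_Mapping.keys c" "i < length l" "l' = delete_nth i l" "l' \<in> X"
    using keys_deletion_boundary[of X c] by blast
  then show "l' \<in> {l \<in> X. length l = k - 1}"
    using assms by (auto simp: list_chains_def length_delete_nth)
qed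

lemma deletion_boundary_chains:
  assumes "c \<in> list_chains X (Suc k)" shows "deletion_boundary X c \<in> list_chains X k"
  using deletion_boundary_chains'[OF assms] by simp

lemma deletion_boundary_chains_0:
  assumes "c \<in> list_chains X 0" shows "deletion_boundary X c = 0"
proof -
  have "Poly_Mapping.keys (deletion_boundary X c) = {}"
    using keys_deletion_boundary[of X c] assms by (fastforce simp: list_chains_def)
  then show ?thesis by simp
qed

lemma list_chains_closed [intro]:
  "0 \<in> list_chains X k"
  "a \<in> list_chains X k \<Longrightarrow> b \<in> list_chains X k \<Longrightarrow> a + b \<in> list_chains X k"
  "a \<in> list_chains X k \<Longrightarrow> b \<in> list_chains X k \<Longrightarrow> a - b \<in> list_chains X k"
  "a \<in> list_chains X k \<Longrightarrow> frag_cmul m a \<in> list_chains X k"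
  "a \<in> list_chains X k \<Longrightarrow> - a \<in> list_chains X k"
  using Poly_Mapping.keys_add[of a b] keys_diff[of a b] keys_cmul[of m a]
  by (auto simp: list_chains_def)

text \<open>The pairs \<open>(i, j)\<close> with \<open>i \<le> j\<close> cancel against those with \<open>j < i\<close> through
  \<open>(i, j) \<mapsto> (j + 1, i)\<close>, which changes the parity of \<open>i + j\<close>.\<close>

lemma sum_alternating_square:
  fixes F :: "nat \<Rightarrow> nat \<Rightarrow> 'b list \<Rightarrow>\<^sub>0 int"
  assumes "\<And>i j. j \<le> i \<Longrightarrow> Suc i < n \<Longrightarrow> F j i = F (Suc i) j"
  shows "(\<Sum>i<n. \<Sum>j<n - 1. frag_cmul ((-1) ^ (i + j)) (F i j)) = 0"
proof -
  let ?g = "\<lambda>(i, j). frag_cmul ((-1) ^ (i + j)) (F i j)"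
  let ?A = "{(i, j). i < n \<and> j < n - 1 \<and> i \<le> j}" and ?B = "{(i, j). i < n \<and> j < n - 1 \<and> j < i}"
  have swap: "- ?g (j, i - 1) = ?g (i, j)" if "i < n" "j < i" for i j
    using that assms[of j "i - 1"] by (cases i) (auto simp: add.commute)
  have eq: "{..<n} \<times> {..<n - 1} = ?A \<union> ?B" by auto
  have fin: "finite ?A" "finite ?B"
    by (rule finite_subset[of _ "{..<n} \<times> {..<n - 1}"]; auto)+
  have "(\<Sum>i<n. \<Sum>j<n - 1. frag_cmul ((-1) ^ (i + j)) (F i j)) = sum ?g (?A \<union> ?B)"
    unfolding eq[symmetric] by (rule sum.cartesian_product)
  also have "\<dots> = sum ?g ?A + sum ?g ?B"
    by (rule sum.union_disjoint) (use fin in auto)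
  also have "sum ?g ?B = sum (\<lambda>p. - ?g p) ?A"
    by (rule sum.reindex_bij_witness[where j = "\<lambda>(i, j). (j, i - 1)" and i = "\<lambda>(i, j). (Suc j, i)"])
       (use swap in auto)
  finally show ?thesis by (simp add: sum_negf)
qed

lemma deletion_boundary_square:
  assumes "convex_lists X" "Poly_Mapping.keys c \<subseteq> X"
  shows "deletion_boundary X (deletion_boundary X c) = 0"
proof -
  have "deletion_boundary X (deletion_boundary X (frag_of l)) = 0" if l: "l \<in> X" for l
  proof -
    let ?F = "\<lambda>i j. if delete_nth j (delete_nth i l) \<in> X then frag_of (delete_nth j (delete_nth i l)) else 0"
    have "deletion_boundary X (deletion_boundary X (frag_of l)) =
       (\<Sum>i<length l. \<Sum>j<length l - 1. frag_cmul ((-1) ^ (i + j)) (?F i j))"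
      unfolding deletion_boundary_of[of X l] deletion_boundary_sum
    proof (rule sum.cong[OF refl])
      fix i assume i: "i \<in> {..<length l}"
      show "deletion_boundary X (if delete_nth i l \<in> X then frag_cmul ((- 1) ^ i) (frag_of (delete_nth i l)) else 0)
        = (\<Sum>j<length l - 1. frag_cmul ((-1) ^ (i + j)) (?F i j))"
      proof (cases "delete_nth i l \<in> X")
        case True
        then show ?thesis using i
          by (auto simp: deletion_boundary_of length_delete_nth frag_cmul_sum power_add intro!: sum.cong)
      next
        case False
        then have "?F i j = 0" if "j < length l - 1" for j
          using assms(1) l i that by (auto simp: convex_lists_def)
        then show ?thesis using False by (auto intro!: sum.neutral[symmetric])
      qed
    qed
    also have "\<dots> = 0"
      by (rule sum_alternating_square) (simp add: delete_nth_delete_nth)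
    finally show ?thesis .
  qed
  then show ?thesis
    using frag_linear_eqI[OF assms(2), of "\<lambda>c. deletion_boundary X (deletion_boundary X c)" "\<lambda>_. 0"] by simp
qed

lemma subcomplex_convex:
  assumes "convex_lists X" "subcomplex Y X"
  shows "convex_lists Y" "convex_lists (X - Y)"
  using assms unfolding convex_lists_def subcomplex_def
  by (blast, metis DiffD1 DiffD2 DiffI length_delete_nth)

lemma chains_mono: "Y \<subseteq> X \<Longrightarrow> list_chains Y k \<subseteq> list_chains X k"
  by (auto simp: list_chains_def)

lemma deletion_boundary_subcomplex:
  assumes "subcomplex Y X" "Poly_Mapping.keys c \<subseteq> Y"
  shows "deletion_boundary X c = deletion_boundary Y c"
  using assms(2)
  by (rule frag_linear_eqI) (use assms(1) in \<open>auto simp: deletion_boundary_of subcomplex_def intro!: sum.cong\<close>)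

text \<open>Restriction to the complement of a subcomplex is the projection onto the quotient complex.\<close>

lemma deletion_boundary_quotient:
  assumes "subcomplex Y X" "Poly_Mapping.keys c \<subseteq> X"
  shows "restrict_chain (X - Y) (deletion_boundary X c) = deletion_boundary (X - Y) (restrict_chain (X - Y) c)"
  using assms(2)
proof (rule frag_linear_eqI)
  fix l assume "l \<in> X"
  show "restrict_chain (X - Y) (deletion_boundary X (frag_of l)) =
    deletion_boundary (X - Y) (restrict_chain (X - Y) (frag_of l))"
  proof (cases "l \<in> Y")
    case True
    then show ?thesis
      using assms(1) by (auto simp: deletion_boundary_of restrict_chain_of restrict_chain_sum subcomplex_def intro!: sum.neutral)
  next
    case False
    then show ?thesis using \<open>l \<in> X\<close>
      by (auto simp: deletion_boundary_of restrict_chain_of restrict_chain_sum intro!: sum.cong)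
  qed
qed auto

lemma chains_keys: "c \<in> list_chains X k \<Longrightarrow> Poly_Mapping.keys c \<subseteq> X"
  by (auto simp: list_chains_def)

lemma restrict_chains: "c \<in> list_chains X k \<Longrightarrow> restrict_chain Y c \<in> list_chains (X \<inter> Y) k"
  by (auto simp: list_chains_def keys_restrict_chain)

context
  fixes X Y :: "'a list set"
  assumes convex: "convex_lists X" and sub: "subcomplex Y X" and acyc: "acyclic_lists Y"
begin

private lemma push:
  assumes "b \<in> list_chains X k"
  shows "restrict_chain (X - Y) b \<in> list_chains (X - Y) k"
    "deletion_boundary (X - Y) (restrict_chain (X - Y) b) = restrict_chain (X - Y) (deletion_boundary X b)"
  using restrict_chains[OF assms, of "X - Y"] deletion_boundary_quotient[OF sub chains_keys[OF assms]]
  by (auto simp: Int_absorb1)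

private lemma lift_cycle:
  assumes c: "c \<in> list_chains (X - Y) k" and cycle: "deletion_boundary (X - Y) c = 0"
  obtains c' where "c' \<in> list_chains X k" "deletion_boundary X c' = 0" "restrict_chain (X - Y) c' = c"
proof -
  have cX: "c \<in> list_chains X k" using c chains_mono[of "X - Y" X] by auto
  have res: "restrict_chain (X - Y) c = c" by (rule restrict_chain_id[OF chains_keys[OF c]])
  let ?y = "deletion_boundary X c"
  have "restrict_chain (X - Y) ?y = 0" using push(2)[OF cX] res cycle by simp
  then have "Poly_Mapping.keys ?y \<inter> (X - Y) = {}" by (metis keys_restrict_chain keys_zero)
  moreover have "?y \<in> list_chains X (k - 1)" using deletion_boundary_chains'[OF cX] .
  ultimately have y: "?y \<in> list_chains Y (k - 1)" by (auto simp: list_chains_def)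
  have "deletion_boundary Y ?y = 0"
    using deletion_boundary_square[OF convex chains_keys[OF cX]]
      deletion_boundary_subcomplex[OF sub chains_keys[OF y]] by simp
  then obtain b where b: "b \<in> list_chains Y k" "deletion_boundary Y b = ?y"
  proof (cases k)
    case 0
    then have "?y = 0" using deletion_boundary_chains_0 cX by blast
    then show ?thesis using that[of 0] by auto
  next
    case (Suc k')
    then show ?thesis using acyc y that \<open>deletion_boundary Y ?y = 0\<close>
      by (metis acyclic_lists_def diff_Suc_1 exact_at_def)
  qed
  have bX: "b \<in> list_chains X k" using b(1) sub chains_mono[of Y X] by (auto simp: subcomplex_def)
  have "restrict_chain (X - Y) b = 0" by (rule restrict_chain_0) (use chains_keys[OF b(1)] in auto)
  moreover have "deletion_boundary X b = ?y"
    using deletion_boundary_subcomplex[OF sub chains_keys[OF b(1)]] b(2) by simp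
  ultimately show ?thesis using that[of "c - b"] cX bX res by auto
qed

private lemma lift_boundary:
  assumes c: "c \<in> list_chains X k" and cycle: "deletion_boundary X c = 0"
    and b: "b \<in> list_chains (X - Y) (Suc k)" "restrict_chain (X - Y) c = deletion_boundary (X - Y) b"
  shows "\<exists>b'\<in>list_chains X (Suc k). deletion_boundary X b' = c"
proof -
  have bX: "b \<in> list_chains X (Suc k)" using b chains_mono[of "X - Y" X] by auto
  have res: "restrict_chain (X - Y) b = b" by (rule restrict_chain_id[OF chains_keys[OF b(1)]])
  let ?y = "c - deletion_boundary X b"
  have yX: "?y \<in> list_chains X k" using c deletion_boundary_chains[OF bX] by auto
  have "restrict_chain (X - Y) ?y = 0" using push(2)[OF bX] res b(2) by simp
  then have "Poly_Mapping.keys ?y \<inter> (X - Y) = {}" by (metis keys_restrict_chain keys_zero)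
  then have y: "?y \<in> list_chains Y k" using yX by (auto simp: list_chains_def)
  have "deletion_boundary Y ?y = 0"
    using deletion_boundary_square[OF convex chains_keys[OF bX]] cycle
      deletion_boundary_subcomplex[OF sub chains_keys[OF y]] by simp
  then obtain b' where b': "b' \<in> list_chains Y (Suc k)" "deletion_boundary Y b' = ?y"
    using acyc y unfolding acyclic_lists_def exact_at_def by blast
  have "b' \<in> list_chains X (Suc k)" using b'(1) sub chains_mono[of Y X] by (auto simp: subcomplex_def)
  moreover have "deletion_boundary X b' = ?y"
    using deletion_boundary_subcomplex[OF sub chains_keys[OF b'(1)]] b'(2) by simp
  ultimately show ?thesis using bX by (intro bexI[of _ "b' + b"]) auto
qed

text \<open>The three statements below are the parts of the long exact sequence of
  \<open>0 \<rightarrow> Y \<rightarrow> X \<rightarrow> X - Y \<rightarrow> 0\<close> that remain when \<open>Y\<close> is acyclic: cycles and bounding chains of the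
  quotient lift, because the defect lies in \<open>Y\<close> and bounds there.\<close>

lemma exact_at_quotient_iff: "exact_at (X - Y) k \<longleftrightarrow> exact_at X k"
proof
  assume ex: "exact_at (X - Y) k"
  show "exact_at X k"
    unfolding exact_at_def
  proof (intro ballI impI)
    fix c assume c: "c \<in> list_chains X k" "deletion_boundary X c = 0"
    then obtain b where "b \<in> list_chains (X - Y) (Suc k)" "restrict_chain (X - Y) c = deletion_boundary (X - Y) b"
      using push[OF c(1)] ex unfolding exact_at_def by (metis restrict_chain_linear(1))
    then show "\<exists>b\<in>list_chains X (Suc k). deletion_boundary X b = c" using lift_boundary c by blast
  qed
next
  assume ex: "exact_at X k"
  show "exact_at (X - Y) k"
    unfolding exact_at_def
  proof (intro ballI impI)
    fix c assume c: "c \<in> list_chains (X - Y) k" "deletion_boundary (X - Y) c = 0"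
    then obtain c' where c': "c' \<in> list_chains X k" "deletion_boundary X c' = 0" "restrict_chain (X - Y) c' = c"
      using lift_cycle by blast
    then obtain b where "b \<in> list_chains X (Suc k)" "deletion_boundary X b = c'"
      using ex unfolding exact_at_def by blast
    then show "\<exists>b\<in>list_chains (X - Y) (Suc k). deletion_boundary (X - Y) b = c"
      using push[of b "Suc k"] c'(3) by auto
  qed
qed

lemma acyclic_quotient_iff: "acyclic_lists (X - Y) \<longleftrightarrow> acyclic_lists X"
  by (simp add: acyclic_lists_def exact_at_quotient_iff)

lemma sphere_quotient_iff: "sphere_lists (X - Y) n \<longleftrightarrow> sphere_lists X n"
proof
  assume sp: "sphere_lists (X - Y) n"
  then obtain z where z: "z \<in> list_chains (X - Y) n" "deletion_boundary (X - Y) z = 0"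
    and gen: "\<And>c. c \<in> list_chains (X - Y) n \<Longrightarrow> deletion_boundary (X - Y) c = 0 \<Longrightarrow>
           (\<exists>m. \<exists>b\<in>list_chains (X - Y) (Suc n). c = frag_cmul m z + deletion_boundary (X - Y) b)"
    and free: "\<And>m b. b\<in>list_chains (X - Y) (Suc n) \<Longrightarrow> frag_cmul m z = deletion_boundary (X - Y) b \<Longrightarrow> m = 0"
    using sphere_listsE by blast
  obtain z' where z': "z' \<in> list_chains X n" "deletion_boundary X z' = 0" "restrict_chain (X - Y) z' = z"
    using lift_cycle[OF z] .
  show "sphere_lists X n"
    unfolding sphere_lists_def
  proof (intro conjI bexI[OF _ z'(1)] z'(2) ballI allI impI)
    show "exact_at X k" if "k \<noteq> n" for k using sp that exact_at_quotient_iff by (auto simp: sphere_lists_def)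
  next
    fix c assume c: "c \<in> list_chains X n" "deletion_boundary X c = 0"
    then obtain m b where b: "b\<in>list_chains (X - Y) (Suc n)"
      "restrict_chain (X - Y) c = frag_cmul m z + deletion_boundary (X - Y) b"
      using gen push[OF c(1)] by (metis restrict_chain_linear(1))
    have "\<exists>b'\<in>list_chains X (Suc n). deletion_boundary X b' = c - frag_cmul m z'"
      by (rule lift_boundary[OF _ _ b(1)]) (use c z' b in auto)
    then show "\<exists>m. \<exists>b\<in>list_chains X (Suc n). c = frag_cmul m z' + deletion_boundary X b"
      by (metis add.commute diff_add_cancel)
  next
    fix m b assume "b \<in> list_chains X (Suc n)" "frag_cmul m z' = deletion_boundary X b"
    then show "m = 0" using push[of b "Suc n"] free z'(3) by (metis restrict_chain_linear(4))
  qed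
next
  assume sp: "sphere_lists X n"
  then obtain z where z: "z \<in> list_chains X n" "deletion_boundary X z = 0"
    and gen: "\<And>c. c \<in> list_chains X n \<Longrightarrow> deletion_boundary X c = 0 \<Longrightarrow>
           (\<exists>m. \<exists>b\<in>list_chains X (Suc n). c = frag_cmul m z + deletion_boundary X b)"
    and free: "\<And>m b. b\<in>list_chains X (Suc n) \<Longrightarrow> frag_cmul m z = deletion_boundary X b \<Longrightarrow> m = 0"
    using sphere_listsE by blast
  show "sphere_lists (X - Y) n"
    unfolding sphere_lists_def
  proof (intro conjI bexI[of _ "restrict_chain (X - Y) z"] ballI allI impI)
    show "exact_at (X - Y) k" if "k \<noteq> n" for k using sp that exact_at_quotient_iff by (auto simp: sphere_lists_def)
    show "restrict_chain (X - Y) z \<in> list_chains (X - Y) n"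
      "deletion_boundary (X - Y) (restrict_chain (X - Y) z) = 0" using push[OF z(1)] z(2) by auto
  next
    fix c assume c: "c \<in> list_chains (X - Y) n" "deletion_boundary (X - Y) c = 0"
    then obtain c' where c': "c' \<in> list_chains X n" "deletion_boundary X c' = 0" "restrict_chain (X - Y) c' = c"
      using lift_cycle by blast
    then obtain m b where b: "b\<in>list_chains X (Suc n)" "c' = frag_cmul m z + deletion_boundary X b"
      using gen by blast
    then show "\<exists>m. \<exists>b\<in>list_chains (X - Y) (Suc n). c = frag_cmul m (restrict_chain (X - Y) z) + deletion_boundary (X - Y) b"
      using push[OF b(1)] c'(3) by (metis restrict_chain_linear(2,4))
  next
    fix m b assume b: "b \<in> list_chains (X - Y) (Suc n)"
      "frag_cmul m (restrict_chain (X - Y) z) = deletion_boundary (X - Y) b"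
    have "\<exists>b'\<in>list_chains X (Suc n). deletion_boundary X b' = frag_cmul m z"
      by (rule lift_boundary[OF _ _ b(1)]) (use z b in auto)
    then show "m = 0" using free by metis
  qed
qed

end

lemma acyclic_empty [simp]: "acyclic_lists {}"
  by (auto simp: acyclic_lists_def exact_at_def list_chains_def)

section \<open>Acyclicity criteria and transport of homology\<close>

text \<open>The filtration by \<open>\<mu> \<circ> g\<close> has the fibres of \<open>g\<close> as direct summands of its graded pieces. This is the
  substitute for a spectral sequence: fibres of maximal measure are quotient complexes and can be split off
  one at a time.\<close>

lemma acyclic_by_key:
  fixes g :: "'a list \<Rightarrow> 'k" and \<mu> :: "'k \<Rightarrow> nat"
  assumes "finite X" "convex_lists X"
    and "\<And>l i. l \<in> X \<Longrightarrow> i < length l \<Longrightarrow> delete_nth i l \<in> X \<Longrightarrow>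
           g (delete_nth i l) = g l \<or> \<mu> (g (delete_nth i l)) < \<mu> (g l)"
    and "\<And>k. k \<in> g ` X \<Longrightarrow> acyclic_lists {l \<in> X. g l = k}"
  shows "acyclic_lists X"
  using assms
proof (induction "card (g ` X)" arbitrary: X rule: less_induct)
  case less
  show ?case
  proof (cases "X = {}")
    case False
    let ?M = "Max (\<mu> ` g ` X)"
    have fin: "finite (\<mu> ` g ` X)" "\<mu> ` g ` X \<noteq> {}" using less.prems(1) False by auto
    obtain k where k: "k \<in> g ` X" "\<mu> k = ?M" using Max_in[OF fin] that by (metis imageE)
    have max: "\<mu> (g l) \<le> \<mu> k" if "l \<in> X" for l using k(2) Max_ge[OF fin(1)] that by auto
    define Y where "Y = {l \<in> X. g l \<noteq> k}"
    have sub: "subcomplex Y X"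
      unfolding subcomplex_def Y_def
    proof (intro conjI ballI allI impI)
      fix l i assume l: "l \<in> {l \<in> X. g l \<noteq> k}" "i < length l" "delete_nth i l \<in> X"
      then show "delete_nth i l \<in> {l \<in> X. g l \<noteq> k}"
        using less.prems(3)[of l i] max[of l] by auto
    qed auto
    have "acyclic_lists Y"
    proof (rule less.hyps)
      have "g ` Y \<subseteq> g ` X" "k \<notin> g ` Y" by (auto simp: Y_def)
      then have "g ` Y \<subset> g ` X" using k(1) by blast
      then show "card (g ` Y) < card (g ` X)" using less.prems(1) by (meson finite_imageI psubset_card_mono)
      show "finite Y" using less.prems(1) by (auto simp: Y_def)
      show "convex_lists Y" using subcomplex_convex[OF less.prems(2) sub] by simp
      show "g (delete_nth i l) = g l \<or> \<mu> (g (delete_nth i l)) < \<mu> (g l)"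
        if "l \<in> Y" "i < length l" "delete_nth i l \<in> Y" for l i
        using less.prems(3)[of l i] that by (auto simp: Y_def)
      fix k' assume "k' \<in> g ` Y"
      then have "{l \<in> Y. g l = k'} = {l \<in> X. g l = k'}" "k' \<in> g ` X" by (auto simp: Y_def)
      then show "acyclic_lists {l \<in> Y. g l = k'}" using less.prems(4) by metis
    qed
    moreover have "X - Y = {l \<in> X. g l = k}" by (auto simp: Y_def)
    ultimately show ?thesis
      using acyclic_quotient_iff[OF less.prems(2) sub] less.prems(4)[OF k(1)] by simp
  qed simp
qed

text \<open>Appending the apex \<open>a\<close> with a sign is a contracting homotopy. The apex may occur inside the lists
  of \<open>Y\<close>, only not at their end.\<close>

lemma acyclic_cone:
  assumes sub: "subcomplex Y X" and X: "X = Y \<union> (\<lambda>l. l @ [a]) ` Y"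
    and last: "\<And>l. l \<in> Y \<Longrightarrow> l \<noteq> [] \<Longrightarrow> last l \<noteq> a"
  shows "acyclic_lists X"
proof -
  define h where "h = frag_extend (\<lambda>l. if l \<in> Y then frag_cmul ((-1) ^ length l) (frag_of (l @ [a])) else 0)"
  have h_linear [simp]: "h 0 = 0" "h (b + c) = h b + h c" "h (b - c) = h b - h c"
    "h (frag_cmul m b) = frag_cmul m (h b)" for b c m
    by (simp_all add: h_def frag_extend_add frag_extend_diff frag_extend_cmul)
  have h_sum: "h (sum f I) = (\<Sum>i\<in>I. h (f i))" for f :: "nat \<Rightarrow> _" and I
    by (induction I rule: infinite_finite_induct) auto
  have h_of: "h (frag_of l) = (if l \<in> Y then frag_cmul ((-1) ^ length l) (frag_of (l @ [a])) else 0)" for l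
    by (simp add: h_def)
  have notY: "l @ [a] \<notin> Y" for l using last[of "l @ [a]"] by auto
  have memX: "l @ [a] \<in> X \<longleftrightarrow> l \<in> Y" for l using notY by (auto simp: X)
  have del: "delete_nth i l \<in> X \<longleftrightarrow> delete_nth i l \<in> Y" if "l \<in> Y" "i < length l" for i l
    using sub that by (auto simp: subcomplex_def)
  have db: "deletion_boundary X (frag_of l) = (\<Sum>i<length l.
     if delete_nth i l \<in> Y then frag_cmul ((-1) ^ i) (frag_of (delete_nth i l)) else 0)" if "l \<in> Y" for l
    unfolding deletion_boundary_of by (rule sum.cong) (use del that in auto)
  have dbc: "deletion_boundary X (frag_of (l @ [a])) = (\<Sum>i<length l.
     if delete_nth i l \<in> Y then frag_cmul ((-1) ^ i) (frag_of (delete_nth i l @ [a])) else 0)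
     + frag_cmul ((-1) ^ length l) (frag_of l)" if "l \<in> Y" for l
  proof -
    have "deletion_boundary X (frag_of (l @ [a])) =
      (\<Sum>i<length l. if delete_nth i (l @ [a]) \<in> X then frag_cmul ((-1) ^ i) (frag_of (delete_nth i (l @ [a]))) else 0)
      + (if delete_nth (length l) (l @ [a]) \<in> X then frag_cmul ((-1) ^ length l) (frag_of (delete_nth (length l) (l @ [a]))) else 0)"
      unfolding deletion_boundary_of by simp
    also have "delete_nth (length l) (l @ [a]) = l" using delete_nth_middle[of l a "[]"] by simp
    also have "(\<Sum>i<length l. if delete_nth i (l @ [a]) \<in> X then frag_cmul ((-1) ^ i) (frag_of (delete_nth i (l @ [a]))) else 0)
      = (\<Sum>i<length l. if delete_nth i l \<in> Y then frag_cmul ((-1) ^ i) (frag_of (delete_nth i l @ [a])) else 0)"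
      by (rule sum.cong) (auto simp: delete_nth_append memX)
    finally show ?thesis using that by (simp add: X)
  qed
  have homotopy: "deletion_boundary X (h c) = c - h (deletion_boundary X c)" if "Poly_Mapping.keys c \<subseteq> X" for c
    using that
  proof (rule frag_linear_eqI)
    fix l assume "l \<in> X"
    then consider "l \<in> Y" | l' where "l' \<in> Y" "l = l' @ [a]" by (auto simp: X)
    then show "deletion_boundary X (h (frag_of l)) = frag_of l - h (deletion_boundary X (frag_of l))"
    proof cases
      case 1
      have "h (deletion_boundary X (frag_of l)) = - frag_cmul ((-1) ^ length l) (\<Sum>i<length l.
     if delete_nth i l \<in> Y then frag_cmul ((-1) ^ i) (frag_of (delete_nth i l @ [a])) else 0)"
        unfolding db[OF 1] h_sum frag_cmul_sum sum_negf[symmetric]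
      proof (rule sum.cong[OF refl])
        fix i assume "i \<in> {..<length l}"
        then obtain n where "length l = Suc n" by (cases "length l") auto
        then show "h (if delete_nth i l \<in> Y then frag_cmul ((- 1) ^ i) (frag_of (delete_nth i l)) else 0) =
          - frag_cmul ((- 1) ^ length l) (if delete_nth i l \<in> Y then frag_cmul ((- 1) ^ i) (frag_of (delete_nth i l @ [a])) else 0)"
          using \<open>i \<in> _\<close> by (auto simp: h_of length_delete_nth mult.commute)
      qed
      then show ?thesis
        using 1 dbc[OF 1] by (simp add: h_of frag_cmul_distrib2 flip: power_add)
    next
      case 2
      have "h (deletion_boundary X (frag_of l)) = frag_of l"
      proof -
        have "h (\<Sum>i<length l'. if delete_nth i l' \<in> Y then frag_cmul ((-1) ^ i) (frag_of (delete_nth i l' @ [a])) else 0) = 0"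
          unfolding h_sum by (rule sum.neutral) (auto simp: h_of notY)
        then show ?thesis using 2 dbc[OF 2(1)] by (simp add: h_of flip: power_add)
      qed
      then show ?thesis using 2 notY by (simp add: h_of)
    qed
  qed (auto simp: algebra_simps)
  show ?thesis
    unfolding acyclic_lists_def exact_at_def
  proof (intro allI ballI impI)
    fix k c assume c: "c \<in> list_chains X k" "deletion_boundary X c = 0"
    have "h c \<in> list_chains X (Suc k)"
    proof -
      have "Poly_Mapping.keys (h c) \<subseteq> (\<Union>x\<in>Poly_Mapping.keys c. Poly_Mapping.keys (if x \<in> Y then frag_cmul ((-1) ^ length x) (frag_of (x @ [a])) else 0))"
        unfolding h_def by (rule keys_frag_extend)
      also have "\<dots> \<subseteq> {l \<in> X. length l = Suc k}"
        using c(1) memX by (auto simp: list_chains_def in_keys_iff split: if_splits)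
      finally show ?thesis by (simp add: list_chains_def)
    qed
    moreover have "deletion_boundary X (h c) = c"
      using homotopy[OF chains_keys[OF c(1)]] c(2) by simp
    ultimately show "\<exists>b\<in>list_chains X (Suc k). deletion_boundary X b = c" by blast
  qed
qed

lemma list_chains_trivial: "{l \<in> X. length l = k} = {} \<Longrightarrow> list_chains X k = {0}"
  unfolding list_chains_def by (simp only:) auto

lemma sphere_singleton: "sphere_lists {l} (length l)"
proof -
  have del: "delete_nth i l \<noteq> l" if "i < length l" for i
    using length_delete_nth[OF that] that by (metis diff_less less_irrefl less_one not_less0 gr0I)
  have ch: "list_chains {l} k = {0}" if "k \<noteq> length l" for k
    using that by (intro list_chains_trivial) auto
  have db: "deletion_boundary {l} c = 0" if "Poly_Mapping.keys c \<subseteq> {l}" for c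
    using that by (rule frag_linear_eqI) (auto simp: deletion_boundary_of del intro!: sum.neutral)
  have gen: "c = frag_cmul (Poly_Mapping.lookup c l) (frag_of l)" if "Poly_Mapping.keys c \<subseteq> {l}" for c
    using that by (intro poly_mapping_eqI) (auto simp: lookup_single when_def in_keys_iff)
  show ?thesis
    unfolding sphere_lists_def
  proof (intro conjI allI impI ballI bexI[of _ "frag_of l"])
    fix k assume "k \<noteq> length l"
    then show "exact_at {l} k"
      unfolding exact_at_def using ch list_chains_closed(1) deletion_boundary_linear(1) by (metis singletonD)
  next
    fix m b assume "b \<in> list_chains {l} (Suc (length l))" "frag_cmul m (frag_of l) = deletion_boundary {l} b"
    then show "m = 0" using ch[of "Suc (length l)"] by simp
  next
    fix c assume "c \<in> list_chains {l} (length l)"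
    then have "c = frag_cmul (Poly_Mapping.lookup c l) (frag_of l) + deletion_boundary {l} 0"
      using gen[OF chains_keys] by simp
    then show "\<exists>m. \<exists>b\<in>list_chains {l} (Suc (length l)). c = frag_cmul m (frag_of l) + deletion_boundary {l} b"
      by (metis list_chains_closed(1))
  qed (auto simp: db list_chains_def)
qed

lemma frag_cmul_diff: "frag_cmul c (a - b) = frag_cmul c a - frag_cmul c b"
  by (rule poly_mapping_eqI) (simp add: lookup_minus right_diff_distrib)

text \<open>Chain maps induced by relabelling basis elements; the constant sign \<open>\<sigma>\<close> below comes from a prefix put
  in front of every list, and the shift \<open>s\<close> from the length of what is added.\<close>

definition relabel_chain :: "('a \<Rightarrow> 'b) \<Rightarrow> ('a \<Rightarrow>\<^sub>0 int) \<Rightarrow> 'b \<Rightarrow>\<^sub>0 int" where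
  "relabel_chain h = frag_extend (\<lambda>l. frag_of (h l))"

lemma relabel_chain_linear [simp]:
  "relabel_chain h 0 = 0"
  "relabel_chain h (a + b) = relabel_chain h a + relabel_chain h b"
  "relabel_chain h (a - b) = relabel_chain h a - relabel_chain h b"
  "relabel_chain h (frag_cmul m a) = frag_cmul m (relabel_chain h a)"
  "relabel_chain h (frag_of l) = frag_of (h l)"
  by (simp_all add: relabel_chain_def frag_extend_add frag_extend_diff frag_extend_cmul)

lemma relabel_chain_sum: "relabel_chain Y (sum f I) = (\<Sum>i\<in>I. relabel_chain Y (f i))"
  by (induction I rule: infinite_finite_induct) auto

lemma keys_relabel_chain: "Poly_Mapping.keys (relabel_chain h c) \<subseteq> h ` Poly_Mapping.keys c"
  unfolding relabel_chain_def by (rule order_trans[OF keys_frag_extend]) auto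

context
  fixes h :: "'a list \<Rightarrow> 'b list" and X :: "'a list set" and Y :: "'b list set" and s :: nat and \<sigma> :: int
  assumes bij: "bij_betw h X Y" and len: "\<And>l. l \<in> X \<Longrightarrow> length (h l) = length l + s"
    and bd: "\<And>l. l \<in> X \<Longrightarrow> deletion_boundary Y (frag_of (h l)) =
              frag_cmul \<sigma> (relabel_chain h (deletion_boundary X (frag_of l)))"
    and sign: "\<sigma> * \<sigma> = 1"
begin

private abbreviation (input) "H \<equiv> relabel_chain h"
private abbreviation (input) "H' \<equiv> relabel_chain (inv_into X h)"

private lemma H'_H: "Poly_Mapping.keys c \<subseteq> X \<Longrightarrow> H' (H c) = c"
  using frag_linear_eqI[of c X "\<lambda>c. H' (H c)" "\<lambda>c. c"] bij by (simp add: bij_betw_def)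

private lemma H_H': "Poly_Mapping.keys c \<subseteq> Y \<Longrightarrow> H (H' c) = c"
  using frag_linear_eqI[of c Y "\<lambda>c. H (H' c)" "\<lambda>c. c"] bij by (simp add: bij_betw_def f_inv_into_f)

private lemma H_boundary:
  "Poly_Mapping.keys c \<subseteq> X \<Longrightarrow> deletion_boundary Y (H c) = frag_cmul \<sigma> (H (deletion_boundary X c))"
  using frag_linear_eqI[of c X "\<lambda>c. deletion_boundary Y (H c)" "\<lambda>c. frag_cmul \<sigma> (H (deletion_boundary X c))"]
  by (simp add: bd frag_cmul_diff)

private lemma H_chains: assumes "c \<in> list_chains X k" shows "H c \<in> list_chains Y (k + s)"
proof -
  have "h ` Poly_Mapping.keys c \<subseteq> {l \<in> Y. length l = k + s}"
    using assms bij len by (auto simp: list_chains_def bij_betw_def)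
  then show ?thesis using keys_relabel_chain[of h c] by (auto simp: list_chains_def)
qed

private lemma H'_chains:
  assumes "c \<in> list_chains Y (k + s)" shows "H' c \<in> list_chains X k"
  unfolding list_chains_def
proof (rule CollectI, rule subsetI)
  fix x assume "x \<in> Poly_Mapping.keys (H' c)"
  then obtain y where y: "y \<in> Poly_Mapping.keys c" "x = inv_into X h y"
    using keys_relabel_chain[of "inv_into X h" c] by auto
  then have "y \<in> h ` X" "length y = k + s" using assms bij by (auto simp: list_chains_def bij_betw_def)
  then show "x \<in> {l \<in> X. length l = k}"
    using y(2) len[of x] by (simp add: inv_into_into f_inv_into_f)
qed

private lemma cancel: "frag_cmul \<sigma> (frag_cmul \<sigma> c) = c"
  by (simp add: sign)

private lemma H'_cycle:
  assumes "c \<in> list_chains Y (k + s)" "deletion_boundary Y c = 0"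
  shows "deletion_boundary X (H' c) = 0"
proof -
  let ?c = "H' c"
  have "?c \<in> list_chains X k" using H'_chains assms(1) by blast
  then have "H' (H (deletion_boundary X ?c)) = deletion_boundary X ?c"
    by (intro H'_H chains_keys[OF deletion_boundary_chains'])
  moreover have "frag_cmul \<sigma> (H (deletion_boundary X ?c)) = 0"
    using H_boundary[of ?c] \<open>?c \<in> _\<close> chains_keys H_H'[of c] assms by metis
  then have "H (deletion_boundary X ?c) = 0" using cancel by (metis frag_cmul_zero2)
  ultimately show ?thesis by (metis relabel_chain_linear(1))
qed

lemma exact_at_relabel_iff: "exact_at Y (k + s) \<longleftrightarrow> exact_at X k"
proof
  assume ex: "exact_at X k"
  show "exact_at Y (k + s)" unfolding exact_at_def
  proof (intro ballI impI)
    fix c assume c: "c \<in> list_chains Y (k + s)" "deletion_boundary Y c = 0"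
    obtain b where b: "b \<in> list_chains X (Suc k)" "deletion_boundary X b = H' c"
      using ex H'_cycle[OF c] H'_chains[OF c(1)] unfolding exact_at_def by blast
    have "deletion_boundary Y (frag_cmul \<sigma> (H b)) = c"
      using H_boundary[OF chains_keys[OF b(1)]] b(2) H_H'[OF chains_keys[OF c(1)]] by (simp add: sign)
    then show "\<exists>b\<in>list_chains Y (Suc (k + s)). deletion_boundary Y b = c"
      using H_chains[OF b(1)] by (intro bexI[of _ "frag_cmul \<sigma> (H b)"]) auto
  qed
next
  assume ex: "exact_at Y (k + s)"
  show "exact_at X k" unfolding exact_at_def
  proof (intro ballI impI)
    fix c assume c: "c \<in> list_chains X k" "deletion_boundary X c = 0"
    then have "H c \<in> list_chains Y (k + s)" "deletion_boundary Y (H c) = 0"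
      using H_chains H_boundary[OF chains_keys[OF c(1)]] by auto
    then obtain b where b: "b \<in> list_chains Y (Suc k + s)" "deletion_boundary Y b = H c"
      using ex unfolding exact_at_def by auto
    let ?b = "H' b"
    have b': "?b \<in> list_chains X (Suc k)" by (rule H'_chains[OF b(1)])
    have "frag_cmul \<sigma> (H (deletion_boundary X ?b)) = H c"
      using H_boundary[OF chains_keys[OF b']] H_H'[OF chains_keys[OF b(1)]] b(2) by simp
    then have "H (deletion_boundary X ?b) = H (frag_cmul \<sigma> c)" using cancel by (metis relabel_chain_linear(4))
    then have "deletion_boundary X ?b = frag_cmul \<sigma> c"
      using H'_H[OF chains_keys[OF deletion_boundary_chains'[OF b']]]
        H'_H[of "frag_cmul \<sigma> c"] c(1) chains_keys[OF list_chains_closed(4)[OF c(1)]] by metis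
    then have "deletion_boundary X (frag_cmul \<sigma> ?b) = c" using cancel by simp
    then show "\<exists>b\<in>list_chains X (Suc k). deletion_boundary X b = c"
      using b' by blast
  qed
qed

private lemma exact_at_short: "k < s \<Longrightarrow> exact_at Y k"
proof -
  assume "k < s"
  then have "{l \<in> Y. length l = k} = {}" using bij len by (auto simp: bij_betw_def)
  then have "list_chains Y k = {0}" by (rule list_chains_trivial)
  then show ?thesis
    unfolding exact_at_def using list_chains_closed(1) deletion_boundary_linear(1) by (metis singletonD)
qed

lemma acyclic_relabel_iff: "acyclic_lists Y \<longleftrightarrow> acyclic_lists X"
  unfolding acyclic_lists_def
  using exact_at_relabel_iff exact_at_short by (metis le_add_diff_inverse2 not_le)

lemma sphere_relabel:
  assumes "sphere_lists X n" shows "sphere_lists Y (n + s)"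
proof -
  obtain z where z: "z \<in> list_chains X n" "deletion_boundary X z = 0"
    and gen: "\<And>c. c \<in> list_chains X n \<Longrightarrow> deletion_boundary X c = 0 \<Longrightarrow>
           (\<exists>m. \<exists>b\<in>list_chains X (Suc n). c = frag_cmul m z + deletion_boundary X b)"
    and free: "\<And>m b. b\<in>list_chains X (Suc n) \<Longrightarrow> frag_cmul m z = deletion_boundary X b \<Longrightarrow> m = 0"
    using sphere_listsE[OF assms] by blast
  show ?thesis
    unfolding sphere_lists_def
  proof (intro conjI bexI[of _ "H z"] allI impI ballI)
    show "exact_at Y k" if "k \<noteq> n + s" for k
    proof (cases "k < s")
      case False
      then obtain k' where "k = k' + s" by (metis le_add_diff_inverse2 not_less)
      then show ?thesis using that assms exact_at_relabel_iff by (auto simp: sphere_lists_def)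
    qed (rule exact_at_short)
    show "H z \<in> list_chains Y (n + s)" by (rule H_chains[OF z(1)])
    show "deletion_boundary Y (H z) = 0" using H_boundary[OF chains_keys[OF z(1)]] z(2) by simp
  next
    fix c assume c: "c \<in> list_chains Y (n + s)" "deletion_boundary Y c = 0"
    obtain m b where b: "b \<in> list_chains X (Suc n)" "H' c = frag_cmul m z + deletion_boundary X b"
      using gen H'_cycle[OF c] H'_chains[OF c(1)] by blast
    then have "c = frag_cmul m (H z) + H (deletion_boundary X b)"
      using H_H'[OF chains_keys[OF c(1)]] by (metis relabel_chain_linear(2,4))
    also have "H (deletion_boundary X b) = deletion_boundary Y (frag_cmul \<sigma> (H b))"
      using H_boundary[OF chains_keys[OF b(1)]] by (simp add: sign)
    finally show "\<exists>m. \<exists>b\<in>list_chains Y (Suc (n + s)). c = frag_cmul m (H z) + deletion_boundary Y b"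
      using H_chains[OF b(1)] list_chains_closed(4)[of "H b"] by (metis add_Suc)
  next
    fix m b assume b: "b \<in> list_chains Y (Suc (n + s))" "frag_cmul m (H z) = deletion_boundary Y b"
    let ?b = "H' b"
    have b': "?b \<in> list_chains X (Suc n)" by (rule H'_chains) (use b(1) in simp)
    have "H (frag_cmul m z) = frag_cmul \<sigma> (H (deletion_boundary X ?b))"
      using H_boundary[OF chains_keys[OF b']] H_H'[OF chains_keys[OF b(1)]] b(2) by simp
    also have "\<dots> = H (deletion_boundary X (frag_cmul \<sigma> ?b))" by simp
    finally have "frag_cmul m z = deletion_boundary X (frag_cmul \<sigma> ?b)"
      using H'_H[OF chains_keys[OF list_chains_closed(4)[OF z(1)]]]
        H'_H[OF chains_keys[OF deletion_boundary_chains'[OF list_chains_closed(4)[OF b']]]] by metis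
    then show "m = 0" using free list_chains_closed(4)[OF b'] by blast
  qed
qed

lemma sphere_relabel_iff: "sphere_lists Y (n + s) \<longleftrightarrow> sphere_lists X n"
proof
  assume sp: "sphere_lists Y (n + s)"
  obtain z where z: "z \<in> list_chains Y (n + s)" "deletion_boundary Y z = 0"
    and gen: "\<And>c. c \<in> list_chains Y (n + s) \<Longrightarrow> deletion_boundary Y c = 0 \<Longrightarrow>
           (\<exists>m. \<exists>b\<in>list_chains Y (Suc (n + s)). c = frag_cmul m z + deletion_boundary Y b)"
    and free: "\<And>m b. b\<in>list_chains Y (Suc (n + s)) \<Longrightarrow> frag_cmul m z = deletion_boundary Y b \<Longrightarrow> m = 0"
    using sphere_listsE[OF sp] by blast
  show "sphere_lists X n"
    unfolding sphere_lists_def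
  proof (intro conjI bexI[of _ "H' z"] allI impI ballI)
    show "exact_at X k" if "k \<noteq> n" for k
      using that sp exact_at_relabel_iff[of k] by (simp add: sphere_lists_def)
    show "H' z \<in> list_chains X n" by (rule H'_chains[OF z(1)])
    show "deletion_boundary X (H' z) = 0" by (rule H'_cycle[OF z])
  next
    fix c assume c: "c \<in> list_chains X n" "deletion_boundary X c = 0"
    then have "H c \<in> list_chains Y (n + s)" "deletion_boundary Y (H c) = 0"
      using H_chains H_boundary[OF chains_keys[OF c(1)]] by auto
    then obtain m b where b: "b \<in> list_chains Y (Suc n + s)" "H c = frag_cmul m z + deletion_boundary Y b"
      using gen by (metis add_Suc)
    let ?b = "H' b"
    have b': "?b \<in> list_chains X (Suc n)" by (rule H'_chains[OF b(1)])
    have "deletion_boundary Y b = H (deletion_boundary X (frag_cmul \<sigma> ?b))"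
      using H_boundary[OF chains_keys[OF b']] H_H'[OF chains_keys[OF b(1)]] by simp
    then have "H' (H c) = H' (frag_cmul m z + H (deletion_boundary X (frag_cmul \<sigma> ?b)))" using b(2) by simp
    also have "\<dots> = frag_cmul m (H' z) + H' (H (deletion_boundary X (frag_cmul \<sigma> ?b)))" by (simp only: relabel_chain_linear)
    also have "H' (H (deletion_boundary X (frag_cmul \<sigma> ?b))) = deletion_boundary X (frag_cmul \<sigma> ?b)"
      by (rule H'_H[OF chains_keys[OF deletion_boundary_chains'[OF list_chains_closed(4)[OF b']]]])
    also have "H' (H c) = c" by (rule H'_H[OF chains_keys[OF c(1)]])
    finally show "\<exists>m. \<exists>b\<in>list_chains X (Suc n). c = frag_cmul m (H' z) + deletion_boundary X b"
      using list_chains_closed(4)[OF b'] by blast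
  next
    fix m b assume b: "b \<in> list_chains X (Suc n)" "frag_cmul m (H' z) = deletion_boundary X b"
    have "frag_cmul m z = H (frag_cmul m (H' z))" using H_H'[OF chains_keys[OF z(1)]] by simp
    also have "\<dots> = deletion_boundary Y (frag_cmul \<sigma> (H b))"
      using H_boundary[OF chains_keys[OF b(1)]] b(2) by (simp add: sign)
    finally show "m = 0" using free[of "frag_cmul \<sigma> (H b)" m] H_chains[OF b(1)] by auto
  qed
qed (rule sphere_relabel)

end

text \<open>Used for lists with inert end pieces: only deletions in the middle part contribute.\<close>

lemma sum_window:
  fixes t :: "nat \<Rightarrow> 'a::comm_monoid_add"
  assumes "\<And>i. i < m + n + k \<Longrightarrow> i < m \<or> m + n \<le> i \<Longrightarrow> t i = 0"
  shows "(\<Sum>i<m + n + k. t i) = (\<Sum>j<n. t (m + j))"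
proof -
  have "(\<Sum>i<m + n + k. t i) = sum t ((+) m ` {..<n})"
  proof (rule sum.mono_neutral_right)
    show "\<forall>i\<in>{..<m + n + k} - (+) m ` {..<n}. t i = 0"
    proof
      fix i assume i: "i \<in> {..<m + n + k} - (+) m ` {..<n}"
      have "i < m \<or> m + n \<le> i"
      proof (rule ccontr)
        assume "\<not> (i < m \<or> m + n \<le> i)"
        then have "i = m + (i - m)" "i - m < n" by auto
        then show False using i by blast
      qed
      then show "t i = 0" using i assms by auto
    qed
  qed auto
  also have "\<dots> = (\<Sum>j<n. t (m + j))" by (subst sum.reindex) auto
  finally show ?thesis .
qed

context
  fixes f :: "'a \<Rightarrow> 'b" and X :: "'a list set" and p q :: "'b list"
  assumes inj: "inj_on f (\<Union>l\<in>X. set l)"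
    and disj: "(set p \<union> set q) \<inter> f ` (\<Union>l\<in>X. set l) = {}"
begin

private abbreviation (input) "h \<equiv> \<lambda>l. p @ map f l @ q"

private lemma h_mem: "h l \<in> h ` X \<longleftrightarrow> l \<in> X" if "set l \<subseteq> (\<Union>l\<in>X. set l)"
proof
  assume "h l \<in> h ` X"
  then obtain l' where "l' \<in> X" "map f l = map f l'" by auto
  moreover have "inj_on f (set l \<union> set l')" using inj that \<open>l' \<in> X\<close> by (elim inj_on_subset) auto
  ultimately show "l \<in> X" using inj_on_map_eq_map by metis
qed auto

private lemma padding_count:
  assumes "l \<in> X" shows "filter (\<lambda>x. x \<in> set p \<union> set q) (map f l) = []"
  using assms disj by (fastforce simp: filter_empty_conv)

private lemma delete_padding:
  assumes "l \<in> X" "i < length p \<or> length p + length l \<le> i" "i < length p + length l + length q"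
  shows "delete_nth i (h l) \<notin> h ` X"
proof
  assume "delete_nth i (h l) \<in> h ` X"
  then obtain l' where l': "l' \<in> X" "delete_nth i (h l) = h l'" by auto
  let ?P = "\<lambda>x. x \<in> set p \<union> set q"
  have "filter ?P (h l') = p @ q" using padding_count[OF l'(1)] by simp
  moreover have "length (filter ?P (delete_nth i (h l))) < length (p @ q)"
  proof (cases "i < length p")
    case True
    have "filter ?P (delete_nth i (h l)) = filter ?P (delete_nth i p) @ q"
      using padding_count[OF assms(1)] True by (simp add: delete_nth_append)
    moreover have "length (filter ?P (delete_nth i p)) < length p"
      using length_delete_nth[OF True] True le_less_trans[OF length_filter_le] by (metis diff_less gr_implies_not0 less_one neq0_conv)
    ultimately show ?thesis by simp
  next
    case False
    let ?j = "i - length p - length l"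
    have j: "?j < length q" "delete_nth i (h l) = p @ map f l @ delete_nth ?j q"
      using False assms(2,3) by (auto simp: delete_nth_append)
    have "filter ?P (delete_nth i (h l)) = p @ filter ?P (delete_nth ?j q)"
      using padding_count[OF assms(1)] j(2) by simp
    moreover have "length (filter ?P (delete_nth ?j q)) < length q"
      using length_delete_nth[OF j(1)] j(1) le_less_trans[OF length_filter_le] by (metis diff_less gr_implies_not0 less_one neq0_conv)
    ultimately show ?thesis by simp
  qed
  ultimately show False using l'(2) by simp
qed

private lemma pad_boundary:
  assumes "l \<in> X"
  shows "deletion_boundary (h ` X) (frag_of (h l)) =
     frag_cmul ((-1) ^ length p) (relabel_chain h (deletion_boundary X (frag_of l)))"
proof -
  let ?t = "\<lambda>i. if delete_nth i (h l) \<in> h ` X then frag_cmul ((-1) ^ i) (frag_of (delete_nth i (h l))) else 0"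
  have "deletion_boundary (h ` X) (frag_of (h l)) = (\<Sum>i<length p + length l + length q. ?t i)"
    by (simp add: deletion_boundary_of add.assoc)
  also have "\<dots> = (\<Sum>j<length l. ?t (length p + j))"
    by (rule sum_window) (use delete_padding[OF assms] in simp)
  also have "\<dots> = (\<Sum>j<length l. frag_cmul ((-1) ^ length p)
      (relabel_chain h (if delete_nth j l \<in> X then frag_cmul ((-1) ^ j) (frag_of (delete_nth j l)) else 0)))"
  proof (rule sum.cong[OF refl])
    fix j assume j: "j \<in> {..<length l}"
    have eq: "delete_nth (length p + j) (h l) = h (delete_nth j l)"
      using j by (simp add: delete_nth_append delete_nth_map)
    have "set (delete_nth j l) \<subseteq> (\<Union>l\<in>X. set l)" using assms set_delete_nth[of j l] by blast
    note mem = h_mem[OF this]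
    show "?t (length p + j) = frag_cmul ((-1) ^ length p)
      (relabel_chain h (if delete_nth j l \<in> X then frag_cmul ((-1) ^ j) (frag_of (delete_nth j l)) else 0))"
      unfolding eq mem by (simp add: power_add)
  qed
  finally show ?thesis
    by (simp add: deletion_boundary_of relabel_chain_sum frag_cmul_sum)
qed

private lemma pad_bij: "bij_betw h X (h ` X)"
  unfolding bij_betw_def
proof
  show "inj_on h X"
  proof (rule inj_onI)
    fix l l' assume "l \<in> X" "l' \<in> X" "h l = h l'"
    moreover have "inj_on f (set l \<union> set l')" using inj \<open>l \<in> X\<close> \<open>l' \<in> X\<close> by (elim inj_on_subset) auto
    ultimately show "l = l'" using inj_on_map_eq_map by auto
  qed
qed simp

text \<open>Surrounding all lists by fixed words \<open>p\<close> and \<open>q\<close> over other letters only shifts degrees: deleting a letter of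
  \<open>p\<close> or \<open>q\<close> leaves the set, since the number of these letters is constant on it.\<close>

lemma acyclic_pad_iff: "acyclic_lists ((\<lambda>l. p @ map f l @ q) ` X) \<longleftrightarrow> acyclic_lists X"
  by (rule acyclic_relabel_iff[where s = "length p + length q" and \<sigma> = "(-1) ^ length p"])
     (use pad_bij pad_boundary in \<open>auto simp flip: power_add mult_2\<close>)

lemma sphere_pad_iff:
  "sphere_lists ((\<lambda>l. p @ map f l @ q) ` X) (n + (length p + length q)) \<longleftrightarrow> sphere_lists X n"
  by (rule sphere_relabel_iff[where \<sigma> = "(-1) ^ length p"])
     (use pad_bij pad_boundary in \<open>auto simp flip: power_add mult_2\<close>)

end

section \<open>Flags of sets and joined complexes\<close>

text \<open>The augmented order complex of a family of sets under inclusion, with flags written from the largest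
  set down; the empty flag accounts for the augmentation.\<close>

definition order_chains :: "'e set set \<Rightarrow> 'e set list set" where
  "order_chains P = {z. sorted_wrt (\<lambda>A B. B \<subset> A) z \<and> set z \<subseteq> P}"

lemma order_chains_append:
  "x @ y \<in> order_chains P \<longleftrightarrow> x \<in> order_chains P \<and> y \<in> order_chains P \<and> (\<forall>A\<in>set x. \<forall>B\<in>set y. B \<subset> A)"
  by (auto simp: order_chains_def sorted_wrt_append)

lemma order_chains_Cons:
  "A # y \<in> order_chains P \<longleftrightarrow> A \<in> P \<and> y \<in> order_chains P \<and> (\<forall>B\<in>set y. B \<subset> A)"
  by (auto simp: order_chains_def)

lemma order_chains_Nil [simp]: "[] \<in> order_chains P"
  by (auto simp: order_chains_def)

lemma order_chains_delete_nth:
  assumes "z \<in> order_chains P" shows "delete_nth i z \<in> order_chains P"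
proof (cases "i < length z")
  case True
  then obtain xs a ys where "z = xs @ a # ys" "delete_nth i z = xs @ ys" using split_at_delete_nth by metis
  then show ?thesis using assms by (auto simp: order_chains_append order_chains_Cons)
qed (use assms in \<open>simp add: delete_nth_def\<close>)

lemma order_chains_mono: "P \<subseteq> Q \<Longrightarrow> order_chains P \<subseteq> order_chains Q"
  by (auto simp: order_chains_def)

lemma convex_order_chains: "convex_lists (order_chains P)"
  by (auto simp: convex_lists_def order_chains_delete_nth)

lemma finite_order_chains:
  assumes "finite P" shows "finite (order_chains P)"
proof (rule finite_subset)
  have "distinct z" if "sorted_wrt (\<lambda>A B. B \<subset> A) z" for z :: "'a set list"
    using that by (induction z) auto
  then show "order_chains P \<subseteq> {z. set z \<subseteq> P \<and> distinct z}" by (auto simp: order_chains_def)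
  show "finite {z. set z \<subseteq> P \<and> distinct z}" using assms by (rule finite_subset_distinct)
qed

text \<open>Paths and flags are put into one list over a sum type. Both parts can be recovered, and every
  deletion takes place in exactly one of them.\<close>

definition joined :: "'a list \<Rightarrow> 'b list \<Rightarrow> ('a + 'b) list" where
  "joined x z = map Inl x @ map Inr z"

definition left_part :: "('a + 'b) list \<Rightarrow> 'a list" where "left_part w = map projl (filter isl w)"
definition right_part :: "('a + 'b) list \<Rightarrow> 'b list" where "right_part w = map projr (filter (\<lambda>c. \<not> isl c) w)"

lemma joined_parts [simp]:
  "left_part (joined x z) = x" "right_part (joined x z) = z" "length (joined x z) = length x + length z"
  by (simp_all add: left_part_def right_part_def joined_def filter_map o_def)

lemma joined_eq_iff [simp]: "joined x z = joined x' z' \<longleftrightarrow> x = x' \<and> z = z'"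
  by (metis joined_parts(1,2))

lemma delete_joined_cases:
  assumes "i < length (joined x z)"
  obtains "i < length x" "delete_nth i (joined x z) = joined (delete_nth i x) z"
  | j where "j < length z" "delete_nth i (joined x z) = joined x (delete_nth j z)"
proof (cases "i < length x")
  case True then show ?thesis using that(1) by (simp add: joined_def delete_nth_append delete_nth_map)
next
  case False then show ?thesis using that(2)[of "i - length x"] assms
    by (simp add: joined_def delete_nth_append delete_nth_map)
qed

text \<open>A family of flag complexes over a complex \<open>X\<close>. If deletions in \<open>X\<close> only enlarge the families, it is
  again a complex.\<close>

definition joined_complex :: "'a list set \<Rightarrow> ('a list \<Rightarrow> 'e set set) \<Rightarrow> ('a + 'e set) list set" where
  "joined_complex X Q = {joined x z | x z. x \<in> X \<and> z \<in> order_chains (Q x)}"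

lemma joined_in_complex [simp]: "joined x z \<in> joined_complex X Q \<longleftrightarrow> x \<in> X \<and> z \<in> order_chains (Q x)"
  by (auto simp: joined_complex_def)

lemma joined_complexE:
  assumes "w \<in> joined_complex X Q" obtains x z where "w = joined x z" "x \<in> X" "z \<in> order_chains (Q x)"
  using assms by (auto simp: joined_complex_def)

definition growing_family :: "'a list set \<Rightarrow> ('a list \<Rightarrow> 'e set set) \<Rightarrow> bool" where
  "growing_family X Q \<longleftrightarrow> (\<forall>x\<in>X. \<forall>i<length x. delete_nth i x \<in> X \<longrightarrow> Q x \<subseteq> Q (delete_nth i x))"

lemma convex_joined_complex:
  assumes X: "convex_lists X" and Q: "growing_family X Q"
  shows "convex_lists (joined_complex X Q)"
  unfolding convex_lists_def
proof (intro ballI allI impI)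
  fix w i j assume w: "w \<in> joined_complex X Q" and i: "i < length w" and j: "j < length w - 1"
    and dd: "delete_nth j (delete_nth i w) \<in> joined_complex X Q"
  obtain x z where xz: "w = joined x z" "x \<in> X" "z \<in> order_chains (Q x)" using joined_complexE[OF w] .
  have lenj: "j < length (delete_nth i w)" using i j by (simp add: length_delete_nth)
  have mono: "order_chains (Q x) \<subseteq> order_chains (Q (delete_nth k x))" if "k < length x" "delete_nth k x \<in> X" for k
    using that Q xz(2) by (auto simp: growing_family_def intro!: order_chains_mono)
  show "delete_nth i w \<in> joined_complex X Q"
    using i[unfolded xz(1)]
  proof (cases rule: delete_joined_cases)
    case 1
    have "delete_nth i x \<in> X"
      using lenj[unfolded xz(1) 1(2)]
    proof (cases rule: delete_joined_cases)
      case inner: 1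
      then show ?thesis using dd 1 X xz(2) unfolding xz(1) convex_lists_def
        by (auto simp: length_delete_nth)
    next
      case (2 k)
      then show ?thesis using dd 1 by (simp add: xz(1))
    qed
    then show ?thesis using 1 xz mono[of i] by auto
  next
    case (2 k)
    then show ?thesis using xz by (simp add: order_chains_delete_nth)
  qed
qed

lemma finite_joined_complex:
  assumes "finite X" "\<And>x. x \<in> X \<Longrightarrow> finite (Q x)"
  shows "finite (joined_complex X Q)"
proof -
  have "joined_complex X Q = (\<Union>x\<in>X. joined x ` order_chains (Q x))" by (auto simp: joined_complex_def)
  then show ?thesis using assms by (auto intro!: finite_order_chains)
qed

text \<open>Deletions in the left part shorten it and deletions in the right part preserve it, so the left part is
  a key for the filtration; symmetrically for the right part.\<close>

lemma acyclic_by_left_part: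
  fixes W :: "('a + 'e set) list set"
  assumes "finite W" "convex_lists W"
    and W: "\<And>w. w \<in> W \<Longrightarrow> \<exists>x z. w = joined x z"
    and fibres: "\<And>x. x \<in> left_part ` W \<Longrightarrow> acyclic_lists {z. joined x z \<in> W}"
  shows "acyclic_lists W"
proof (rule acyclic_by_key[where g = left_part and \<mu> = length])
  fix w i assume wi: "w \<in> W" "i < length w" "delete_nth i w \<in> W"
  then obtain x z where xz: "w = joined x z" using W by blast
  show "left_part (delete_nth i w) = left_part w \<or> length (left_part (delete_nth i w)) < length (left_part w)"
    using wi(2)[unfolded xz] by (cases rule: delete_joined_cases) (auto simp: xz length_delete_nth)
next
  fix x assume x: "x \<in> left_part ` W"
  let ?F = "{z. joined x z \<in> W}"
  have "{w \<in> W. left_part w = x} = (\<lambda>z. map Inl x @ map Inr z @ []) ` ?F"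
    using W by (fastforce simp: joined_def[symmetric])
  moreover have "acyclic_lists ((\<lambda>z. map Inl x @ map Inr z @ []) ` ?F)"
    by (subst acyclic_pad_iff) (use fibres[OF x] in \<open>auto simp: inj_on_def\<close>)
  ultimately show "acyclic_lists {w \<in> W. left_part w = x}" by simp
qed (use assms in auto)

lemma acyclic_by_right_part:
  fixes W :: "('a + 'e set) list set"
  assumes "finite W" "convex_lists W"
    and W: "\<And>w. w \<in> W \<Longrightarrow> \<exists>x z. w = joined x z"
    and fibres: "\<And>z. z \<in> right_part ` W \<Longrightarrow> acyclic_lists {x. joined x z \<in> W}"
  shows "acyclic_lists W"
proof (rule acyclic_by_key[where g = right_part and \<mu> = length])
  fix w i assume wi: "w \<in> W" "i < length w" "delete_nth i w \<in> W"
  then obtain x z where xz: "w = joined x z" using W by blast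
  show "right_part (delete_nth i w) = right_part w \<or> length (right_part (delete_nth i w)) < length (right_part w)"
    using wi(2)[unfolded xz] by (cases rule: delete_joined_cases) (auto simp: xz length_delete_nth)
next
  fix z assume z: "z \<in> right_part ` W"
  let ?F = "{x. joined x z \<in> W}"
  have "{w \<in> W. right_part w = z} = (\<lambda>x. [] @ map Inl x @ map Inr z) ` ?F"
    using W by (fastforce simp: joined_def[symmetric])
  moreover have "acyclic_lists ((\<lambda>x. [] @ map Inl x @ map Inr z) ` ?F)"
    by (subst acyclic_pad_iff) (use fibres[OF z] in \<open>auto simp: inj_on_def\<close>)
  ultimately show "acyclic_lists {w \<in> W. right_part w = z}" by simp
qed (use assms in auto)

context
  fixes P N :: "'e set set" and G' :: "'e set"
  assumes fin: "finite P" and N: "N \<subseteq> P" "G' \<in> N" and least: "\<And>Z. Z \<in> N \<Longrightarrow> G' \<subseteq> Z"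
    and up: "\<And>Y Z. Y \<in> N \<Longrightarrow> Z \<in> P \<Longrightarrow> Y \<subset> Z \<Longrightarrow> Z \<in> N"
    and minimal: "\<And>Y. Y \<in> P \<Longrightarrow> \<not> Y \<subset> G'"
begin

text \<open>The part of a flag that lies in \<open>N\<close> comes first, because \<open>N\<close> is closed upwards. Filtering by this part leaves
  flags in \<open>P - N\<close> below its smallest set, or arbitrary flags in \<open>P - N\<close> if it is empty.\<close>

lemma acyclic_punctured:
  assumes L: "acyclic_lists (order_chains (P - N))"
    and lower: "\<And>Z. Z \<in> N \<Longrightarrow> Z \<noteq> G' \<Longrightarrow> acyclic_lists (order_chains {Y \<in> P - N. Y \<subset> Z})"
  shows "acyclic_lists (order_chains (P - {G'}))"
proof (rule acyclic_by_key[where g = "filter (\<lambda>Z. Z \<in> N)" and \<mu> = length])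
  show "finite (order_chains (P - {G'}))" using fin by (intro finite_order_chains) simp
  fix z :: "'e set list" and i assume "i < length z"
  then obtain xs a ys where "z = xs @ a # ys" "delete_nth i z = xs @ ys" using split_at_delete_nth by metis
  then show "filter (\<lambda>Z. Z \<in> N) (delete_nth i z) = filter (\<lambda>Z. Z \<in> N) z \<or>
    length (filter (\<lambda>Z. Z \<in> N) (delete_nth i z)) < length (filter (\<lambda>Z. Z \<in> N) z)" by auto
next
  fix k assume k: "k \<in> filter (\<lambda>Z. Z \<in> N) ` order_chains (P - {G'})"
  let ?F = "{z \<in> order_chains (P - {G'}). filter (\<lambda>Z. Z \<in> N) z = k}"
  let ?L = "if k = [] then P - N else {Y \<in> P - N. Y \<subset> last k}"
  have kOC: "k \<in> order_chains (P - {G'})" "set k \<subseteq> N"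
    using k by (auto simp: order_chains_def sorted_wrt_filter)
  have split: "\<exists>y. z = filter (\<lambda>Z. Z \<in> N) z @ y \<and> set y \<inter> N = {}" if "z \<in> order_chains P" for z
    using that
  proof (induction z)
    case (Cons A z)
    then obtain y where y: "z = filter (\<lambda>Z. Z \<in> N) z @ y" "set y \<inter> N = {}"
      by (auto simp: order_chains_Cons)
    show ?case
    proof (cases "A \<in> N")
      case True then show ?thesis using y by auto
    next
      case False
      have "B \<notin> N" if "B \<in> set z" for B using Cons.prems that False up by (auto simp: order_chains_Cons)
      then show ?thesis using False by (auto simp: filter_empty_conv)
    qed
  qed simp
  have "?F = (\<lambda>y. k @ map id y @ []) ` order_chains ?L"
  proof (intro equalityI subsetI)
    fix z assume z: "z \<in> ?F"
    then obtain y where y: "z = k @ y" "set y \<inter> N = {}"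
      using split[of z] order_chains_mono[of "P - {G'}" P] by blast
    then have "k @ y \<in> order_chains (P - {G'})" using z by auto
    then have y3: "set y \<subseteq> P" "\<forall>A\<in>set k. \<forall>B\<in>set y. B \<subset> A" "y \<in> order_chains (P - {G'})"
      by (auto simp: order_chains_append) (auto simp: order_chains_def)
    have "B \<in> ?L" if B: "B \<in> set y" for B
    proof -
      have "B \<in> P - N" using B y(2) y3(1) by blast
      moreover have "B \<subset> last k" if "k \<noteq> []" using bspec[OF bspec[OF y3(2) last_in_set[OF that]] B] .
      ultimately show ?thesis by (cases "k = []") simp_all
    qed
    then have "set y \<subseteq> ?L" by (rule subsetI)
    then have "y \<in> order_chains ?L" using y3(3) by (simp add: order_chains_def)
    then show "z \<in> (\<lambda>y. k @ map id y @ []) ` order_chains ?L" using y by auto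
  next
    fix z assume "z \<in> (\<lambda>y. k @ map id y @ []) ` order_chains ?L"
    then obtain y where y: "z = k @ y" "y \<in> order_chains ?L" by auto
    have yset: "set y \<subseteq> ?L" using y(2) by (simp add: order_chains_def)
    have "B \<subset> A" if "A \<in> set k" "B \<in> set y" for A B
    proof -
      have "B \<subset> last k" using that yset by (auto split: if_splits)
      moreover have "last k \<subseteq> A"
      proof -
        have "k = butlast k @ [last k]" using that by (metis append_butlast_last_id empty_iff empty_set)
        then show ?thesis using kOC(1) that
          by (metis (no_types, lifting) order_chains_append Un_iff empty_iff empty_set insert_iff list.simps(15) order.refl order.strict_implies_order set_append)
      qed
      ultimately show ?thesis by blast
    qed
    moreover have "set y \<subseteq> P - {G'}" "set y \<inter> N = {}" using yset N by (auto split: if_splits)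
    moreover have "filter (\<lambda>Z. Z \<in> N) y = []" using calculation by (auto simp: filter_empty_conv)
    moreover have "filter (\<lambda>Z. Z \<in> N) k = k" using kOC(2) by (auto simp: filter_id_conv)
    ultimately show "z \<in> ?F" using y kOC(1) by (auto simp: order_chains_append) (auto simp: order_chains_def)
  qed
  moreover have "acyclic_lists ((\<lambda>y. k @ map id y @ []) ` order_chains ?L)"
  proof (subst acyclic_pad_iff)
    show "(set k \<union> set []) \<inter> id ` (\<Union>l\<in>order_chains ?L. set l) = {}"
      using kOC(2) by (auto simp: order_chains_def split: if_splits)
    show "acyclic_lists (order_chains ?L)"
    proof (cases "k = []")
      case False
      then have "last k \<in> N" "last k \<noteq> G'" using kOC by (auto simp: order_chains_def subset_iff)
      then show ?thesis using False lower by simp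
    qed (use L in simp)
  qed simp
  ultimately show "acyclic_lists ?F" by simp
qed (rule convex_order_chains)

text \<open>Nothing in \<open>P\<close> lies below the least set \<open>G'\<close> of \<open>N\<close>, so \<open>G'\<close> ends each flag through it.\<close>

lemma order_chains_through_least:
  "order_chains P - order_chains (P - {G'}) = (\<lambda>z. z @ [G']) ` order_chains (N - {G'})"
proof (intro equalityI subsetI)
  fix z assume z: "z \<in> order_chains P - order_chains (P - {G'})"
  then have "G' \<in> set z" by (auto simp: order_chains_def)
  then obtain xs ys where xy: "z = xs @ G' # ys" by (meson split_list)
  have "ys = []"
    using z xy minimal by (cases ys) (auto simp: order_chains_append order_chains_Cons)
  moreover have "xs \<in> order_chains (N - {G'})"
    using z xy up[OF N(2)] by (auto simp: order_chains_append order_chains_Cons) (auto simp: order_chains_def)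
  ultimately show "z \<in> (\<lambda>z. z @ [G']) ` order_chains (N - {G'})" using xy by auto
next
  fix z assume "z \<in> (\<lambda>z. z @ [G']) ` order_chains (N - {G'})"
  then obtain y where y: "z = y @ [G']" "y \<in> order_chains (N - {G'})" by auto
  then have "G' \<subset> A" if "A \<in> set y" for A using that least by (fastforce simp: order_chains_def)
  then show "z \<in> order_chains P - order_chains (P - {G'})"
    using y N by (auto simp: order_chains_append order_chains_Cons) (auto simp: order_chains_def)
qed

lemma acyclic_with_least:
  assumes "acyclic_lists (order_chains (P - N))"
    and "\<And>Z. Z \<in> N \<Longrightarrow> Z \<noteq> G' \<Longrightarrow> acyclic_lists (order_chains {Y \<in> P - N. Y \<subset> Z})"
    and "acyclic_lists (order_chains (N - {G'}))"
  shows "acyclic_lists (order_chains P)"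
proof -
  have sub: "subcomplex (order_chains (P - {G'})) (order_chains P)"
    by (auto simp: subcomplex_def order_chains_delete_nth intro: order_chains_mono[THEN subsetD, rotated])
  have "acyclic_lists ((\<lambda>z. [] @ map id z @ [G']) ` order_chains (N - {G'}))"
    by (subst acyclic_pad_iff) (use assms(3) in \<open>auto simp: order_chains_def\<close>)
  then show ?thesis
    using acyclic_quotient_iff[OF convex_order_chains sub acyclic_punctured[OF assms(1,2)]]
    by (simp add: order_chains_through_least)
qed

end

section \<open>Linear functionals and ranks\<close>

text \<open>Induction on \<open>F\<close>: if \<open>a\<close> does not vanish at some common zero \<open>v\<close> of the other functionals, then
  subtracting \<open>(f v / a v) a\<close> from \<open>f\<close> removes the dependence on \<open>a\<close>.\<close>

lemma functional_in_span_if_kernel: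
  fixes f :: "'v::real_vector \<Rightarrow> real"
  assumes "finite F" "\<And>g. g \<in> F \<Longrightarrow> linear g" "linear f"
    and "\<And>v. (\<And>g. g \<in> F \<Longrightarrow> g v = 0) \<Longrightarrow> f v = 0"
  shows "f \<in> functional.span F"
  using assms
proof (induction F arbitrary: f rule: finite_induct)
  case empty
  then have "f = 0" by auto
  then show ?case by (metis functional.span_zero)
next
  case (insert a F)
  show ?case
  proof (cases "\<exists>v. (\<forall>g\<in>F. g v = 0) \<and> a v \<noteq> 0")
    case False
    have "f \<in> functional.span F"
    proof (rule insert.IH)
      fix v assume v: "\<And>g. g \<in> F \<Longrightarrow> g v = 0"
      then have "a v = 0" using False by blast
      then show "f v = 0" using v by (intro insert.prems(3)) auto
    qed (use insert.prems in auto)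
    then show ?thesis using functional.span_mono[of F "insert a F"] by auto
  next
    case True
    then obtain v where v: "\<forall>g\<in>F. g v = 0" "a v \<noteq> 0" by blast
    define c where "c = f v / a v"
    let ?f = "\<lambda>x. f x - c * a x"
    have lin: "linear g" if "g \<in> F" for g using that insert.prems by auto
    have "linear a" using insert.prems by auto
    have "?f \<in> functional.span F"
    proof (rule insert.IH)
      show "linear ?f"
        using linear_compose_sub[OF \<open>linear f\<close> linear_compose_scale_right[OF \<open>linear a\<close>, of c]] by simp
      fix w assume w: "\<And>g. g \<in> F \<Longrightarrow> g w = 0"
      let ?u = "w - (a w / a v) *\<^sub>R v"
      have "f ?u = 0"
      proof (rule insert.prems(3))
        fix g assume "g \<in> insert a F"
        then show "g ?u = 0"
          using v w \<open>linear a\<close> lin by (auto simp: linear_diff linear_scale)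
      qed
      then show "?f w = 0"
        using \<open>linear f\<close> v(2) by (simp add: linear_diff linear_scale c_def field_simps)
    qed (use insert.prems in auto)
    then have "?f \<in> functional.span (insert a F)"
      using functional.span_mono[of F "insert a F"] by blast
    moreover have "(\<lambda>x. c * a x) \<in> functional.span (insert a F)"
      by (intro functional.span_scale functional.span_base) simp
    ultimately have "(\<lambda>x. c * a x) + ?f \<in> functional.span (insert a F)"
      by (rule functional.span_add[rotated])
    moreover have "(\<lambda>x. c * a x) + ?f = f" by (auto simp: fun_eq_iff)
    ultimately show ?thesis by metis
  qed
qed

lemma functional_dim_insert:
  assumes "finite F" "f \<notin> functional.span F"
  shows "functional.dim (functional.span (insert f F)) = Suc (functional.dim (functional.span F))"
proof -
  obtain B where B: "B \<subseteq> F" "\<not> functional.dependent B" "F \<subseteq> functional.span B"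
    using functional.maximal_independent_subset[of F] by blast
  have span: "functional.span B = functional.span F"
    using B functional.span_superset[of F] by (subst functional.span_eq) auto
  have ind: "\<not> functional.dependent (insert f B)"
    using B(2) assms(2) by (simp add: functional.independent_insert span)
  have "f \<notin> B" using assms(2) B(1) functional.span_base by blast
  have "finite B" using B(1) assms(1) finite_subset by blast
  have "functional.span (insert f B) = functional.span (insert f F)"
    using span by (simp add: functional.span_insert)
  then have "functional.dim (functional.span (insert f F)) = card (insert f B)"
    using functional.dim_eq_card[OF _ ind] by (metis functional.dim_span)
  moreover have "functional.dim (functional.span F) = card B"
    using functional.dim_eq_card[OF span B(2)] by simp
  ultimately show ?thesis using \<open>f \<notin> B\<close> \<open>finite B\<close> by simp
qed

section \<open>Faces of a cone and the first crossing of a segment\<close>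

lemma small_perturbation:
  fixes a b :: "'e \<Rightarrow> real"
  assumes "finite F" "\<And>e. e \<in> F \<Longrightarrow> 0 < a e"
  obtains \<epsilon> where "0 < \<epsilon>" "\<And>e. e \<in> F \<Longrightarrow> 0 < a e + \<epsilon> * b e"
proof -
  have "\<exists>\<epsilon>>0. \<forall>\<delta>. 0 < \<delta> \<and> \<delta> \<le> \<epsilon> \<longrightarrow> (\<forall>e\<in>F. 0 < a e + \<delta> * b e)"
    using assms
  proof (induction F rule: finite_induct)
    case (insert x F)
    then obtain \<epsilon> where \<epsilon>: "\<epsilon> > 0" "\<forall>\<delta>. 0 < \<delta> \<and> \<delta> \<le> \<epsilon> \<longrightarrow> (\<forall>e\<in>F. 0 < a e + \<delta> * b e)" by auto
    define k where "k = \<bar>b x\<bar> + 1"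
    have k: "0 < k" "\<bar>b x\<bar> \<le> k" by (auto simp: k_def)
    let ?\<eta> = "min \<epsilon> (a x / (2 * k))"
    have ax: "0 < a x" using insert by auto
    have "0 < a x + \<delta> * b x" if "0 < \<delta>" "\<delta> \<le> ?\<eta>" for \<delta>
    proof -
      have "\<delta> * \<bar>b x\<bar> \<le> a x / (2 * k) * k"
        using that ax k by (intro mult_mono) auto
      also have "\<dots> = a x / 2" using k(1) by simp
      finally have "\<delta> * \<bar>b x\<bar> < a x" using ax by simp
      moreover have "- (\<delta> * \<bar>b x\<bar>) \<le> \<delta> * b x" using that by (metis abs_ge_minus_self abs_mult abs_of_pos minus_le_iff)
      ultimately show ?thesis by linarith
    qed
    moreover have "0 < ?\<eta>" using \<epsilon>(1) ax k(1) by simp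
    ultimately show ?case using \<epsilon>(2) by (intro exI[of _ ?\<eta>]) auto
  qed (auto intro: exI[of _ 1])
  then show ?thesis using that by blast
qed

text \<open>The faces of the cone \<open>{y. \<forall>e\<in>E. 0 \<le> \<psi> e y}\<close>, each recorded as the set of functionals vanishing on it. Larger
  sets belong to smaller faces, and the relative interior of the face is the set of witnesses \<open>y\<close>.\<close>

definition faces :: "'e set \<Rightarrow> ('e \<Rightarrow> 'v \<Rightarrow> real) \<Rightarrow> 'e set set" where
  "faces E \<psi> = {Z. Z \<subseteq> E \<and> (\<exists>y. (\<forall>e\<in>Z. \<psi> e y = 0) \<and> (\<forall>e\<in>E - Z. 0 < \<psi> e y))}"

text \<open>The point lies in the span of the face \<open>G\<close> and on no other hyperplane.\<close>

definition generic_on :: "'e set \<Rightarrow> ('e \<Rightarrow> 'v \<Rightarrow> real) \<Rightarrow> 'e set \<Rightarrow> 'v \<Rightarrow> bool" where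
  "generic_on E \<psi> G x \<longleftrightarrow> (\<forall>e\<in>G. \<psi> e x = 0) \<and> (\<forall>e\<in>E - G. \<psi> e x \<noteq> 0)"

definition negative_set :: "'e set \<Rightarrow> ('e \<Rightarrow> 'v \<Rightarrow> real) \<Rightarrow> 'v \<Rightarrow> 'e set" where
  "negative_set E \<psi> x = {e \<in> E. \<psi> e x < 0}"

text \<open>The functionals in \<open>T\<close> are proportional on the subspace cut out by \<open>G\<close>.\<close>

definition parallel_on :: "('e \<Rightarrow> 'v \<Rightarrow> real) \<Rightarrow> 'e set \<Rightarrow> 'e set \<Rightarrow> bool" where
  "parallel_on \<psi> G T \<longleftrightarrow> (\<forall>v. (\<forall>g\<in>G. \<psi> g v = 0) \<longrightarrow> (\<forall>e\<in>T. \<forall>f\<in>T. \<psi> e v = 0 \<longrightarrow> \<psi> f v = 0))"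

lemma finite_faces: "finite E \<Longrightarrow> finite (faces E \<psi>)"
  by (rule finite_subset[of _ "Pow E"]) (auto simp: faces_def)

context
  fixes E :: "'e set" and \<psi> :: "'e \<Rightarrow> 'v::real_vector \<Rightarrow> real"
  assumes fin: "finite E" and lin: "\<And>e. e \<in> E \<Longrightarrow> linear (\<psi> e)"
begin

text \<open>Walk inside the span of \<open>G\<close> from \<open>x\<close> towards the cone, and let \<open>T\<close> be a minimal set of negative
  functionals that can be made positive; \<open>q\<close> is the point where the hyperplanes of \<open>T\<close> are crossed. Minimality
  forces all of \<open>T\<close> to be crossed simultaneously, since otherwise stopping between two crossings would give a
  smaller set. This persists under perturbation of the far end point \<open>x'\<close>, so the functionals in \<open>T\<close> are
  proportional on the span of \<open>G\<close>. Parallel hyperplanes have to be allowed here, as they arise by restriction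
  to \<open>G\<close> even in a simple arrangement.\<close>

lemma first_crossing:
  assumes G: "G \<in> faces E \<psi>" and x: "generic_on E \<psi> G x" and S: "negative_set E \<psi> x \<noteq> {}"
  obtains T x' q where "T \<noteq> {}" "T \<subseteq> negative_set E \<psi> x" "generic_on E \<psi> G x'"
    "negative_set E \<psi> x' = negative_set E \<psi> x - T" "parallel_on \<psi> G T"
    "\<forall>e\<in>G \<union> T. \<psi> e q = 0" "\<forall>e\<in>E - (G \<union> T). sgn (\<psi> e q) = sgn (\<psi> e x)"
proof -
  let ?neg = "negative_set E \<psi>"
  obtain g where g: "\<forall>e\<in>G. \<psi> e g = 0" "\<forall>e\<in>E - G. 0 < \<psi> e g" and GE: "G \<subseteq> E" using G by (auto simp: faces_def)
  let ?C = "\<lambda>y. generic_on E \<psi> G y \<and> ?neg y \<subset> ?neg x"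
  have negg: "?neg g = {}" using g by (force simp: negative_set_def)
  have "?C g" using g negg S by (force simp: generic_on_def)
  moreover have finneg: "finite (?neg y)" for y using fin by (simp add: negative_set_def)
  have "\<forall>y. ?C y \<longrightarrow> card (?neg y) < Suc (card E)"
    using fin by (auto simp: negative_set_def less_Suc_eq_le intro!: card_mono)
  \<comment> \<open>Maximality of the negative set of \<open>x'\<close> is minimality of \<open>T\<close>.\<close>
  ultimately obtain x' where x': "?C x'" and max: "\<And>y. ?C y \<Longrightarrow> card (?neg y) \<le> card (?neg x')"
    using Lattices_Big.ex_has_greatest_nat[of ?C g "\<lambda>y. card (?neg y)" "Suc (card E)"] by blast
  define T where "T = ?neg x - ?neg x'"
  have xx: "\<psi> e x < 0" if "e \<in> T" for e using that by (simp add: T_def negative_set_def)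
  have TE: "T \<subseteq> E" "T \<inter> G = {}" using x by (auto simp: T_def negative_set_def generic_on_def)
  have lin_comb: "\<psi> e ((1 - t) *\<^sub>R y + t *\<^sub>R x) = (1 - t) * \<psi> e y + t * \<psi> e x" if "e \<in> E" for e y t
    using lin[OF that] by (simp add: linear_add linear_scale)
  have same_sign: "sgn (\<psi> e y) = sgn (\<psi> e x)" if "e \<in> E - (G \<union> T)" "generic_on E \<psi> G y" "?neg y = ?neg x'" for e y
  proof -
    have "e \<in> ?neg y \<longleftrightarrow> e \<in> ?neg x" using that x' by (auto simp: T_def)
    then have "\<psi> e y < 0 \<longleftrightarrow> \<psi> e x < 0" using that by (auto simp: negative_set_def)
    moreover have "\<psi> e y \<noteq> 0" "\<psi> e x \<noteq> 0" using that x by (auto simp: generic_on_def)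
    ultimately show ?thesis by (auto simp: sgn_if)
  qed
  have posT: "0 < \<psi> e y" if "e \<in> T" "generic_on E \<psi> G y" "?neg y = ?neg x'" for e y
  proof -
    have "e \<notin> ?neg y" "e \<in> E - G" using that TE by (auto simp: T_def)
    then show ?thesis using that by (force simp: negative_set_def generic_on_def)
  qed
  \<comment> \<open>If some functional of \<open>T\<close> were crossed before another one, a point strictly between
    the two crossing times, off the finitely many hyperplanes, would contradict the maximality of \<open>x'\<close>.\<close>
  have no_earlier: False
    if y: "generic_on E \<psi> G y" "?neg y = ?neg x'" and ef: "e \<in> T" "f \<in> T"
      and lt: "\<psi> e y / (\<psi> e y - \<psi> e x) < \<psi> f y / (\<psi> f y - \<psi> f x)" for y e f
  proof -
    let ?t = "\<lambda>e. \<psi> e y / (\<psi> e y - \<psi> e x)"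
    have "infinite ({?t e<..<?t f} - ?t ` E)" using lt fin by (simp add: infinite_Ioo)
    then have "{?t e<..<?t f} - ?t ` E \<noteq> {}" by (rule infinite_imp_nonempty)
    then obtain t where "t \<in> {?t e<..<?t f} - ?t ` E" by blast
    then have t: "?t e < t" "t < ?t f" "t \<notin> ?t ` E" by simp_all
    have e: "0 < \<psi> e y" "\<psi> e x < 0" "0 < \<psi> f y" "\<psi> f x < 0" using posT y ef xx by auto
    have "0 < ?t e" "?t f < 1" using e by (auto simp: field_simps)
    then have t01: "0 < t" "t < 1" using t by auto
    let ?p = "(1 - t) *\<^sub>R y + t *\<^sub>R x"
    have pe: "\<psi> h ?p = \<psi> h y - t * (\<psi> h y - \<psi> h x)" if "h \<in> E" for h using lin_comb[OF that] by (simp add: algebra_simps)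
    have gen: "generic_on E \<psi> G ?p"
      unfolding generic_on_def
    proof (intro conjI ballI notI)
      fix h assume "h \<in> G" then show "\<psi> h ?p = 0" using lin_comb GE x y by (auto simp: generic_on_def)
    next
      fix h assume h: "h \<in> E - G" "\<psi> h ?p = 0"
      then have "\<psi> h y = t * (\<psi> h y - \<psi> h x)" using pe by auto
      moreover have "\<psi> h y \<noteq> 0" using h y by (auto simp: generic_on_def)
      moreover from calculation have "\<psi> h y - \<psi> h x \<noteq> 0" by auto
      ultimately have "t = ?t h" by (simp add: nonzero_eq_divide_eq)
      then show False using t(3) h by auto
    qed
    have sgnp: "\<psi> h ?p < 0 \<longleftrightarrow> \<psi> h x < 0" if "h \<in> E - (G \<union> T)" for h
    proof -
      have s: "sgn (\<psi> h y) = sgn (\<psi> h x)" using same_sign that y by auto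
      show ?thesis
      proof (cases "\<psi> h x < 0")
        case True
        then have "\<psi> h y < 0" using s by (simp add: sgn_if split: if_splits)
        then have "(1 - t) * \<psi> h y < 0" "t * \<psi> h x < 0" using True t01 by (simp_all add: mult_pos_neg)
        then show ?thesis using lin_comb[of h t y] that True by auto
      next
        case False
        then have "\<psi> h y \<ge> 0" using s by (simp add: sgn_if split: if_splits)
        then have "(1 - t) * \<psi> h y \<ge> 0" "t * \<psi> h x \<ge> 0" using False t01 by simp_all
        then show ?thesis using lin_comb[of h t y] that False by auto
      qed
    qed
    have "\<psi> e ?p < 0"
    proof -
      have "\<psi> e y < t * (\<psi> e y - \<psi> e x)" using t(1) e by (simp add: field_simps)
      then show ?thesis using pe ef TE by auto
    qed
    then have "e \<in> ?neg ?p" "e \<notin> ?neg x'" using ef TE by (auto simp: negative_set_def T_def)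
    moreover have "0 < \<psi> f ?p"
    proof -
      have "t * (\<psi> f y - \<psi> f x) < \<psi> f y" using t(2) e by (simp add: field_simps)
      then show ?thesis using pe ef TE by auto
    qed
    then have "f \<notin> ?neg ?p" "f \<in> ?neg x" using ef TE by (auto simp: negative_set_def T_def)
    moreover have "h \<in> ?neg ?p" if "h \<in> ?neg x'" for h
    proof -
      have "h \<in> ?neg x" "h \<notin> T" using that x' by (auto simp: T_def)
      moreover have "h \<notin> G" using that x' by (auto simp: negative_set_def generic_on_def)
      ultimately show ?thesis using sgnp by (auto simp: negative_set_def)
    qed
    moreover have "h \<in> ?neg x" if "h \<in> ?neg ?p" for h
    proof (cases "h \<in> T")
      case False
      have "h \<notin> G" using that gen by (auto simp: negative_set_def generic_on_def)
      then show ?thesis using sgnp that False by (auto simp: negative_set_def)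
    qed (auto simp: T_def)
    ultimately have "?C ?p" "?neg x' \<subset> ?neg ?p" using gen by blast+
    then show False using max[of ?p] psubset_card_mono[OF finneg, of "?neg x'" ?p] by auto
  qed
  have cross: "\<psi> e y / (\<psi> e y - \<psi> e x) = \<psi> f y / (\<psi> f y - \<psi> f x)"
    if "generic_on E \<psi> G y" "?neg y = ?neg x'" "e \<in> T" "f \<in> T" for y e f
    by (rule antisym; rule leI; rule notI) (use no_earlier that in blast)+
  have "T \<noteq> {}" using x' by (auto simp: T_def)
  moreover have "T \<subseteq> ?neg x" "?neg x' = ?neg x - T" using x' by (auto simp: T_def)
  moreover have "parallel_on \<psi> G T"
    unfolding parallel_on_def
  proof (intro allI impI ballI, rule ccontr)
    fix v e f assume v: "\<forall>g\<in>G. \<psi> g v = 0" and e: "e \<in> T" and f: "f \<in> T" and ev: "\<psi> e v = 0" and fv: "\<psi> f v \<noteq> 0"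
    obtain \<epsilon> where \<epsilon>: "0 < \<epsilon>" "\<And>h. h \<in> E - G \<Longrightarrow> 0 < \<bar>\<psi> h x'\<bar> + \<epsilon> * (sgn (\<psi> h x') * \<psi> h v)"
      using small_perturbation[of "E - G" "\<lambda>h. \<bar>\<psi> h x'\<bar>" "\<lambda>h. sgn (\<psi> h x') * \<psi> h v"] fin x'
      by (auto simp: generic_on_def)
    \<comment> \<open>Moving \<open>x'\<close> by \<open>\<epsilon> v\<close> changes the crossing time of \<open>f\<close> but not that of \<open>e\<close>.\<close>
    let ?y = "x' + \<epsilon> *\<^sub>R v"
    have py: "\<psi> h ?y = \<psi> h x' + \<epsilon> * \<psi> h v" if "h \<in> E" for h using lin[OF that] by (simp add: linear_add linear_scale)
    have sy: "sgn (\<psi> h ?y) = sgn (\<psi> h x')" if "h \<in> E - G" for h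
    proof -
      have "\<psi> h x' \<noteq> 0" using that x' by (auto simp: generic_on_def)
      then show ?thesis using \<epsilon>(2)[OF that] py[of h] that by (auto simp: sgn_if abs_if split: if_splits)
    qed
    have gy: "generic_on E \<psi> G ?y"
      unfolding generic_on_def
    proof (intro conjI ballI)
      show "\<psi> h ?y = 0" if "h \<in> G" for h using that v x' py GE by (auto simp: generic_on_def)
      show "\<psi> h ?y \<noteq> 0" if "h \<in> E - G" for h using that sy[OF that] x' by (metis generic_on_def sgn_eq_0_iff)
    qed
    have ny: "?neg ?y = ?neg x'"
    proof -
      have "\<psi> h ?y < 0 \<longleftrightarrow> \<psi> h x' < 0" if "h \<in> E" for h
      proof (cases "h \<in> G")
        case True then show ?thesis using gy x' by (simp add: generic_on_def)
      next
        case False then show ?thesis using that sy[of h] by (metis DiffI sgn_less)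
      qed
      then show ?thesis by (auto simp: negative_set_def)
    qed
    have "e \<in> E" "f \<in> E" using e f TE by auto
    then have ye: "\<psi> e ?y = \<psi> e x'" "\<psi> f ?y = \<psi> f x' + \<epsilon> * \<psi> f v" using py ev by auto
    have pos: "0 < \<psi> e x'" "0 < \<psi> f x'" "0 < \<psi> f ?y" "\<psi> e x < 0" "\<psi> f x < 0"
      using posT x' gy ny e f xx by auto
    have "\<psi> f x' / (\<psi> f x' - \<psi> f x) = \<psi> f ?y / (\<psi> f ?y - \<psi> f x)"
      using cross[OF gy ny e f] cross[of x' e f] x' e f ye(1) by simp
    then have "\<psi> f x' * (\<psi> f ?y - \<psi> f x) = \<psi> f ?y * (\<psi> f x' - \<psi> f x)"
      using pos by (simp add: frac_eq_eq)
    then have "\<psi> f x * (\<psi> f ?y - \<psi> f x') = 0" by (simp add: algebra_simps)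
    then show False using pos fv ye(2) \<epsilon>(1) by simp
  qed
  moreover obtain e0 where e0: "e0 \<in> T" using \<open>T \<noteq> {}\<close> by blast
  define t where "t = \<psi> e0 x' / (\<psi> e0 x' - \<psi> e0 x)"
  have t01: "0 < t" "t < 1" using posT[OF e0, of x'] xx[OF e0] x' by (auto simp: t_def field_simps)
  define q where "q = (1 - t) *\<^sub>R x' + t *\<^sub>R x"
  have "\<psi> e q = 0" if "e \<in> G \<union> T" for e
  proof (cases "e \<in> G")
    case True then show ?thesis using lin_comb GE x x' by (auto simp: q_def generic_on_def)
  next
    case False
    then have e: "e \<in> T" "e \<in> E" using that TE by auto
    then have "t = \<psi> e x' / (\<psi> e x' - \<psi> e x)" using cross[of x' e e0] x' e0 by (simp add: t_def)
    moreover have "\<psi> e x' - \<psi> e x \<noteq> 0" using posT[OF e(1), of x'] xx[OF e(1)] x' by auto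
    ultimately have "t * (\<psi> e x' - \<psi> e x) = \<psi> e x'" by simp
    then show ?thesis using lin_comb[OF e(2), of t x'] by (simp add: q_def algebra_simps)
  qed
  moreover have "sgn (\<psi> e q) = sgn (\<psi> e x)" if e: "e \<in> E - (G \<union> T)" for e
  proof -
    have s: "sgn (\<psi> e x') = sgn (\<psi> e x)" using same_sign e x' by auto
    have q: "\<psi> e q = (1 - t) * \<psi> e x' + t * \<psi> e x" using lin_comb e by (auto simp: q_def)
    consider "\<psi> e x < 0" "\<psi> e x' < 0" | "\<psi> e x > 0" "\<psi> e x' > 0"
      using s x e by (force simp: generic_on_def sgn_if split: if_splits)
    then show ?thesis
    proof cases
      case 1
      then have "(1 - t) * \<psi> e x' < 0" "t * \<psi> e x < 0" using t01 by (simp_all add: mult_pos_neg)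
      then show ?thesis using q 1 by simp
    next
      case 2
      then have "(1 - t) * \<psi> e x' > 0" "t * \<psi> e x > 0" using t01 by simp_all
      then show ?thesis using q 2 by simp
    qed
  qed
  ultimately show ?thesis using that[of T x' q] x' by blast
qed

end

text \<open>Modulo the span of \<open>G\<close>, the functionals in \<open>T\<close> span a line; it is nonzero because of \<open>x\<close>.\<close>

lemma matroid_rank_step:
  fixes \<psi> :: "'e \<Rightarrow> 'v::real_vector \<Rightarrow> real"
  assumes "finite E" "\<And>e. e \<in> E \<Longrightarrow> linear (\<psi> e)" "G \<subseteq> E" "T \<subseteq> E" "T \<noteq> {}" "parallel_on \<psi> G T"
    and x: "\<forall>g\<in>G. \<psi> g x = 0" "\<forall>e\<in>T. \<psi> e x \<noteq> 0"
  shows "matroid_rank \<psi> (G \<union> T) = Suc (matroid_rank \<psi> G)"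
proof -
  obtain e where e: "e \<in> T" using assms by blast
  have finG: "finite G" "finite T" using assms(1,3,4) by (auto intro: finite_subset)
  have linG: "linear g" if "g \<in> \<psi> ` (G \<union> T)" for g using that assms by auto
  have "\<psi> f \<in> functional.span (insert (\<psi> e) (\<psi> ` G))" if "f \<in> T" for f
  proof (rule functional_in_span_if_kernel)
    fix v assume v: "\<And>g. g \<in> insert (\<psi> e) (\<psi> ` G) \<Longrightarrow> g v = 0"
    show "\<psi> f v = 0" using assms(6) v e that unfolding parallel_on_def by blast
  qed (use finG e linG that in auto)
  then have "functional.span (\<psi> ` (G \<union> T)) = functional.span (insert (\<psi> e) (\<psi> ` G))"
    using e functional.span_superset[of "insert (\<psi> e) (\<psi> ` G)"] functional.span_base[of _ "\<psi> ` (G \<union> T)"]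
    by (subst functional.span_eq) auto
  moreover have "\<psi> e \<notin> functional.span (\<psi> ` G)"
  proof
    assume "\<psi> e \<in> functional.span (\<psi> ` G)"
    then have "\<psi> e x = 0"
      by (induction rule: functional.span_induct_alt) (use x in auto)
    then show False using x e by blast
  qed
  ultimately show ?thesis
    unfolding matroid_rank_def using functional_dim_insert finG by (metis finite_imageI)
qed

section \<open>Faces visible from a point form an acyclic complex\<close>

text \<open>For \<open>S = negative_set E \<psi> x\<close> these are the proper faces of \<open>G\<close> that can be seen from \<open>x\<close>: their
  hyperplanes (other than those of \<open>G\<close>) separate \<open>x\<close> from the cone.\<close>

definition visible_faces :: "'e set \<Rightarrow> ('e \<Rightarrow> 'v \<Rightarrow> real) \<Rightarrow> 'e set \<Rightarrow> 'e set \<Rightarrow> 'e set set" where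
  "visible_faces E \<psi> G S = {Z \<in> faces E \<psi>. G \<subset> Z \<and> Z \<subseteq> G \<union> S}"

context
  fixes E :: "'e set" and \<psi> :: "'e \<Rightarrow> 'v::real_vector \<Rightarrow> real"
  assumes fin: "finite E" and lin: "\<And>e. e \<in> E \<Longrightarrow> linear (\<psi> e)"
begin

text \<open>The point is \<open>y - \<epsilon> w\<close> with \<open>y\<close> in the relative interior of \<open>Z\<close>: on \<open>Z\<close> the direction \<open>w\<close> decides
  the signs, elsewhere \<open>y\<close> does.\<close>

lemma push_off_face:
  assumes "Z \<in> faces E \<psi>"
  obtains x where "\<forall>e\<in>Z. sgn (\<psi> e x) = - sgn (\<psi> e w)" "\<forall>e\<in>E - Z. 0 < \<psi> e x"
proof -
  obtain y where y: "\<forall>e\<in>Z. \<psi> e y = 0" "\<forall>e\<in>E - Z. 0 < \<psi> e y" and ZE: "Z \<subseteq> E" using assms by (auto simp: faces_def)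
  obtain \<epsilon> where \<epsilon>: "0 < \<epsilon>" "\<And>e. e \<in> E - Z \<Longrightarrow> 0 < \<psi> e y + \<epsilon> * (- \<psi> e w)"
    using small_perturbation[of "E - Z" "\<lambda>e. \<psi> e y" "\<lambda>e. - \<psi> e w"] fin y by auto
  have eq: "\<psi> e (y - \<epsilon> *\<^sub>R w) = \<psi> e y + \<epsilon> * (- \<psi> e w)" if "e \<in> E" for e
    using lin[OF that] by (simp add: linear_diff linear_scale)
  show ?thesis
  proof (rule that[of "y - \<epsilon> *\<^sub>R w"])
    show "\<forall>e\<in>Z. sgn (\<psi> e (y - \<epsilon> *\<^sub>R w)) = - sgn (\<psi> e w)"
    proof
      fix e assume "e \<in> Z"
      then have "\<psi> e (y - \<epsilon> *\<^sub>R w) = \<epsilon> * (- \<psi> e w)" using eq[of e] y(1) ZE by auto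
      then show "sgn (\<psi> e (y - \<epsilon> *\<^sub>R w)) = - sgn (\<psi> e w)" using \<epsilon>(1) by (simp add: sgn_mult sgn_minus)
    qed
    show "\<forall>e\<in>E - Z. 0 < \<psi> e (y - \<epsilon> *\<^sub>R w)" using eq \<epsilon>(2) by simp
  qed
qed

lemma generic_negativeI:
  assumes "N \<subseteq> E - G" "\<forall>e\<in>G. \<psi> e x = 0" "\<forall>e\<in>N. \<psi> e x < 0" "\<forall>e\<in>E - (G \<union> N). 0 < \<psi> e x"
  shows "generic_on E \<psi> G x" "negative_set E \<psi> x = N"
proof -
  have sign: "e \<in> G \<and> \<psi> e x = 0 \<or> e \<in> N \<and> \<psi> e x < 0 \<or> e \<notin> G \<union> N \<and> 0 < \<psi> e x" if "e \<in> E" for e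
    using assms(2-4) that by blast
  show "generic_on E \<psi> G x"
    unfolding generic_on_def using assms(2) sign by fastforce
  show "negative_set E \<psi> x = N"
    unfolding negative_set_def using assms(1) sign by fastforce
qed

text \<open>Start in the relative interior of \<open>U\<close> and move away from the relative interior of \<open>G\<close>.\<close>

lemma face_beyond:
  assumes G: "G \<in> faces E \<psi>" and U: "U \<in> faces E \<psi>" and GU: "G \<subset> U"
  obtains x where "generic_on E \<psi> G x" "negative_set E \<psi> x = U - G"
proof -
  obtain g where g: "\<forall>e\<in>G. \<psi> e g = 0" "\<forall>e\<in>E - G. 0 < \<psi> e g" using G by (auto simp: faces_def)
  obtain x where x: "\<forall>e\<in>U. sgn (\<psi> e x) = - sgn (\<psi> e g)" "\<forall>e\<in>E - U. 0 < \<psi> e x"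
    by (rule push_off_face[OF U])
  have UE: "U \<subseteq> E" using U by (simp add: faces_def)
  have zero: "\<forall>e\<in>G. \<psi> e x = 0"
  proof
    fix e assume "e \<in> G"
    then have "sgn (\<psi> e x) = 0" using x(1) g(1) GU by auto
    then show "\<psi> e x = 0" by (simp add: sgn_zero_iff)
  qed
  have neg: "\<forall>e\<in>U - G. \<psi> e x < 0"
  proof
    fix e assume e: "e \<in> U - G"
    then have "sgn (\<psi> e x) = -1" using x(1) g(2) UE by auto
    then show "\<psi> e x < 0" by (simp add: sgn_1_neg)
  qed
  have "U - G \<subseteq> E - G" "\<forall>e\<in>E - (G \<union> (U - G)). 0 < \<psi> e x" using UE GU x(2) by blast+
  then show ?thesis using that generic_negativeI[OF _ zero neg] by blast
qed

text \<open>Here the direction moved away from is itself a point beyond \<open>G'\<close>; this turns the signs on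
  \<open>G' - G\<close> back to positive.\<close>

lemma face_beyond_in_star:
  assumes G: "G \<in> faces E \<psi>" and G': "G' \<in> faces E \<psi>" and Z: "Z \<in> faces E \<psi>" and less: "G \<subset> G'" "G' \<subset> Z"
  obtains x where "generic_on E \<psi> G x" "negative_set E \<psi> x = Z - G'"
proof -
  obtain w where w: "generic_on E \<psi> G w" "negative_set E \<psi> w = G' - G" using face_beyond[OF G G' less(1)] .
  obtain x where x: "\<forall>e\<in>Z. sgn (\<psi> e x) = - sgn (\<psi> e w)" "\<forall>e\<in>E - Z. 0 < \<psi> e x"
    by (rule push_off_face[OF Z])
  have ZE: "Z \<subseteq> E" using Z by (simp add: faces_def)
  have sign: "sgn (\<psi> e x) = - sgn (\<psi> e w)" "e \<in> E" if "e \<in> Z" for e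
    using that x(1) ZE by blast+
  have zero: "\<forall>e\<in>G. \<psi> e x = 0"
  proof
    fix e assume "e \<in> G"
    then have "sgn (\<psi> e x) = 0" using sign(1)[of e] less w(1) by (auto simp: generic_on_def)
    then show "\<psi> e x = 0" by (simp add: sgn_zero_iff)
  qed
  have wneg: "\<psi> e w < 0 \<longleftrightarrow> e \<in> G' - G" if "e \<in> E" for e
    using w(2) that unfolding negative_set_def by blast
  have neg: "\<forall>e\<in>Z - G'. \<psi> e x < 0"
  proof
    fix e assume e: "e \<in> Z - G'"
    then have "\<psi> e w \<noteq> 0" "\<not> \<psi> e w < 0" using w(1) wneg sign(2)[of e] less unfolding generic_on_def by blast+
    then show "\<psi> e x < 0" using sign(1)[of e] e by (simp add: sgn_if split: if_splits)
  qed
  have pos: "\<forall>e\<in>E - (G \<union> (Z - G')). 0 < \<psi> e x"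
  proof
    fix e assume e: "e \<in> E - (G \<union> (Z - G'))"
    show "0 < \<psi> e x"
    proof (cases "e \<in> Z")
      case True
      then have "\<psi> e w < 0" using e wneg by blast
      then show ?thesis using sign(1)[OF True] by (simp add: sgn_if split: if_splits)
    qed (use e x(2) in blast)
  qed
  have "Z - G' \<subseteq> E - G" using ZE less by blast
  then show ?thesis using that generic_negativeI[OF _ zero neg pos] by blast
qed

lemma parallel_in_face:
  assumes "parallel_on \<psi> G T" "Z \<in> faces E \<psi>" "G \<subseteq> Z" "T \<subseteq> E" "e \<in> T" "e \<in> Z"
  shows "T \<subseteq> Z"
proof
  fix f assume f: "f \<in> T"
  obtain y where y: "\<forall>e\<in>Z. \<psi> e y = 0" "\<forall>e\<in>E - Z. 0 < \<psi> e y" using assms(2) by (auto simp: faces_def)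
  then have "\<psi> f y = 0" using assms f unfolding parallel_on_def by blast
  then show "f \<in> Z" using y(2) f assms(4) by force
qed

text \<open>If the cone has some face inside the hyperplanes of \<open>T\<close> that is visible from \<open>x\<close>, then \<open>T\<close> supports a facet:
  moving from this face away from \<open>q\<close> leaves all its hyperplanes except those containing \<open>q\<close>.\<close>

lemma crossed_facet:
  assumes Z: "Z \<in> faces E \<psi>" "G \<union> T \<subseteq> Z" "Z \<subseteq> G \<union> negative_set E \<psi> x"
    and q: "\<And>e. e \<in> G \<union> T \<Longrightarrow> \<psi> e q = 0" "\<And>e. e \<in> E - (G \<union> T) \<Longrightarrow> sgn (\<psi> e q) = sgn (\<psi> e x)"
  shows "G \<union> T \<in> faces E \<psi>"
proof -
  obtain y where y: "\<forall>e\<in>Z. sgn (\<psi> e y) = - sgn (\<psi> e q)" "\<forall>e\<in>E - Z. 0 < \<psi> e y"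
    by (rule push_off_face[OF Z(1)])
  have ZE: "Z \<subseteq> E" using Z by (simp add: faces_def)
  have sign: "sgn (\<psi> e y) = - sgn (\<psi> e q)" if "e \<in> Z" for e
    using y(1) that by blast
  have "\<forall>e\<in>G \<union> T. \<psi> e y = 0"
  proof
    fix e assume e: "e \<in> G \<union> T"
    then have "sgn (\<psi> e y) = 0" using sign[of e] q(1)[OF e] Z(2) by auto
    then show "\<psi> e y = 0" by (simp add: sgn_zero_iff)
  qed
  moreover have "\<forall>e\<in>E - (G \<union> T). 0 < \<psi> e y"
  proof
    fix e assume e: "e \<in> E - (G \<union> T)"
    show "0 < \<psi> e y"
    proof (cases "e \<in> Z")
      case True
      then have "\<psi> e x < 0" using Z(3) e by (auto simp: negative_set_def)
      then have "sgn (\<psi> e y) = 1" using sign[OF True] q(2)[OF e] by simp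
      then show ?thesis by (simp add: sgn_1_pos)
    qed (use e y(2) in blast)
  qed
  ultimately show ?thesis using Z(2) ZE unfolding faces_def by blast
qed

text \<open>The visible part of the boundary of a convex cone is a ball. The proof is a shelling by induction on the
  number of separating hyperplanes. Let \<open>T\<close> be as in \<open>first_crossing\<close>. The faces not in \<open>T\<close> are the ones visible from
  \<open>x'\<close>. If any visible face lies in \<open>T\<close>, then \<open>G \<union> T\<close> is a facet, and the proper faces of this facet that are
  visible from \<open>x\<close> are those visible from \<open>q\<close>. Finally, below a face \<open>Z\<close> of the facet, the faces outside \<open>T\<close>
  are visible from a point beyond \<open>Z\<close> in the star of the facet. All three complexes have fewer separating
  hyperplanes.\<close>

theorem acyclic_visible_faces:
  assumes "G \<in> faces E \<psi>" "generic_on E \<psi> G x" "negative_set E \<psi> x \<noteq> {}"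
  shows "acyclic_lists (order_chains (visible_faces E \<psi> G (negative_set E \<psi> x)))"
  using assms
proof (induction "card (negative_set E \<psi> x)" arbitrary: G x rule: less_induct)
  case less
  define S where "S = negative_set E \<psi> x"
  obtain T x' q where T: "T \<noteq> {}" "T \<subseteq> negative_set E \<psi> x"
    and x': "generic_on E \<psi> G x'" "negative_set E \<psi> x' = negative_set E \<psi> x - T"
    and par: "parallel_on \<psi> G T" and q: "\<forall>e\<in>G \<union> T. \<psi> e q = 0" "\<forall>e\<in>E - (G \<union> T). sgn (\<psi> e q) = sgn (\<psi> e x)"
    by (rule first_crossing[OF fin _ less.prems]) (rule lin)
  note T = T[folded S_def] and x' = x'[folded S_def] and q = q[rule_format]
  have "S \<subseteq> E" by (simp add: S_def negative_set_def)
  moreover have "e \<notin> G" if "e \<in> S" for e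
    using that less.prems(2) unfolding S_def negative_set_def generic_on_def by force
  ultimately have SE: "S \<subseteq> E" "finite S" "S \<inter> G = {}" using finite_subset[OF _ fin] by blast+
  have GE: "G \<subseteq> E" using less.prems(1) by (simp add: faces_def)
  define P where "P = visible_faces E \<psi> G S"
  define N where "N = {Z \<in> P. T \<subseteq> Z}"
  have finP: "finite P" using finite_faces[OF fin, of \<psi>] by (simp add: P_def visible_faces_def)
  have dich: "T \<subseteq> Z \<or> Z \<inter> T = {}" if "Z \<in> P" for Z
    using parallel_in_face[OF par, of Z] that T(2) SE(1) by (auto simp: P_def visible_faces_def)
  have L: "P - N = visible_faces E \<psi> G (S - T)"
  proof (intro equalityI subsetI)
    fix Z assume "Z \<in> P - N"
    then have "Z \<in> P" "Z \<inter> T = {}" using dich by (auto simp: N_def)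
    then show "Z \<in> visible_faces E \<psi> G (S - T)" unfolding P_def visible_faces_def by blast
  next
    fix Z assume Z: "Z \<in> visible_faces E \<psi> G (S - T)"
    then have "Z \<inter> T = {}" using T SE(3) unfolding visible_faces_def by blast
    then have "\<not> T \<subseteq> Z" using T(1) by blast
    moreover have "Z \<in> P" using Z unfolding P_def visible_faces_def by blast
    ultimately show "Z \<in> P - N" by (simp add: N_def)
  qed
  have smaller: "card (S - T) < card S" 
    by (rule psubset_card_mono) (use T SE(2) in blast)+
  have G'mem: "G \<union> T \<in> faces E \<psi>" if "Z \<in> N" for Z
    by (rule crossed_facet[of Z G T x q]) (use that q in \<open>auto simp: N_def P_def S_def visible_faces_def\<close>)
  have GP: "G \<subset> G \<union> T" using T SE(3) by blast
  have acyL: "acyclic_lists (order_chains (P - N))" if "S - T \<noteq> {}"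
    using less.hyps[of x' G] smaller less.prems(1) x' that unfolding L S_def[symmetric] by simp
  have "acyclic_lists (order_chains P)"
  proof (cases "N = {}")
    case True
    \<comment> \<open>If \<open>T\<close> were everything, \<open>q\<close> itself would lie on a facet supported by \<open>T\<close>.\<close>
    have "S - T \<noteq> {}"
    proof
      assume "S - T = {}"
      then have "S = T" using T by blast
      have "G \<union> T \<in> faces E \<psi>"
        unfolding faces_def
      proof (intro CollectI conjI exI[of _ q] ballI)
        show "G \<union> T \<subseteq> E" using GE T SE by blast
        fix e assume e: "e \<in> E - (G \<union> T)"
        then have "\<not> \<psi> e x < 0" "\<psi> e x \<noteq> 0" using \<open>S = T\<close> less.prems(2) by (auto simp: S_def negative_set_def generic_on_def)
        then show "0 < \<psi> e q" using q(2)[OF e] by (metis linorder_neqE_linordered_idom sgn_greater)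
      qed (use q(1) in auto)
      then have "G \<union> T \<in> N" using GP T by (auto simp: N_def P_def visible_faces_def)
      then show False using True by blast
    qed
    then show ?thesis using acyL True by simp
  next
    case False
    then have G': "G \<union> T \<in> faces E \<psi>" using G'mem by blast
    have G'N: "G \<union> T \<in> N" using G' GP T by (auto simp: N_def P_def visible_faces_def)
    have qgen: "generic_on E \<psi> (G \<union> T) q"
      unfolding generic_on_def
    proof (intro conjI ballI)
      fix e assume e: "e \<in> E - (G \<union> T)"
      then have "\<psi> e x \<noteq> 0" using less.prems(2) by (auto simp: generic_on_def)
      then show "\<psi> e q \<noteq> 0" using q(2)[OF e] by (metis sgn_eq_0_iff)
    qed (use q(1) in auto)
    have qneg: "negative_set E \<psi> q = S - T"
    proof -
      have "\<psi> e q < 0 \<longleftrightarrow> \<psi> e x < 0 \<and> e \<notin> T" if "e \<in> E" for e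
      proof (cases "e \<in> G \<union> T")
        case True then show ?thesis using q(1) less.prems(2) by (auto simp: generic_on_def)
      next
        case False then show ?thesis using q(2)[of e] that by (metis DiffI UnI2 sgn_less)
      qed
      then show ?thesis by (auto simp: S_def negative_set_def)
    qed
    have N_eq: "N - {G \<union> T} = visible_faces E \<psi> (G \<union> T) (S - T)"
      unfolding N_def P_def visible_faces_def using GP T(2) by blast
    \<comment> \<open>Below \<open>Z\<close>, visibility in \<open>P - N\<close> is visibility from a point beyond \<open>Z\<close> on the near side of \<open>T\<close>.\<close>
    have lowerfam: "{Y \<in> P - N. Y \<subset> Z} = visible_faces E \<psi> G (Z - (G \<union> T))" if "Z \<in> N" "Z \<noteq> G \<union> T" for Z
    proof -
      have Z: "T \<subseteq> Z" "Z \<subseteq> G \<union> S" "G \<subseteq> Z" using that by (auto simp: N_def P_def visible_faces_def)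
      show ?thesis unfolding L visible_faces_def using Z T SE(3) by blast
    qed
    show ?thesis
    proof (cases "S - T = {}")
      case True
      have "Z = G \<union> T" if "Z \<in> P" for Z
      proof -
        have Z: "G \<subset> Z" "Z \<subseteq> G \<union> T" using that True by (auto simp: P_def visible_faces_def)
        then have "Z \<inter> T \<noteq> {}" by blast
        then have "T \<subseteq> Z" using dich[OF that] by blast
        then show ?thesis using Z by blast
      qed
      moreover have "G \<union> T \<in> P" using G'N by (simp add: N_def)
      ultimately have P1: "P = {G \<union> T}" by blast
      have "order_chains P = {[]} \<union> (\<lambda>l. l @ [G \<union> T]) ` {[]}"
      proof -
        have "z = [] \<or> z = [G \<union> T]" if "sorted_wrt (\<lambda>A B. B \<subset> A) z" "set z \<subseteq> {G \<union> T}" for z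
          using that by (cases z; cases "tl z") auto
        then show ?thesis using P1 by (auto simp: order_chains_def)
      qed
      moreover have "acyclic_lists ({[]} \<union> (\<lambda>l. l @ [G \<union> T]) ` {[]})"
        by (rule acyclic_cone[where Y = "{[]}" and a = "G \<union> T"]) (auto simp: subcomplex_def)
      ultimately show ?thesis by simp
    next
      case ne: False
      show ?thesis
      proof (rule acyclic_with_least[of P N "G \<union> T"])
        show "acyclic_lists (order_chains (P - N))" by (rule acyL[OF ne])
        have "acyclic_lists (order_chains (visible_faces E \<psi> (G \<union> T) (negative_set E \<psi> q)))"
          by (rule less.hyps) (use qneg smaller G' qgen ne in \<open>auto simp: S_def\<close>)
        then show "acyclic_lists (order_chains (N - {G \<union> T}))" by (simp add: N_eq qneg)
        fix Z assume Z: "Z \<in> N" "Z \<noteq> G \<union> T"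
        have ZF: "Z \<in> faces E \<psi>" "G \<union> T \<subset> Z" "Z - (G \<union> T) \<subseteq> S - T" using Z by (auto simp: N_def P_def visible_faces_def)
        obtain w where w: "generic_on E \<psi> G w" "negative_set E \<psi> w = Z - (G \<union> T)"
          using face_beyond_in_star[OF less.prems(1) G' ZF(1) GP ZF(2)] .
        have "card (negative_set E \<psi> w) < card (negative_set E \<psi> x)"
          using smaller card_mono[OF _ ZF(3)] SE(2) w(2) by (simp add: S_def)
        then have "acyclic_lists (order_chains (visible_faces E \<psi> G (negative_set E \<psi> w)))"
          by (rule less.hyps) (use less.prems w ZF(2) in auto)
        then show "acyclic_lists (order_chains {Y \<in> P - N. Y \<subset> Z})" using lowerfam[OF Z] w(2) by simp
      next
        show "\<not> Y \<subset> G \<union> T" if "Y \<in> P" for Y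
          using dich[OF that] that by (auto simp: P_def visible_faces_def)
      qed (use finP G'N GP in \<open>auto simp: N_def P_def visible_faces_def\<close>)
    qed
  qed
  then show ?case by (simp add: P_def S_def)
qed

end

section \<open>Flags of faces form spheres\<close>

definition faces_between :: "'e set \<Rightarrow> ('e \<Rightarrow> 'v \<Rightarrow> real) \<Rightarrow> 'e set \<Rightarrow> 'e set \<Rightarrow> 'e set set" where
  "faces_between E \<psi> G U = {Z \<in> faces E \<psi>. G \<subset> Z \<and> Z \<subset> U}"

text \<open>Flags of faces between \<open>G\<close> and \<open>U\<close>, always headed by \<open>U\<close>, attached to the lists of \<open>X\<close>. Keeping
  \<open>U\<close> makes the degree shift equal to the rank.\<close>

definition flag_complex ::
  "'e set \<Rightarrow> ('e \<Rightarrow> 'v \<Rightarrow> real) \<Rightarrow> 'a list set \<Rightarrow> 'e set \<Rightarrow> 'e set \<Rightarrow> ('a + 'e set) list set" where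
  "flag_complex E \<psi> X G U = {joined x (U # z) | x z. x \<in> X \<and> z \<in> order_chains (faces_between E \<psi> G U)}"

context
  fixes E :: "'e set" and \<psi> :: "'e \<Rightarrow> 'v::real_vector \<Rightarrow> real"
  assumes fin: "finite E" and lin: "\<And>e. e \<in> E \<Longrightarrow> linear (\<psi> e)"
begin

lemma finite_flag_complex: "finite X \<Longrightarrow> finite (flag_complex E \<psi> X G U)"
proof -
  assume "finite X"
  have "flag_complex E \<psi> X G U = (\<Union>x\<in>X. (\<lambda>z. joined x (U # z)) ` order_chains (faces_between E \<psi> G U))"
    by (auto simp: flag_complex_def)
  moreover have "finite (faces_between E \<psi> G U)"
    using finite_faces[OF fin, of \<psi>] by (simp add: faces_between_def)
  ultimately show ?thesis using \<open>finite X\<close> by (auto intro!: finite_order_chains)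
qed

text \<open>It is the quotient of the complex of all flags by the flags that avoid \<open>U\<close>.\<close>

lemma convex_flag_complex:
  assumes "convex_lists X" shows "convex_lists (flag_complex E \<psi> X G U)"
proof -
  let ?P = "faces_between E \<psi> G U"
  let ?A = "joined_complex X (\<lambda>_. insert U ?P)" and ?B = "joined_complex X (\<lambda>_. ?P)"
  have A: "convex_lists ?A" by (rule convex_joined_complex[OF assms]) (simp add: growing_family_def)
  have sub: "subcomplex ?B ?A"
    unfolding subcomplex_def
  proof (intro conjI ballI allI impI)
    show "?B \<subseteq> ?A" using order_chains_mono[of ?P "insert U ?P"] by (auto simp: joined_complex_def)
    fix w i assume w: "w \<in> ?B" "i < length w" "delete_nth i w \<in> ?A"
    obtain x z where xz: "w = joined x z" "x \<in> X" "z \<in> order_chains ?P" using joined_complexE[OF w(1)] .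
    show "delete_nth i w \<in> ?B"
      using w(2)[unfolded xz(1)]
    proof (cases rule: delete_joined_cases)
      case 1 then show ?thesis using w(3) xz by simp
    next
      case (2 j) then show ?thesis using xz by (simp add: order_chains_delete_nth)
    qed
  qed
  have "flag_complex E \<psi> X G U = ?A - ?B"
  proof (intro equalityI subsetI)
    fix w assume "w \<in> flag_complex E \<psi> X G U"
    then obtain x z where xz: "w = joined x (U # z)" "x \<in> X" "z \<in> order_chains ?P" by (auto simp: flag_complex_def)
    have "\<forall>B\<in>set z. B \<subset> U" using xz(3) by (auto simp: order_chains_def faces_between_def)
    then have "U # z \<in> order_chains (insert U ?P)"
      using xz(3) order_chains_mono[of ?P "insert U ?P"] by (auto simp: order_chains_Cons)
    moreover have "U # z \<notin> order_chains ?P" by (auto simp: order_chains_def faces_between_def)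
    ultimately show "w \<in> ?A - ?B" using xz by simp
  next
    fix w assume w: "w \<in> ?A - ?B"
    then obtain x z where xz: "w = joined x z" "x \<in> X" "z \<in> order_chains (insert U ?P)"
      unfolding joined_complex_def by blast
    have "z \<notin> order_chains ?P" using w xz by simp
    then have "U \<in> set z" using xz(3) by (auto simp: order_chains_def)
    then obtain z1 z2 where z: "z = z1 @ U # z2" by (meson split_list)
    have "\<not> U \<subset> A" if "A \<in> insert U ?P" for A using that by (auto simp: faces_between_def)
    moreover have "set z1 \<subseteq> insert U ?P" "\<forall>A\<in>set z1. U \<subset> A"
      using xz(3) unfolding z order_chains_append by (simp_all add: order_chains_def)
    ultimately have "\<forall>A\<in>set z1. False" by blast
    then have "z1 = []" by simp
    then have "z2 \<in> order_chains ?P"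
      using z xz(3) by (auto simp: order_chains_Cons) (auto simp: order_chains_def)
    then show "w \<in> flag_complex E \<psi> X G U" using xz z \<open>z1 = []\<close> by (auto simp: flag_complex_def)
  qed
  then show ?thesis using subcomplex_convex(2)[OF A sub] by simp
qed

text \<open>The open interval between \<open>G\<close> and \<open>U\<close> in the face lattice is a sphere, here proved as an iterated
  suspension of \<open>X\<close>. Choose a facet \<open>G \<union> T\<close> of \<open>G\<close> that is crossed by a segment ending beyond \<open>U\<close>. All
  proper faces except this facet form an acyclic complex (a ball) by \<open>acyclic_punctured\<close>. What is left are the flags
  through the facet, that is, flags between \<open>G \<union> T\<close> and \<open>U\<close> with one more entry appended.\<close>

theorem sphere_flag_complex:
  fixes X :: "'a list set"
  assumes "finite X" "convex_lists X" "sphere_lists X n"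
    and "G \<in> faces E \<psi>" "U \<in> faces E \<psi>" "G \<subset> U"
  shows "matroid_rank \<psi> G < matroid_rank \<psi> U \<and>
    sphere_lists (flag_complex E \<psi> X G U) (n + (matroid_rank \<psi> U - matroid_rank \<psi> G))"
  using assms(4-)
proof (induction "card (U - G)" arbitrary: G rule: less_induct)
  case less
  obtain x where x: "generic_on E \<psi> G x" "negative_set E \<psi> x = U - G"
    by (rule face_beyond[OF fin _ less.prems]) (rule lin)
  have ne: "negative_set E \<psi> x \<noteq> {}" using x less.prems by blast
  obtain T x' q where T: "T \<noteq> {}" "T \<subseteq> negative_set E \<psi> x"
    and x': "generic_on E \<psi> G x'" "negative_set E \<psi> x' = negative_set E \<psi> x - T"
    and par: "parallel_on \<psi> G T" and q: "\<forall>e\<in>G \<union> T. \<psi> e q = 0" "\<forall>e\<in>E - (G \<union> T). sgn (\<psi> e q) = sgn (\<psi> e x)"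
    by (rule first_crossing[OF fin _ less.prems(1) x(1) ne]) (rule lin)
  have UE: "U \<subseteq> E" "finite U" using less.prems(2) fin by (auto simp: faces_def intro: finite_subset)
  have TU: "T \<subseteq> U" "T \<inter> G = {}" "T \<subseteq> E" using T x(2) UE by auto
  define P where "P = faces_between E \<psi> G U"
  have finP: "finite P" using finite_faces[OF fin, of \<psi>] by (simp add: P_def faces_between_def)
  have dich: "T \<subseteq> Z \<or> Z \<inter> T = {}" if "Z \<in> P" for Z
  proof -
    have Z: "Z \<in> faces E \<psi>" "G \<subseteq> Z" using that by (auto simp: P_def faces_between_def)
    show ?thesis
    proof (cases "Z \<inter> T = {}")
      case False
      then obtain e where "e \<in> Z" "e \<in> T" by blast
      have "T \<subseteq> Z"
        by (rule parallel_in_face[OF fin _ par Z TU(3) \<open>e \<in> T\<close> \<open>e \<in> Z\<close>]) (rule lin)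
      then show ?thesis ..
    qed simp
  qed
  have rank: "matroid_rank \<psi> (G \<union> T) = Suc (matroid_rank \<psi> G)"
  proof (rule matroid_rank_step[OF fin _ _ TU(3) T(1) par])
    show "\<forall>g\<in>G. \<psi> g x = 0" using x(1) by (simp add: generic_on_def)
    show "\<forall>e\<in>T. \<psi> e x \<noteq> 0" using T(2) by (auto simp: negative_set_def)
    show "G \<subseteq> E" using less.prems(1) by (simp add: faces_def)
  qed (rule lin)
  show ?case
  proof (cases "U = G \<union> T")
    case True
    have "P = {}"
    proof (rule ccontr)
      assume "P \<noteq> {}"
      then obtain Z where Z: "Z \<in> P" by blast
      then have "G \<subset> Z" "Z \<subset> G \<union> T" using True by (auto simp: P_def faces_between_def)
      moreover have "Z \<inter> T \<noteq> {}" using calculation by blast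
      then have "T \<subseteq> Z" using dich[OF Z] by blast
      ultimately show False by blast
    qed
    then have "flag_complex E \<psi> X G U = (\<lambda>l. [] @ map Inl l @ [Inr U]) ` X"
      unfolding flag_complex_def P_def[symmetric] by (auto simp: order_chains_def joined_def)
    moreover have "sphere_lists ((\<lambda>l. [] @ map Inl l @ [Inr U]) ` X) (n + (length ([] :: ('a + 'e set) list) + length [Inr U :: 'a + 'e set]))"
      by (subst sphere_pad_iff) (use assms(3) in \<open>auto simp: inj_on_def\<close>)
    ultimately show ?thesis using rank True by simp
  next
    case False
    have GT: "G \<subset> G \<union> T" "G \<union> T \<subset> U" using T TU less.prems(3) False by blast+
    have G': "G \<union> T \<in> faces E \<psi>"
    proof (rule crossed_facet[OF fin _ less.prems(2), where x = x and q = q])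
      show "U \<subseteq> G \<union> negative_set E \<psi> x" using x(2) by blast
    qed (use GT q lin in auto)
    define N where "N = {Z \<in> P. T \<subseteq> Z}"
    have G'N: "G \<union> T \<in> N" using G' GT by (simp add: N_def P_def faces_between_def)
    have L: "P - N = visible_faces E \<psi> G (negative_set E \<psi> x')"
    proof (intro equalityI subsetI)
      fix Z assume "Z \<in> P - N"
      then have "Z \<in> P" "Z \<inter> T = {}" using dich by (auto simp: N_def)
      then show "Z \<in> visible_faces E \<psi> G (negative_set E \<psi> x')"
        unfolding P_def visible_faces_def faces_between_def x'(2) x(2) by blast
    next
      fix Z assume Z: "Z \<in> visible_faces E \<psi> G (negative_set E \<psi> x')"
      then have Z': "Z \<in> faces E \<psi>" "G \<subset> Z" "Z \<subseteq> G \<union> (U - G - T)" unfolding visible_faces_def x'(2) x(2) by blast+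
      then have "Z \<inter> T = {}" using TU by blast
      then have "\<not> T \<subseteq> Z" "Z \<subset> U" using T(1) Z' TU less.prems(3) by blast+
      then show "Z \<in> P - N" using Z' by (simp add: N_def P_def faces_between_def)
    qed
    have N_eq: "N - {G \<union> T} = faces_between E \<psi> (G \<union> T) U"
      unfolding N_def P_def faces_between_def using GT by blast
    have least: "finite P" "N \<subseteq> P" "G \<union> T \<in> N" "\<And>Z. Z \<in> N \<Longrightarrow> G \<union> T \<subseteq> Z"
      "\<And>Y Z. Y \<in> N \<Longrightarrow> Z \<in> P \<Longrightarrow> Y \<subset> Z \<Longrightarrow> Z \<in> N" "\<And>Y. Y \<in> P \<Longrightarrow> \<not> Y \<subset> G \<union> T"
    proof -
      show "\<not> Y \<subset> G \<union> T" if "Y \<in> P" for Y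
      proof
        assume Y: "Y \<subset> G \<union> T"
        have "G \<subset> Y" using that by (simp add: P_def faces_between_def)
        then have "Y \<inter> T \<noteq> {}" using Y by blast
        then show False using dich[OF that] Y \<open>G \<subset> Y\<close> by blast
      qed
    qed (use finP G'N in \<open>auto simp: N_def P_def faces_between_def\<close>)
    have through: "order_chains P - order_chains (P - {G \<union> T}) = (\<lambda>z. z @ [G \<union> T]) ` order_chains (N - {G \<union> T})"
      by (rule order_chains_through_least) (fact least)+
    have punct: "acyclic_lists (order_chains (P - {G \<union> T}))"
    proof (rule acyclic_punctured[OF least])
      show "acyclic_lists (order_chains (P - N))"
        unfolding L
      proof (rule acyclic_visible_faces[OF fin _ less.prems(1) x'(1)])
        show "negative_set E \<psi> x' \<noteq> {}" using x'(2) x(2) GT by blast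
      qed (rule lin)
      fix Z assume Z: "Z \<in> N" "Z \<noteq> G \<union> T"
      have ZF: "Z \<in> faces E \<psi>" "G \<union> T \<subset> Z" "Z \<subset> U" using Z by (auto simp: N_def P_def faces_between_def)
      obtain w where w: "generic_on E \<psi> G w" "negative_set E \<psi> w = Z - (G \<union> T)"
        by (rule face_beyond_in_star[OF fin _ less.prems(1) G' ZF(1) GT(1) ZF(2)]) (rule lin)
      have "{Y \<in> P - N. Y \<subset> Z} = visible_faces E \<psi> G (negative_set E \<psi> w)"
        unfolding L visible_faces_def w(2) x'(2) x(2) using ZF TU T(1) less.prems(3) by blast
      moreover have "acyclic_lists (order_chains (visible_faces E \<psi> G (negative_set E \<psi> w)))"
      proof (rule acyclic_visible_faces[OF fin _ less.prems(1) w(1)])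
        show "negative_set E \<psi> w \<noteq> {}" using w(2) ZF by blast
      qed (rule lin)
      ultimately show "acyclic_lists (order_chains {Y \<in> P - N. Y \<subset> Z})" by simp
    qed
    let ?W = "flag_complex E \<psi> X G U"
    define Y where "Y = {joined x (U # z) | x z. x \<in> X \<and> z \<in> order_chains (P - {G \<union> T})}"
    have inW: "joined x z \<in> ?W \<longleftrightarrow> x \<in> X \<and> (\<exists>z'. z = U # z' \<and> z' \<in> order_chains P)" for x z
      by (auto simp: flag_complex_def P_def)
    have inY: "joined x z \<in> Y \<longleftrightarrow> x \<in> X \<and> (\<exists>z'. z = U # z' \<and> z' \<in> order_chains (P - {G \<union> T}))" for x z
      by (auto simp: Y_def)
    have YW: "Y \<subseteq> ?W" using order_chains_mono[of "P - {G \<union> T}" P] by (auto simp: Y_def flag_complex_def P_def)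
    have conv: "convex_lists ?W" by (rule convex_flag_complex[OF assms(2)])
    have sub: "subcomplex Y ?W"
      unfolding subcomplex_def
    proof (intro conjI ballI allI impI YW)
      fix w i assume w: "w \<in> Y" "i < length w" "delete_nth i w \<in> ?W"
      then obtain x z where xz: "w = joined x (U # z)" "x \<in> X" "z \<in> order_chains (P - {G \<union> T})" by (auto simp: Y_def)
      show "delete_nth i w \<in> Y"
        using w(2)[unfolded xz(1)]
      proof (cases rule: delete_joined_cases)
        case 1 then show ?thesis using w(3) xz by (simp add: inW inY)
      next
        case (2 j)
        then obtain z' where z': "delete_nth j (U # z) = U # z'" "z' \<in> order_chains P" using w(3) xz by (auto simp: inW)
        have "set z' \<subseteq> set z \<union> {U}" using z'(1) set_delete_nth[of j "U # z"] by auto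
        moreover have "U \<noteq> G \<union> T" using GT by blast
        moreover have "set z \<subseteq> P - {G \<union> T}" using xz(3) by (simp add: order_chains_def)
        ultimately have "set z' \<subseteq> P - {G \<union> T}" using z'(2) by (auto simp: order_chains_def)
        then have "z' \<in> order_chains (P - {G \<union> T})" using z'(2) by (simp add: order_chains_def)
        then show ?thesis using 2 z'(1) xz(1,2) by (simp add: inY)
      qed
    qed
    have "acyclic_lists Y"
    proof (rule acyclic_by_left_part)
      show "finite Y" using YW finite_flag_complex[OF assms(1)] finite_subset by blast
      show "convex_lists Y" using subcomplex_convex(1)[OF conv sub] .
      show "\<exists>x z. w = joined x z" if "w \<in> Y" for w using that by (auto simp: Y_def)
      fix x assume "x \<in> left_part ` Y"
      then have "x \<in> X" by (auto simp: Y_def)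
      then have "{z. joined x z \<in> Y} = (\<lambda>z. [U] @ map id z @ []) ` order_chains (P - {G \<union> T})"
        by (auto simp: inY)
      moreover have "acyclic_lists ((\<lambda>z. [U] @ map id z @ []) ` order_chains (P - {G \<union> T}))"
        by (subst acyclic_pad_iff) (use punct in \<open>auto simp: order_chains_def P_def faces_between_def\<close>)
      ultimately show "acyclic_lists {z. joined x z \<in> Y}" by simp
    qed
    note quot = sphere_quotient_iff[OF conv sub this]
    have snoc: "joined x (U # z @ [G \<union> T]) = joined x (U # z) @ [Inr (G \<union> T)]" for x :: "'a list" and z
      by (simp add: joined_def)
    have WY: "?W - Y = (\<lambda>w. [] @ map id w @ [Inr (G \<union> T)]) ` flag_complex E \<psi> X (G \<union> T) U"
    proof -
      have "?W - Y = {joined x (U # z) | x z. x \<in> X \<and> z \<in> order_chains P - order_chains (P - {G \<union> T})}"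
        using inY by (auto simp: flag_complex_def P_def[symmetric])
      also have "\<dots> = {joined x (U # z @ [G \<union> T]) | x z. x \<in> X \<and> z \<in> order_chains (faces_between E \<psi> (G \<union> T) U)}"
        unfolding through N_eq by auto
      also have "\<dots> = (\<lambda>w. [] @ map id w @ [Inr (G \<union> T)]) ` flag_complex E \<psi> X (G \<union> T) U"
        unfolding snoc by (auto simp: flag_complex_def image_iff)
      finally show ?thesis .
    qed
    have IH: "matroid_rank \<psi> (G \<union> T) < matroid_rank \<psi> U"
      "sphere_lists (flag_complex E \<psi> X (G \<union> T) U) (n + (matroid_rank \<psi> U - matroid_rank \<psi> (G \<union> T)))"
    proof -
      have "card (U - (G \<union> T)) < card (U - G)" using UE T(1) TU by (intro psubset_card_mono) auto
      then show "matroid_rank \<psi> (G \<union> T) < matroid_rank \<psi> U"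
        "sphere_lists (flag_complex E \<psi> X (G \<union> T) U) (n + (matroid_rank \<psi> U - matroid_rank \<psi> (G \<union> T)))"
        using less.hyps[of "G \<union> T"] G' less.prems(2) GT by blast+
    qed
    have "sphere_lists (?W - Y) (n + (matroid_rank \<psi> U - matroid_rank \<psi> (G \<union> T)) +
        (length ([] :: ('a + 'e set) list) + length [Inr (G \<union> T) :: 'a + 'e set]))"
      unfolding WY
    proof (subst sphere_pad_iff)
      show "(set [] \<union> set [Inr (G \<union> T)]) \<inter> id ` (\<Union>l\<in>flag_complex E \<psi> X (G \<union> T) U. set l) = {}"
        using GT by (auto simp: flag_complex_def joined_def order_chains_def faces_between_def)
    qed (use IH(2) in simp_all)
    then have "sphere_lists ?W (n + (matroid_rank \<psi> U - matroid_rank \<psi> G))"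
      using quot rank IH(1) by (simp add: Suc_diff_Suc)
    then show ?thesis using rank IH(1) by simp
  qed
qed

end

section \<open>Crossing vectors\<close>

lemma crossing_vector_short [simp]: "crossing_vector E [] = (\<lambda>_. 0)" "crossing_vector E [A] = (\<lambda>_. 0)"
  by (auto simp: crossing_vector_def)

lemma crossing_vector_Cons_Cons:
  "crossing_vector E (A # B # l) e = (if e \<in> Sep E A B then 1 else 0) + crossing_vector E (B # l) e"
proof -
  let ?t = "\<lambda>l i. if e \<in> Sep E (l ! (i - 1)) (l ! i) then 1 else 0 :: nat"
  have "crossing_vector E (A # B # l) e = (\<Sum>i = 1..Suc (length l). ?t (A # B # l) i)"
    by (simp add: crossing_vector_def)
  also have "\<dots> = ?t (A # B # l) 1 + (\<Sum>i = Suc 1..Suc (length l). ?t (A # B # l) i)"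
    by (rule sum.atLeast_Suc_atMost) simp
  also have "(\<Sum>i = Suc 1..Suc (length l). ?t (A # B # l) i) = (\<Sum>i = 1..length l. ?t (A # B # l) (Suc i))"
    by (rule sum.atLeast_Suc_atMost_Suc_shift[unfolded o_def])
  also have "\<dots> = crossing_vector E (B # l) e"
    unfolding crossing_vector_def by (intro sum.cong) (auto simp: nth_Cons split: nat.splits)
  finally show ?thesis by simp
qed

lemma crossing_vector_append:
  "crossing_vector E (xs @ A # ys) e = crossing_vector E (xs @ [A]) e + crossing_vector E (A # ys) e"
proof (induction xs)
  case (Cons x xs)
  then show ?case by (cases xs) (auto simp: crossing_vector_Cons_Cons)
qed simp

lemma crossing_vector_outside: "e \<notin> E \<Longrightarrow> crossing_vector E l e = 0"
  by (auto simp: crossing_vector_def Sep_def)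

lemma crossing_vector_snoc:
  "l \<noteq> [] \<Longrightarrow> crossing_vector E (l @ [A]) e = crossing_vector E l e + (if e \<in> Sep E (last l) A then 1 else 0)"
  using crossing_vector_append[of E "butlast l" "last l" "[A]" e]
  by (cases l rule: rev_cases) (auto simp: crossing_vector_Cons_Cons)

lemma Sep_triangle: "Sep E A C \<subseteq> Sep E A B \<union> Sep E B C"
  by (auto simp: Sep_def)

text \<open>The triangle inequality, hyperplane by hyperplane.\<close>

lemma crossing_vector_delete_le: "crossing_vector E (xs @ ys) e \<le> crossing_vector E (xs @ a # ys) e"
proof (induction xs)
  case Nil
  then show ?case by (cases ys) (auto simp: crossing_vector_Cons_Cons)
next
  case (Cons x xs)
  show ?case
  proof (cases xs)
    case Nil
    then show ?thesis
      using Sep_triangle[of E x "hd ys" a] by (cases ys) (auto simp: crossing_vector_Cons_Cons)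
  next
    case (Cons y xs')
    then show ?thesis using Cons.IH by (auto simp: crossing_vector_Cons_Cons)
  qed
qed

lemma crossing_vector_delete_middle:
  "crossing_vector E (xs @ x # a # y # ys) e + (if e \<in> Sep E x y then 1 else 0) =
   crossing_vector E (xs @ x # y # ys) e + (if e \<in> Sep E x a then 1 else 0) + (if e \<in> Sep E a y then 1 else 0)"
  using crossing_vector_append[of E xs x "a # y # ys" e] crossing_vector_append[of E xs x "y # ys" e]
  by (auto simp: crossing_vector_Cons_Cons)

section \<open>Topes and paths of topes\<close>

text \<open>Orients the functionals so that the chamber of \<open>A\<close> becomes the positive cone; the faces of the tope \<open>A\<close> are
  then the faces of this cone.\<close>

definition orient :: "'e sign_vector \<Rightarrow> ('e \<Rightarrow> 'v \<Rightarrow> real) \<Rightarrow> 'e \<Rightarrow> 'v \<Rightarrow> real" where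
  "orient A \<phi> e v = A e * \<phi> e v"

definition flip :: "'e sign_vector \<Rightarrow> 'e set \<Rightarrow> 'e sign_vector" where
  "flip A Z = (\<lambda>e. if e \<in> Z then - A e else A e)"

abbreviation tope_faces :: "'e set \<Rightarrow> ('e \<Rightarrow> 'v \<Rightarrow> real) \<Rightarrow> 'e sign_vector \<Rightarrow> 'e set set" where
  "tope_faces E \<phi> A \<equiv> faces E (orient A \<phi>)"

text \<open>Tope paths that are continued to \<open>A\<close> by a final step, which may be trivial and crosses no hyperplane in \<open>W\<close>.
  For \<open>W = E\<close> the final step is trivial, and these are the magnitude chains ending in \<open>A\<close>. In general, the
  lists compute \<open>Tor\<close>, over the algebra of geodesics, of the module of topes on the same side of \<open>W\<close>
  as \<open>A\<close>; for \<open>W = {}\<close> this module is projective.\<close>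

definition tope_paths ::
  "'e set \<Rightarrow> ('e \<Rightarrow> 'v \<Rightarrow> real) \<Rightarrow> 'e sign_vector \<Rightarrow> 'e set \<Rightarrow> ('e \<Rightarrow> nat) \<Rightarrow> 'e sign_vector list set" where
  "tope_paths E \<phi> A W \<gamma> = {l. l \<noteq> [] \<and> set l \<subseteq> topes E \<phi> \<and> distinct_adj l \<and>
     crossing_vector E (l @ [A]) = \<gamma> \<and> Sep E (last l) A \<inter> W = {}}"

lemma tope_cases: "A \<in> topes E \<phi> \<Longrightarrow> e \<in> E \<Longrightarrow> A e = 1 \<or> A e = -1"
  by (auto simp: topes_def covectors_def sgn_if split: if_splits)

lemma tope_outside: "A \<in> topes E \<phi> \<Longrightarrow> e \<notin> E \<Longrightarrow> A e = 0"
  by (auto simp: topes_def covectors_def)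

lemma Sep_empty_iff: "A \<in> topes E \<phi> \<Longrightarrow> B \<in> topes E \<phi> \<Longrightarrow> Sep E A B = {} \<longleftrightarrow> A = B"
  using tope_outside[of A E \<phi>] tope_outside[of B E \<phi>] by (fastforce simp: Sep_def fun_eq_iff)

lemma Sep_self [simp]: "Sep E A A = {}"
  by (simp add: Sep_def)

lemma Sep_commute: "Sep E A B = Sep E B A"
  by (auto simp: Sep_def)

lemma finite_topes: assumes "finite E" shows "finite (topes E \<phi>)"
proof (rule finite_subset)
  show "topes E \<phi> \<subseteq> {f. \<forall>e. (e \<in> E \<longrightarrow> f e \<in> {1, -1}) \<and> (e \<notin> E \<longrightarrow> f e = 0)}"
    using tope_cases tope_outside by fastforce
  show "finite {f. \<forall>e. (e \<in> E \<longrightarrow> f e \<in> {1, - 1 :: real}) \<and> (e \<notin> E \<longrightarrow> f e = 0)}"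
    by (rule finite_set_of_finite_funs) (use assms in auto)
qed

lemma tope_point:
  assumes "X \<in> topes E \<phi>" obtains x where "\<And>e. e \<in> E \<Longrightarrow> X e = sgn (\<phi> e x)"
  using assms by (auto simp: topes_def covectors_def)

lemma Sep_flip:
  assumes "X \<in> topes E \<phi>" "A \<in> topes E \<phi>" "Z \<subseteq> E"
  shows "Sep E X (flip A Z) = (Sep E X A - Z) \<union> (Z - Sep E X A)"
proof -
  have "X e \<noteq> - A e \<longleftrightarrow> X e = A e" if "e \<in> E" for e
    using tope_cases[OF assms(1) that] tope_cases[OF assms(2) that] by auto
  then show ?thesis using assms(3) by (auto simp: Sep_def flip_def)
qed

text \<open>Every step crosses some hyperplane, so the crossing vector bounds the length.\<close>

lemma length_le_crossings:
  assumes "finite E" "set l \<subseteq> topes E \<phi>" "distinct_adj l"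
  shows "length l \<le> Suc (\<Sum>e\<in>E. crossing_vector E l e)"
  using assms(2,3)
proof (induction l)
  case (Cons A l)
  show ?case
  proof (cases l)
    case (Cons B l')
    then have "A \<noteq> B" using Cons.prems by simp
    then have "Sep E A B \<noteq> {}" using Sep_empty_iff[of A E \<phi> B] Cons.prems Cons by auto
    then obtain e where "e \<in> E" "e \<in> Sep E A B" by (auto simp: Sep_def)
    then have "1 \<le> (\<Sum>e\<in>E. if e \<in> Sep E A B then 1 else 0 :: nat)"
      using member_le_sum[of e E "\<lambda>e. if e \<in> Sep E A B then 1 else 0 :: nat"] assms(1) by simp
    moreover have "length l \<le> Suc (\<Sum>e\<in>E. crossing_vector E l e)" using Cons.IH Cons.prems Cons by auto
    ultimately show ?thesis using Cons by (simp add: crossing_vector_Cons_Cons sum.distrib)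
  qed simp
qed simp

lemma finite_paths_with_crossings:
  assumes "finite E" shows "finite {l. set l \<subseteq> topes E \<phi> \<and> distinct_adj l \<and> (\<Sum>e\<in>E. crossing_vector E l e) \<le> n}"
proof (rule finite_subset)
  show "{l. set l \<subseteq> topes E \<phi> \<and> distinct_adj l \<and> (\<Sum>e\<in>E. crossing_vector E l e) \<le> n}
    \<subseteq> {l. set l \<subseteq> topes E \<phi> \<and> length l \<le> Suc n}"
    using length_le_crossings[OF assms, of _ \<phi>] by fastforce
  show "finite {l. set l \<subseteq> topes E \<phi> \<and> length l \<le> Suc n}"
    by (rule finite_lists_length_le[OF finite_topes[OF assms]])
qed

lemma finite_tope_paths:
  assumes "finite E" shows "finite (tope_paths E \<phi> A W \<gamma>)"
proof (rule finite_subset[OF _ finite_paths_with_crossings[OF assms, of \<phi> "\<Sum>e\<in>E. \<gamma> e"]])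
  show "tope_paths E \<phi> A W \<gamma> \<subseteq>
    {l. set l \<subseteq> topes E \<phi> \<and> distinct_adj l \<and> (\<Sum>e\<in>E. crossing_vector E l e) \<le> (\<Sum>e\<in>E. \<gamma> e)}"
    by (auto simp: tope_paths_def crossing_vector_snoc intro!: sum_mono)
qed

text \<open>If deleting \<open>a\<close> made two equal topes adjacent, the crossings on the way to \<open>a\<close> and back would be lost.\<close>

lemma distinct_adj_delete:
  assumes "distinct_adj (xs @ a # ys)" "set (xs @ a # ys) \<subseteq> topes E \<phi>"
    and same: "crossing_vector E (xs @ ys @ zs) = crossing_vector E (xs @ a # ys @ zs)"
  shows "distinct_adj (xs @ ys)"
proof (cases "xs = [] \<or> ys = []")
  case True
  then show ?thesis using assms(1) by (auto simp: distinct_adj_append_iff distinct_adj_Cons)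
next
  case False
  then obtain xs' x y ys' where eq: "xs = xs' @ [x]" "ys = y # ys'" by (metis neq_Nil_conv rev_exhaust)
  have "x \<noteq> a" using assms(1) eq by (auto simp: distinct_adj_append_iff distinct_adj_Cons)
  then have "Sep E x a \<noteq> {}" using Sep_empty_iff[of x E \<phi> a] assms(2) eq by auto
  then obtain e where e: "e \<in> Sep E x a" by blast
  have "x \<noteq> y"
  proof
    assume "x = y"
    then show False
      using crossing_vector_delete_middle[of E xs' x a y "ys' @ zs" e] fun_cong[OF same, of e] e eq
      by (auto split: if_splits)
  qed
  then show ?thesis using assms(1) eq by (auto simp: distinct_adj_append_iff distinct_adj_Cons)
qed

text \<open>Deleting the last tope without losing crossings means that it lies on a geodesic from its predecessor
  to \<open>A\<close>.\<close>

lemma last_deleted: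
  assumes "l \<noteq> []" "delete_nth i l \<noteq> []" "i < length l" "crossing_vector E (delete_nth i l @ [A]) = crossing_vector E (l @ [A])"
  shows "Sep E (last l) A \<subseteq> Sep E (last (delete_nth i l)) A"
    and "last (delete_nth i l) = A \<Longrightarrow> Sep E (last l) A = {}"
proof -
  obtain xs a ys where l: "l = xs @ a # ys" "delete_nth i l = xs @ ys" using split_at_delete_nth[OF assms(3)] by metis
  have "Sep E (last l) A \<subseteq> Sep E (last (delete_nth i l)) A \<and> (last (delete_nth i l) = A \<longrightarrow> Sep E (last l) A = {})"
  proof (cases "ys = []")
    case True
    then obtain xs' x where xs: "xs = xs' @ [x]" using assms(2) l by (metis append_Nil2 rev_exhaust)
    have "(if e \<in> Sep E x A then 1 else 0 :: nat) = (if e \<in> Sep E x a then 1 else 0) + (if e \<in> Sep E a A then 1 else 0)" for e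
      using fun_cong[OF assms(4), of e] crossing_vector_delete_middle[of E xs' x a A "[]" e] l xs True by auto
    then have "e \<in> Sep E a A \<Longrightarrow> e \<in> Sep E x A" for e by (metis add_eq_0_iff_both_eq_0 zero_neq_one)
    then show ?thesis using l xs True by auto
  qed (use l in auto)
  then show "Sep E (last l) A \<subseteq> Sep E (last (delete_nth i l)) A"
    "last (delete_nth i l) = A \<Longrightarrow> Sep E (last l) A = {}" by blast+
qed

lemma convex_tope_paths: "convex_lists (tope_paths E \<phi> A W \<gamma>)"
  unfolding convex_lists_def
proof (intro ballI allI impI)
  fix l i j assume l: "l \<in> tope_paths E \<phi> A W \<gamma>" and i: "i < length l" and j: "j < length l - 1"
    and dd: "delete_nth j (delete_nth i l) \<in> tope_paths E \<phi> A W \<gamma>"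
  obtain xs a ys where ll: "l = xs @ a # ys" "delete_nth i l = xs @ ys" using split_at_delete_nth[OF i] by metis
  have j': "j < length (delete_nth i l)" using i j by (simp add: length_delete_nth)
  then obtain xs' a' ys' where ll': "delete_nth i l = xs' @ a' # ys'" "delete_nth j (delete_nth i l) = xs' @ ys'"
    using split_at_delete_nth[of j "delete_nth i l"] by metis
  have ne: "delete_nth i l \<noteq> []" "l \<noteq> []" using j' i by auto
  have ne2: "delete_nth j (delete_nth i l) \<noteq> []" using dd by (simp add: tope_paths_def)
  have "crossing_vector E (delete_nth i l @ [A]) e \<le> \<gamma> e" for e
    using crossing_vector_delete_le[of E xs "ys @ [A]" e a] l ll by (auto simp: tope_paths_def)
  moreover have "\<gamma> e \<le> crossing_vector E (delete_nth i l @ [A]) e" for e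
    using crossing_vector_delete_le[of E xs' "ys' @ [A]" e a'] dd ll' by (auto simp: tope_paths_def)
  ultimately have cv: "crossing_vector E (delete_nth i l @ [A]) = \<gamma>" by (intro ext antisym)
  have "distinct_adj (xs @ ys)"
    by (rule distinct_adj_delete[of xs a ys E \<phi> "[A]"]) (use l ll cv in \<open>auto simp: tope_paths_def\<close>)
  moreover have "Sep E (last (delete_nth i l)) A \<inter> W = {}"
    using last_deleted(1)[OF ne(1) ne2 j', of E A] dd cv by (auto simp: tope_paths_def)
  ultimately show "delete_nth i l \<in> tope_paths E \<phi> A W \<gamma>"
    using ne l ll cv by (auto simp: tope_paths_def)
qed

section \<open>Faces of topes and layers of crossing vectors\<close>

text \<open>Removing one layer: the level sets of \<open>\<gamma> - 1\<close> are those of \<open>\<gamma>\<close> from the second one on.\<close>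

lemma kappa_reduce:
  assumes "finite E" "level_set E \<gamma> 1 \<noteq> {}"
  shows "kappa E \<phi> \<gamma> = matroid_rank \<phi> (level_set E \<gamma> 1) + kappa E \<phi> (\<lambda>e. \<gamma> e - 1)"
proof -
  let ?\<gamma>' = "\<lambda>e. \<gamma> e - 1"
  have fin: "finite (insert 0 (\<gamma> ` E))" using assms(1) by simp
  have "max_entry E \<gamma> - 1 = Max ((\<lambda>n. n - 1) ` insert 0 (\<gamma> ` E))"
    unfolding max_entry_def by (rule mono_Max_commute) (use fin in \<open>auto simp: mono_def\<close>)
  also have "\<dots> = max_entry E ?\<gamma>'" by (simp add: max_entry_def image_image)
  finally have m: "max_entry E ?\<gamma>' = max_entry E \<gamma> - 1" by simp
  obtain e where "e \<in> E" "1 \<le> \<gamma> e" using assms(2) by (auto simp: level_set_def)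
  moreover have "\<gamma> e \<le> max_entry E \<gamma>" unfolding max_entry_def using fin \<open>e \<in> E\<close> by (intro Max_ge) auto
  ultimately have M: "max_entry E \<gamma> = Suc (max_entry E ?\<gamma>')" using m by simp
  have lev: "level_set E ?\<gamma>' i = level_set E \<gamma> (Suc i)" if "1 \<le> i" for i
    using that by (auto simp: level_set_def)
  have "kappa E \<phi> \<gamma> = matroid_rank \<phi> (level_set E \<gamma> 1) +
      (\<Sum>j=Suc 1..Suc (max_entry E ?\<gamma>'). matroid_rank \<phi> (level_set E \<gamma> j))"
    unfolding kappa_def M by (rule sum.atLeast_Suc_atMost) simp
  also have "(\<Sum>j=Suc 1..Suc (max_entry E ?\<gamma>'). matroid_rank \<phi> (level_set E \<gamma> j))
      = (\<Sum>j=1..max_entry E ?\<gamma>'. matroid_rank \<phi> (level_set E \<gamma> (Suc j)))"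
    by (rule sum.atLeast_Suc_atMost_Suc_shift[unfolded o_def])
  also have "\<dots> = kappa E \<phi> ?\<gamma>'" unfolding kappa_def by (rule sum.cong) (use lev in auto)
  finally show ?thesis .
qed

lemma matroid_rank_orient:
  assumes "\<And>e. e \<in> S \<Longrightarrow> A e = 1 \<or> A e = -1"
  shows "matroid_rank (orient A \<phi>) S = matroid_rank \<phi> S"
proof -
  have eq: "orient A \<phi> e = (\<lambda>v. A e * \<phi> e v)" for e by (simp add: orient_def fun_eq_iff)
  have "\<phi> e = (\<lambda>v. A e * orient A \<phi> e v)" if "e \<in> S" for e
    using assms[OF that] by (auto simp: orient_def fun_eq_iff)
  then have "\<phi> e \<in> functional.span (orient A \<phi> ` S)" if "e \<in> S" for e
    using that functional.span_scale[OF functional.span_base[of "orient A \<phi> e" "orient A \<phi> ` S"], of "A e"] by auto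
  moreover have "orient A \<phi> e \<in> functional.span (\<phi> ` S)" if "e \<in> S" for e
    unfolding eq using that by (intro functional.span_scale functional.span_base) auto
  ultimately have "functional.span (orient A \<phi> ` S) = functional.span (\<phi> ` S)"
    by (subst functional.span_eq) auto
  then show ?thesis by (simp add: matroid_rank_def)
qed

context
  fixes E :: "'e set" and \<phi> :: "'e \<Rightarrow> 'v::real_vector \<Rightarrow> real"
  assumes arrangement: "central_arrangement E \<phi>"
begin

lemma finite_E: "finite E" and linear_phi: "e \<in> E \<Longrightarrow> linear (\<phi> e)"
  using arrangement by (auto simp: central_arrangement_def)

lemma linear_orient:
  assumes "e \<in> E" shows "linear (orient A \<phi> e)"
proof -
  have "orient A \<phi> e = (\<lambda>v. A e *\<^sub>R \<phi> e v)" by (simp add: orient_def fun_eq_iff)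
  then show ?thesis using linear_compose_scale_right[OF linear_phi[OF assms], of "A e"] by simp
qed

lemma orient_zero_iff: "A \<in> topes E \<phi> \<Longrightarrow> e \<in> E \<Longrightarrow> orient A \<phi> e v = 0 \<longleftrightarrow> \<phi> e v = 0"
  using tope_cases[of A E \<phi> e] by (auto simp: orient_def)

lemma orient_pos_iff: "A \<in> topes E \<phi> \<Longrightarrow> e \<in> E \<Longrightarrow> 0 < orient A \<phi> e v \<longleftrightarrow> A e = sgn (\<phi> e v)"
  using tope_cases[of A E \<phi> e] by (auto simp: orient_def sgn_if)

text \<open>The faces of the tope \<open>A\<close> are the sets of hyperplanes whose deletion from \<open>A\<close> leaves a covector, as in
  the definition of tope-admissibility.\<close>

lemma tope_faces_iff:
  assumes A: "A \<in> topes E \<phi>"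
  shows "Z \<in> tope_faces E \<phi> A \<longleftrightarrow> Z \<subseteq> E \<and> zero_on A Z \<in> covectors E \<phi>"
proof -
  have "zero_on A Z = (\<lambda>e. if e \<in> E then sgn (\<phi> e x) else 0) \<longleftrightarrow>
    (\<forall>e\<in>Z. orient A \<phi> e x = 0) \<and> (\<forall>e\<in>E - Z. 0 < orient A \<phi> e x)" if "Z \<subseteq> E" for x
  proof
    assume eq: "zero_on A Z = (\<lambda>e. if e \<in> E then sgn (\<phi> e x) else 0)"
    show "(\<forall>e\<in>Z. orient A \<phi> e x = 0) \<and> (\<forall>e\<in>E - Z. 0 < orient A \<phi> e x)"
    proof (intro conjI ballI)
      fix e assume "e \<in> Z"
      then show "orient A \<phi> e x = 0"
        using fun_cong[OF eq, of e] that A by (auto simp: orient_zero_iff zero_on_def sgn_zero_iff subset_iff)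
    next
      fix e assume "e \<in> E - Z"
      then show "0 < orient A \<phi> e x"
        using fun_cong[OF eq, of e] that A by (auto simp: orient_pos_iff zero_on_def)
    qed
  next
    assume R: "(\<forall>e\<in>Z. orient A \<phi> e x = 0) \<and> (\<forall>e\<in>E - Z. 0 < orient A \<phi> e x)"
    show "zero_on A Z = (\<lambda>e. if e \<in> E then sgn (\<phi> e x) else 0)"
    proof
      fix e
      show "zero_on A Z e = (if e \<in> E then sgn (\<phi> e x) else 0)"
        using R that A tope_outside[OF A, of e]
        by (cases "e \<in> Z"; cases "e \<in> E") (auto simp: zero_on_def orient_zero_iff orient_pos_iff)
    qed
  qed
  then show ?thesis unfolding faces_def covectors_def by auto
qed

lemma empty_face: assumes "A \<in> topes E \<phi>" shows "{} \<in> tope_faces E \<phi> A"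
proof -
  obtain a where "\<And>e. e \<in> E \<Longrightarrow> A e = sgn (\<phi> e a)" using tope_point[OF assms] by blast
  then show ?thesis using assms by (auto simp: faces_def orient_pos_iff)
qed

lemma full_face: "E \<in> tope_faces E \<phi> A"
  using linear_0[OF linear_orient] by (auto simp: faces_def)

lemma tope_generic:
  assumes "A \<in> topes E \<phi>" "X \<in> topes E \<phi>"
  obtains x where "generic_on E (orient A \<phi>) {} x" "negative_set E (orient A \<phi>) x = Sep E X A"
proof -
  obtain x where x: "\<And>e. e \<in> E \<Longrightarrow> X e = sgn (\<phi> e x)" using tope_point[OF assms(2)] by blast
  have nz: "\<phi> e x \<noteq> 0" if "e \<in> E" for e using x[OF that] tope_cases[OF assms(2) that] by auto
  have "generic_on E (orient A \<phi>) {} x" using nz assms(1) by (auto simp: generic_on_def orient_zero_iff)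
  moreover have "negative_set E (orient A \<phi>) x = Sep E X A"
  proof -
    have "orient A \<phi> e x < 0 \<longleftrightarrow> X e \<noteq> A e" if "e \<in> E" for e
      using orient_pos_iff[OF assms(1) that, of x] orient_zero_iff[OF assms(1) that, of x] nz[OF that] x[OF that]
      by (metis less_irrefl linorder_neqE_linordered_idom order.asym)
    then show ?thesis by (auto simp: negative_set_def Sep_def)
  qed
  ultimately show ?thesis by (rule that)
qed

lemma flip_empty [simp]: "flip A {} = A" by (simp add: flip_def)
lemma flip_flip [simp]: "flip (flip A Z) Z = A" by (auto simp: flip_def)

lemma generic_flip_tope:
  assumes A: "A \<in> topes E \<phi>" and x: "generic_on E (orient A \<phi>) {} x"
  shows "flip A (negative_set E (orient A \<phi>) x) \<in> topes E \<phi>"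
proof -
  let ?N = "negative_set E (orient A \<phi>) x"
  have eq: "flip A ?N e = sgn (\<phi> e x)" if e: "e \<in> E" for e
  proof -
    have "orient A \<phi> e x \<noteq> 0" using x e by (auto simp: generic_on_def)
    then show ?thesis using tope_cases[OF A e] e by (auto simp: flip_def negative_set_def orient_def sgn_if)
  qed
  have "flip A ?N = (\<lambda>e. if e \<in> E then sgn (\<phi> e x) else 0)"
    using eq tope_outside[OF A] by (auto simp: fun_eq_iff flip_def negative_set_def)
  moreover have "flip A ?N e \<noteq> 0" if "e \<in> E" for e
    using tope_cases[OF A that] by (auto simp: flip_def)
  ultimately show ?thesis unfolding topes_def covectors_def by blast
qed

text \<open>Reflecting a chamber in one of its faces gives a chamber: go from the face a little beyond it.\<close>

lemma flip_face_tope: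
  assumes A: "A \<in> topes E \<phi>" and Z: "Z \<in> tope_faces E \<phi> A"
  shows "flip A Z \<in> topes E \<phi>"
proof (cases "Z = {}")
  case False
  obtain x where x: "generic_on E (orient A \<phi>) {} x" "negative_set E (orient A \<phi>) x = Z - {}"
    by (rule face_beyond[OF finite_E _ empty_face[OF A] Z]) (use linear_orient False in auto)
  then show ?thesis using generic_flip_tope[OF A x(1)] by simp
qed (use A in simp)

lemma flip_face_self:
  assumes "A \<in> topes E \<phi>" "Z \<in> tope_faces E \<phi> A" shows "Z \<in> tope_faces E \<phi> (flip A Z)"
proof -
  obtain y where y: "\<forall>e\<in>Z. orient A \<phi> e y = 0" "\<forall>e\<in>E - Z. 0 < orient A \<phi> e y" "Z \<subseteq> E" using assms(2) by (auto simp: faces_def)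
  then have "(\<forall>e\<in>Z. orient (flip A Z) \<phi> e y = 0) \<and> (\<forall>e\<in>E - Z. 0 < orient (flip A Z) \<phi> e y)"
    by (auto simp: orient_def flip_def)
  then show ?thesis using y(3) by (auto simp: faces_def)
qed

text \<open>Near the face \<open>U\<close> the arrangement is symmetric about it, so \<open>A\<close> and its reflection have
  the same faces containing \<open>U\<close>. A witness for \<open>Z\<close> is a point of the span of \<open>Z\<close> beyond \<open>U\<close>.\<close>

lemma flip_subface:
  assumes A: "A \<in> topes E \<phi>" and U: "U \<in> tope_faces E \<phi> A" and Z: "Z \<in> tope_faces E \<phi> A" "Z \<subseteq> U"
  shows "Z \<in> tope_faces E \<phi> (flip A U)"
proof (cases "Z = U")
  case False
  obtain x where x: "generic_on E (orient A \<phi>) Z x" "negative_set E (orient A \<phi>) x = U - Z"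
    by (rule face_beyond[OF finite_E _ Z(1) U]) (use linear_orient Z False in auto)
  have UE: "U \<subseteq> E" using U by (simp add: faces_def)
  have "\<forall>e\<in>Z. orient (flip A U) \<phi> e x = 0" using x(1) by (auto simp: generic_on_def orient_def flip_def)
  moreover have "\<forall>e\<in>E - Z. 0 < orient (flip A U) \<phi> e x"
  proof
    fix e assume e: "e \<in> E - Z"
    have "orient A \<phi> e x \<noteq> 0" using x(1) e by (auto simp: generic_on_def)
    moreover have "orient A \<phi> e x < 0 \<longleftrightarrow> e \<in> U" using x(2) e unfolding negative_set_def by blast
    ultimately consider "e \<in> U" "orient A \<phi> e x < 0" | "e \<notin> U" "0 < orient A \<phi> e x" by linarith
    then show "0 < orient (flip A U) \<phi> e x" by cases (auto simp: orient_def flip_def)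
  qed
  ultimately show ?thesis using Z UE by (auto simp: faces_def)
qed (use flip_face_self[OF A U] in simp)

lemma flip_subface_iff:
  assumes A: "A \<in> topes E \<phi>" and U: "U \<in> tope_faces E \<phi> A" and "Z \<subseteq> U"
  shows "Z \<in> tope_faces E \<phi> (flip A U) \<longleftrightarrow> Z \<in> tope_faces E \<phi> A"
  using flip_subface[OF A U _ assms(3)]
    flip_subface[OF flip_face_tope[OF A U] flip_face_self[OF A U] _ assms(3)] by auto

text \<open>\<open>acyclic_visible_faces\<close> for the arrangement localised at \<open>W\<close>: moving a point of \<open>X\<close> close to the face \<open>W\<close>
  keeps only the separating hyperplanes in \<open>W\<close>.\<close>

lemma acyclic_star_faces:
  assumes A: "A \<in> topes E \<phi>" and X: "X \<in> topes E \<phi>" and W: "W \<in> tope_faces E \<phi> A" and ne: "Sep E X A \<inter> W \<noteq> {}"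
  shows "acyclic_lists (order_chains (visible_faces E (orient A \<phi>) {} (Sep E X A \<inter> W)))"
proof -
  let ?\<psi> = "orient A \<phi>"
  obtain x where x: "generic_on E ?\<psi> {} x" "negative_set E ?\<psi> x = Sep E X A" by (rule tope_generic[OF A X])
  obtain y where y: "\<forall>e\<in>W. sgn (?\<psi> e y) = - sgn (?\<psi> e (- x))" "\<forall>e\<in>E - W. 0 < ?\<psi> e y"
    by (rule push_off_face[OF finite_E _ W]) (rule linear_orient)
  have minus: "?\<psi> e (- x) = - ?\<psi> e x" if "e \<in> E" for e using linear_neg[OF linear_orient[OF that]] .
  have sign: "?\<psi> e y < 0 \<longleftrightarrow> ?\<psi> e x < 0 \<and> e \<in> W" "?\<psi> e y \<noteq> 0" if "e \<in> E" for e
  proof -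
    have "?\<psi> e x \<noteq> 0" using x(1) that by (simp add: generic_on_def)
    moreover have "sgn (?\<psi> e y) = sgn (?\<psi> e x)" if "e \<in> W"
      using y(1) that minus[OF \<open>e \<in> E\<close>] by (simp add: sgn_minus)
    moreover have "0 < ?\<psi> e y" if "e \<notin> W" using y(2) that \<open>e \<in> E\<close> by blast
    ultimately show "?\<psi> e y < 0 \<longleftrightarrow> ?\<psi> e x < 0 \<and> e \<in> W" "?\<psi> e y \<noteq> 0"
      by (metis less_irrefl order.asym sgn_0_0 sgn_less)+
  qed
  have gen: "generic_on E ?\<psi> {} y" using sign(2) by (simp add: generic_on_def)
  have neg: "negative_set E ?\<psi> y = Sep E X A \<inter> W"
    using x(2) sign(1) by (auto simp: negative_set_def)
  have "acyclic_lists (order_chains (visible_faces E ?\<psi> {} (negative_set E ?\<psi> y)))"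
    by (rule acyclic_visible_faces[OF finite_E _ empty_face[OF A] gen]) (use linear_orient neg ne in auto)
  then show ?thesis by (simp add: neg)
qed

text \<open>The path may be extended by \<open>A\<close> itself, so the complex is a cone. For \<open>\<gamma> = 0\<close> it would consist of the
  list \<open>[A]\<close> alone.\<close>

lemma tope_paths_unrestricted_acyclic:
  assumes A: "A \<in> topes E \<phi>" and "\<gamma> \<noteq> (\<lambda>_. 0)"
  shows "acyclic_lists (tope_paths E \<phi> A {} \<gamma>)"
proof -
  let ?X = "tope_paths E \<phi> A {} \<gamma>"
  define Y where "Y = {l \<in> ?X. last l \<noteq> A}"
  have snoc: "l @ [A] \<in> ?X \<longleftrightarrow> l \<in> Y" for l
  proof (cases "l = []")
    case True
    then show ?thesis using assms by (auto simp: tope_paths_def Y_def crossing_vector_Cons_Cons)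
  next
    case False
    have "crossing_vector E (l @ [A, A]) = crossing_vector E (l @ [A])"
      using crossing_vector_append[of E l A "[A]"] by (simp add: fun_eq_iff crossing_vector_Cons_Cons)
    then show ?thesis using False A by (auto simp: tope_paths_def Y_def distinct_adj_append_iff)
  qed
  show ?thesis
  proof (rule acyclic_cone[where Y = Y and a = A])
    show "?X = Y \<union> (\<lambda>l. l @ [A]) ` Y"
    proof (intro equalityI subsetI)
      fix l assume l: "l \<in> ?X"
      show "l \<in> Y \<union> (\<lambda>l. l @ [A]) ` Y"
      proof (cases "last l = A")
        case True
        then have "l = butlast l @ [A]" using l by (simp add: tope_paths_def flip: True)
        then show ?thesis using l snoc by (metis UnI2 image_eqI)
      qed (use l in \<open>simp add: Y_def\<close>)
    qed (use snoc in \<open>auto simp: Y_def\<close>)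
    show "subcomplex Y ?X"
      unfolding subcomplex_def
    proof (intro conjI ballI allI impI)
      fix l i assume l: "l \<in> Y" "i < length l" "delete_nth i l \<in> ?X"
      have lX: "l \<in> ?X" using l(1) by (simp add: Y_def)
      have "last (delete_nth i l) \<noteq> A"
      proof
        assume "last (delete_nth i l) = A"
        then have "Sep E (last l) A = {}"
          using last_deleted(2)[of l i E A] l(2,3) lX by (auto simp: tope_paths_def)
        moreover have "last l \<in> topes E \<phi>" using lX by (auto simp: tope_paths_def)
        ultimately show False using Sep_empty_iff[of "last l" E \<phi> A] A l(1) by (auto simp: Y_def)
      qed
      then show "delete_nth i l \<in> Y" using l(3) by (simp add: Y_def)
    qed (simp add: Y_def)
    show "last l \<noteq> A" if "l \<in> Y" for l using that by (simp add: Y_def)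
  qed
qed

text \<open>If all of \<open>Z\<close> is crossed in the final step, a geodesic for this step can be chosen through the reflection of \<open>A\<close>
  in \<open>Z\<close>, and the rest of the step crosses no hyperplane of \<open>Z\<close>.\<close>

lemma tope_paths_crossing_face:
  assumes A: "A \<in> topes E \<phi>" and Z: "Z \<in> tope_faces E \<phi> A" "\<forall>e\<in>Z. 1 \<le> \<gamma> e"
  shows "{l \<in> tope_paths E \<phi> A {} \<gamma>. Z \<subseteq> Sep E (last l) A}
    = tope_paths E \<phi> (flip A Z) Z (\<lambda>e. \<gamma> e - (if e \<in> Z then 1 else 0))"
proof -
  have ZE: "Z \<subseteq> E" using Z by (simp add: faces_def)
  have *: "crossing_vector E (l @ [A]) = \<gamma> \<and> Z \<subseteq> Sep E (last l) A \<longleftrightarrow>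
    crossing_vector E (l @ [flip A Z]) = (\<lambda>e. \<gamma> e - (if e \<in> Z then 1 else 0)) \<and> Sep E (last l) (flip A Z) \<inter> Z = {}"
    if l: "l \<noteq> []" "set l \<subseteq> topes E \<phi>" for l
  proof -
    have last: "last l \<in> topes E \<phi>" using l by auto
    have S: "Sep E (last l) (flip A Z) = (Sep E (last l) A - Z) \<union> (Z - Sep E (last l) A)"
      by (rule Sep_flip[OF last A ZE])
    then have iff: "Z \<subseteq> Sep E (last l) A \<longleftrightarrow> Sep E (last l) (flip A Z) \<inter> Z = {}" by blast
    have "crossing_vector E (l @ [A]) = \<gamma> \<longleftrightarrow> crossing_vector E (l @ [flip A Z]) = (\<lambda>e. \<gamma> e - (if e \<in> Z then 1 else 0))"
      if sub: "Z \<subseteq> Sep E (last l) A"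
    proof -
      have "crossing_vector E (l @ [A]) e = crossing_vector E (l @ [flip A Z]) e + (if e \<in> Z then 1 else 0)" for e
        unfolding crossing_vector_snoc[OF l(1)] S using sub by auto
      then have "crossing_vector E (l @ [A]) e = \<gamma> e \<longleftrightarrow>
         crossing_vector E (l @ [flip A Z]) e = \<gamma> e - (if e \<in> Z then 1 else 0)" for e
        using Z(2) by (cases "e \<in> Z") (auto dest: bspec)
      then show ?thesis by (simp add: fun_eq_iff)
    qed
    then show ?thesis using iff by blast
  qed
  show ?thesis unfolding tope_paths_def using * by blast
qed

end

section \<open>Resolving path complexes by flags of faces\<close>

text \<open>Pairs of a path and a flag of faces of \<open>A\<close> that are crossed in the final step and lie in \<open>W\<close>. Fixing the
  path or fixing the flag gives two descriptions of the same homology.\<close>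

definition resolution ::
  "'e set \<Rightarrow> ('e \<Rightarrow> 'v \<Rightarrow> real) \<Rightarrow> 'e sign_vector \<Rightarrow> 'e set \<Rightarrow> ('e \<Rightarrow> nat) \<Rightarrow> ('e sign_vector + 'e set) list set" where
  "resolution E \<phi> A W \<gamma> = joined_complex (tope_paths E \<phi> A {} \<gamma>)
     (\<lambda>l. visible_faces E (orient A \<phi>) {} (Sep E (last l) A \<inter> W))"

context
  fixes E :: "'e set" and \<phi> :: "'e \<Rightarrow> 'v::real_vector \<Rightarrow> real"
  assumes arrangement: "central_arrangement E \<phi>"
begin

lemma convex_resolution: "convex_lists (resolution E \<phi> A W \<gamma>)"
  unfolding resolution_def
proof (rule convex_joined_complex[OF convex_tope_paths])
  show "growing_family (tope_paths E \<phi> A {} \<gamma>) (\<lambda>l. visible_faces E (orient A \<phi>) {} (Sep E (last l) A \<inter> W))"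
    unfolding growing_family_def
  proof (intro ballI allI impI)
    fix l i assume l: "l \<in> tope_paths E \<phi> A {} \<gamma>" "i < length l" "delete_nth i l \<in> tope_paths E \<phi> A {} \<gamma>"
    then have "Sep E (last l) A \<subseteq> Sep E (last (delete_nth i l)) A"
      by (intro last_deleted(1)) (auto simp: tope_paths_def)
    then show "visible_faces E (orient A \<phi>) {} (Sep E (last l) A \<inter> W)
      \<subseteq> visible_faces E (orient A \<phi>) {} (Sep E (last (delete_nth i l)) A \<inter> W)"
      by (auto simp: visible_faces_def)
  qed
qed

lemma finite_resolution: "finite (resolution E \<phi> A W \<gamma>)"
  unfolding resolution_def
proof (rule finite_joined_complex)
  show "finite (tope_paths E \<phi> A {} \<gamma>)" by (rule finite_tope_paths[OF finite_E[OF arrangement]])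
  show "finite (visible_faces E (orient A \<phi>) {} S)" for S
    using finite_faces[OF finite_E[OF arrangement], of "orient A \<phi>"] by (simp add: visible_faces_def)
qed

lemma joined_in_resolution:
  "joined l z \<in> resolution E \<phi> A W \<gamma> \<longleftrightarrow> l \<in> tope_paths E \<phi> A {} \<gamma> \<and>
     z \<in> order_chains (visible_faces E (orient A \<phi>) {} (Sep E (last l) A \<inter> W))"
  by (simp add: resolution_def)

lemma resolution_joined: "w \<in> resolution E \<phi> A W \<gamma> \<Longrightarrow> \<exists>l z. w = joined l z"
  by (auto simp: resolution_def joined_complex_def)

text \<open>For a fixed path, the flags form an acyclic complex if the final step crosses \<open>W\<close>, because the
  faces in question are those visible from its tope. Otherwise only the empty flag is left.\<close>

lemma resolution_quasi_paths:
  assumes A: "A \<in> topes E \<phi>" and W: "W \<in> tope_faces E \<phi> A"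
  shows "acyclic_lists (tope_paths E \<phi> A W \<gamma>) \<longleftrightarrow> acyclic_lists (resolution E \<phi> A W \<gamma>)"
    and "sphere_lists (resolution E \<phi> A W \<gamma>) n \<Longrightarrow> sphere_lists (tope_paths E \<phi> A W \<gamma>) n"
proof -
  let ?R = "resolution E \<phi> A W \<gamma>"
  define Y where "Y = {w \<in> ?R. Sep E (last (left_part w)) A \<inter> W \<noteq> {}}"
  have inY: "joined l z \<in> Y \<longleftrightarrow> joined l z \<in> ?R \<and> Sep E (last l) A \<inter> W \<noteq> {}" for l z by (simp add: Y_def)
  have sub: "subcomplex Y ?R"
    unfolding subcomplex_def
  proof (intro conjI ballI allI impI)
    fix w i assume w: "w \<in> Y" "i < length w" "delete_nth i w \<in> ?R"
    then obtain l z where lz: "w = joined l z" using resolution_joined[of w A W \<gamma>] unfolding Y_def by blast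
    show "delete_nth i w \<in> Y"
      using w(2)[unfolded lz]
    proof (cases rule: delete_joined_cases)
      case 1
      have "l \<in> tope_paths E \<phi> A {} \<gamma>" "delete_nth i l \<in> tope_paths E \<phi> A {} \<gamma>"
        using w 1 lz by (auto simp: Y_def joined_in_resolution)
      then have "Sep E (last l) A \<subseteq> Sep E (last (delete_nth i l)) A"
        by (intro last_deleted(1)) (use 1 in \<open>auto simp: tope_paths_def\<close>)
      then show ?thesis using w 1 lz by (auto simp: inY)
    next
      case (2 j)
      then show ?thesis using w lz by (auto simp: inY)
    qed
  qed (auto simp: Y_def)
  have acyc: "acyclic_lists Y"
  proof (rule acyclic_by_left_part)
    show "finite Y" using finite_resolution by (simp add: Y_def)
    show "convex_lists Y" using subcomplex_convex(1)[OF convex_resolution sub] .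
    show "\<exists>x z. w = joined x z" if "w \<in> Y" for w using that resolution_joined by (auto simp: Y_def)
    fix l assume "l \<in> left_part ` Y"
    then obtain z where "joined l z \<in> Y" using resolution_joined by (fastforce simp: Y_def)
    then have l: "l \<in> tope_paths E \<phi> A {} \<gamma>" "Sep E (last l) A \<inter> W \<noteq> {}" by (auto simp: inY joined_in_resolution)
    have "last l \<in> topes E \<phi>" using l(1) by (auto simp: tope_paths_def)
    then have "acyclic_lists (order_chains (visible_faces E (orient A \<phi>) {} (Sep E (last l) A \<inter> W)))"
      using acyclic_star_faces[OF arrangement A _ W l(2)] by blast
    moreover have "{z. joined l z \<in> Y} = order_chains (visible_faces E (orient A \<phi>) {} (Sep E (last l) A \<inter> W))"
      using l by (auto simp: inY joined_in_resolution)
    ultimately show "acyclic_lists {z. joined l z \<in> Y}" by simp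
  qed
  have vis: "visible_faces E (orient A \<phi>) {} {} = {}" by (auto simp: visible_faces_def)
  have quotient: "?R - Y = (\<lambda>l. [] @ map Inl l @ []) ` tope_paths E \<phi> A W \<gamma>"
  proof (intro equalityI subsetI)
    fix w assume w: "w \<in> ?R - Y"
    then obtain l z where lz: "w = joined l z" using resolution_joined by blast
    then have l: "l \<in> tope_paths E \<phi> A {} \<gamma>" "Sep E (last l) A \<inter> W = {}"
      "z \<in> order_chains (visible_faces E (orient A \<phi>) {} (Sep E (last l) A \<inter> W))"
      using w by (auto simp: inY joined_in_resolution)
    then have "z = []" "l \<in> tope_paths E \<phi> A W \<gamma>"
      using vis by (auto simp: order_chains_def tope_paths_def)
    then show "w \<in> (\<lambda>l. [] @ map Inl l @ []) ` tope_paths E \<phi> A W \<gamma>" by (simp add: lz joined_def)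
  next
    fix w :: "('e sign_vector + 'e set) list" assume "w \<in> (\<lambda>l. [] @ map Inl l @ []) ` tope_paths E \<phi> A W \<gamma>"
    then obtain l where l: "w = joined l []" "l \<in> tope_paths E \<phi> A W \<gamma>" by (auto simp: joined_def)
    then show "w \<in> ?R - Y" by (auto simp: inY joined_in_resolution tope_paths_def)
  qed
  show "acyclic_lists (tope_paths E \<phi> A W \<gamma>) \<longleftrightarrow> acyclic_lists ?R"
    using quotient acyclic_quotient_iff[OF convex_resolution sub acyc]
      acyclic_pad_iff[of "Inl :: _ \<Rightarrow> 'e sign_vector + 'e set" "tope_paths E \<phi> A W \<gamma>" "[]" "[]"]
    by (simp add: inj_on_def)
  assume sp: "sphere_lists ?R n"
  then have sp': "sphere_lists ((\<lambda>l. [] @ map Inl l @ []) ` tope_paths E \<phi> A W \<gamma> :: ('e sign_vector + 'e set) list set) n"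
    using sphere_quotient_iff[OF convex_resolution sub acyc] quotient by simp
  show "sphere_lists (tope_paths E \<phi> A W \<gamma>) n"
    using sphere_pad_iff[of "Inl :: _ \<Rightarrow> 'e sign_vector + 'e set" "tope_paths E \<phi> A W \<gamma>" "[]" "[]" n] sp'
    by (simp add: inj_on_def)
qed

text \<open>For a fixed flag with largest face \<open>Z\<close>, the paths are the tope paths to the reflection of \<open>A\<close> in \<open>Z\<close>. By
  the assumption \<open>IH\<close> they are acyclic unless \<open>Z\<close> is the whole support \<open>U\<close> of \<open>\<gamma>\<close>, and the empty flag gives the cone
  of \<open>tope_paths_unrestricted_acyclic\<close>. So only the flags headed by \<open>U\<close> contribute.\<close>

lemma resolution_quasi_flags:
  assumes A: "A \<in> topes E \<phi>" and W: "W \<in> tope_faces E \<phi> A" and \<gamma>: "\<gamma> \<in> nat_vectors E" "\<gamma> \<noteq> (\<lambda>_. 0)"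
    and IH: "\<And>Z. Z \<in> tope_faces E \<phi> A \<Longrightarrow> Z \<noteq> {} \<Longrightarrow> Z \<subset> level_set E \<gamma> 1 \<Longrightarrow>
      acyclic_lists (tope_paths E \<phi> (flip A Z) Z (\<lambda>e. \<gamma> e - (if e \<in> Z then 1 else 0)))"
  defines "U \<equiv> level_set E \<gamma> 1"
  defines "F \<equiv> if U \<in> tope_faces E \<phi> A \<and> U \<subseteq> W
     then flag_complex E (orient A \<phi>) (tope_paths E \<phi> (flip A U) U (\<lambda>e. \<gamma> e - 1)) {} U else {}"
  shows "acyclic_lists (resolution E \<phi> A W \<gamma>) \<longleftrightarrow> acyclic_lists F"
    and "sphere_lists (resolution E \<phi> A W \<gamma>) n \<longleftrightarrow> sphere_lists F n"
proof -
  let ?R = "resolution E \<phi> A W \<gamma>"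
  let ?T = "tope_paths E \<phi> A {} \<gamma>"
  define Y where "Y = {w \<in> ?R. \<not> (\<exists>z. right_part w = U # z)}"
  have inY: "joined l z \<in> Y \<longleftrightarrow> joined l z \<in> ?R \<and> \<not> (\<exists>z'. z = U # z')" for l z by (simp add: Y_def)
  have SepU: "Sep E (last l) A \<subseteq> U" if "l \<in> ?T" for l
  proof
    fix e assume e: "e \<in> Sep E (last l) A"
    have "l \<noteq> []" "crossing_vector E (l @ [A]) = \<gamma>" using that by (auto simp: tope_paths_def)
    then have "1 \<le> \<gamma> e" using crossing_vector_snoc[of l E A e] e by auto
    then show "e \<in> U" using e by (simp add: U_def level_set_def Sep_def)
  qed
  have zU: "set z \<subseteq> Pow U" if "joined l z \<in> ?R" for l z
    using that SepU[of l] by (auto simp: joined_in_resolution order_chains_def visible_faces_def)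
  have sub: "subcomplex Y ?R"
    unfolding subcomplex_def
  proof (intro conjI ballI allI impI)
    fix w i assume w: "w \<in> Y" "i < length w" "delete_nth i w \<in> ?R"
    then obtain l z where lz: "w = joined l z" using resolution_joined[of w A W \<gamma>] unfolding Y_def by blast
    show "delete_nth i w \<in> Y"
      using w(2)[unfolded lz]
    proof (cases rule: delete_joined_cases)
      case 1
      then show ?thesis using w lz by (auto simp: inY)
    next
      case (2 j)
      have "\<not> (\<exists>z'. delete_nth j z = U # z')"
      proof
        assume "\<exists>z'. delete_nth j z = U # z'"
        then have "U \<in> set z" using set_delete_nth[of j z] by auto
        then obtain z1 z2 where z: "z = z1 @ U # z2" by (meson split_list)
        have "joined l z \<in> ?R" using w(1) lz by (simp add: inY)
        then have "\<forall>B\<in>set z1. U \<subset> B" "set z1 \<subseteq> Pow U"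
          using zU[of l z] z by (simp_all add: joined_in_resolution order_chains_append)
        then have "\<forall>B\<in>set z1. False" by blast
        then have "z = U # z2" using z by simp
        then show False using w(1) lz by (simp add: inY)
      qed
      then show ?thesis using w 2 lz by (auto simp: inY)
    qed
  qed (auto simp: Y_def)
  have acyc: "acyclic_lists Y"
  proof (rule acyclic_by_right_part)
    show "finite Y" using finite_resolution by (simp add: Y_def)
    show "convex_lists Y" using subcomplex_convex(1)[OF convex_resolution sub] .
    show "\<exists>x z. w = joined x z" if "w \<in> Y" for w using that resolution_joined by (auto simp: Y_def)
    fix z assume "z \<in> right_part ` Y"
    then obtain l0 where l0: "joined l0 z \<in> Y" using resolution_joined by (fastforce simp: Y_def)
    then have z: "z \<in> order_chains (visible_faces E (orient A \<phi>) {} (Sep E (last l0) A \<inter> W))"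
      "\<not> (\<exists>z'. z = U # z')" "set z \<subseteq> Pow U" using zU by (auto simp: inY joined_in_resolution)
    show "acyclic_lists {l. joined l z \<in> Y}"
    proof (cases z)
      case Nil
      then have "{l. joined l z \<in> Y} = ?T" by (auto simp: inY joined_in_resolution)
      then show ?thesis using tope_paths_unrestricted_acyclic[OF arrangement A \<gamma>(2)] by simp
    next
      case (Cons Z z')
      have Z: "Z \<in> tope_faces E \<phi> A" "Z \<noteq> {}" "Z \<subseteq> W" "Z \<subset> U"
        using z Cons by (auto simp: order_chains_Cons visible_faces_def)
      have "z \<in> order_chains (visible_faces E (orient A \<phi>) {} (Sep E (last l) A \<inter> W)) \<longleftrightarrow> Z \<subseteq> Sep E (last l) A" for l
      proof
        assume "z \<in> order_chains (visible_faces E (orient A \<phi>) {} (Sep E (last l) A \<inter> W))"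
        then show "Z \<subseteq> Sep E (last l) A" by (simp add: Cons order_chains_Cons visible_faces_def)
      next
        assume S: "Z \<subseteq> Sep E (last l) A"
        have "B \<subseteq> Z" if "B \<in> set z" for B
          using that z(1) by (auto simp: Cons order_chains_Cons)
        then have "set z \<subseteq> visible_faces E (orient A \<phi>) {} (Sep E (last l) A \<inter> W)"
          using z(1) S by (fastforce simp: order_chains_def visible_faces_def)
        then show "z \<in> order_chains (visible_faces E (orient A \<phi>) {} (Sep E (last l) A \<inter> W))"
          using z(1) by (simp add: order_chains_def)
      qed
      then have "{l. joined l z \<in> Y} = {l \<in> ?T. Z \<subseteq> Sep E (last l) A}"
        using z(2) by (auto simp: inY joined_in_resolution)
      also have "\<dots> = tope_paths E \<phi> (flip A Z) Z (\<lambda>e. \<gamma> e - (if e \<in> Z then 1 else 0))"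
        by (rule tope_paths_crossing_face[OF arrangement A Z(1)]) (use Z(4) in \<open>auto simp: U_def level_set_def\<close>)
      finally show ?thesis using IH Z U_def by simp
    qed
  qed
  have "?R - Y = F"
  proof -
    have RY: "?R - Y = {joined l (U # z) | l z. joined l (U # z) \<in> ?R}"
      using resolution_joined by (fastforce simp: Y_def)
    show ?thesis
    proof (cases "U \<in> tope_faces E \<phi> A \<and> U \<subseteq> W")
      case True
      have "U \<noteq> {}"
      proof -
        obtain e where "\<gamma> e \<noteq> 0" using \<gamma>(2) by (auto simp: fun_eq_iff)
        then have "e \<in> U" using \<gamma>(1) by (auto simp: U_def level_set_def nat_vectors_def)
        then show ?thesis by blast
      qed
      have eq: "{l \<in> ?T. U \<subseteq> Sep E (last l) A} = tope_paths E \<phi> (flip A U) U (\<lambda>e. \<gamma> e - 1)"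
      proof -
        have "{l \<in> ?T. U \<subseteq> Sep E (last l) A} = tope_paths E \<phi> (flip A U) U (\<lambda>e. \<gamma> e - (if e \<in> U then 1 else 0))"
          by (rule tope_paths_crossing_face[OF arrangement A]) (use True in \<open>auto simp: U_def level_set_def\<close>)
        also have "(\<lambda>e. \<gamma> e - (if e \<in> U then 1 else 0)) = (\<lambda>e. \<gamma> e - 1)"
          using \<gamma>(1) by (force simp: U_def level_set_def nat_vectors_def)
        finally show ?thesis .
      qed
      have "joined l (U # z) \<in> ?R \<longleftrightarrow> l \<in> {l \<in> ?T. U \<subseteq> Sep E (last l) A} \<and> z \<in> order_chains (faces_between E (orient A \<phi>) {} U)" for l z
      proof
        assume R: "joined l (U # z) \<in> ?R"
        then have l: "l \<in> ?T" "U \<subseteq> Sep E (last l) A" by (auto simp: joined_in_resolution order_chains_Cons visible_faces_def)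
        moreover have "z \<in> order_chains (faces_between E (orient A \<phi>) {} U)"
          using R unfolding joined_in_resolution order_chains_def visible_faces_def faces_between_def by auto
        ultimately show "l \<in> {l \<in> ?T. U \<subseteq> Sep E (last l) A} \<and> z \<in> order_chains (faces_between E (orient A \<phi>) {} U)" by simp
      next
        assume R: "l \<in> {l \<in> ?T. U \<subseteq> Sep E (last l) A} \<and> z \<in> order_chains (faces_between E (orient A \<phi>) {} U)"
        then have "Sep E (last l) A = U" using SepU by auto
        then have "Sep E (last l) A \<inter> W = U" using True by auto
        moreover have "U # z \<in> order_chains (visible_faces E (orient A \<phi>) {} U)"
          using R True \<open>U \<noteq> {}\<close> unfolding order_chains_def visible_faces_def faces_between_def by auto
        ultimately show "joined l (U # z) \<in> ?R" using R by (simp add: joined_in_resolution)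
      qed
      then show ?thesis using True unfolding RY F_def flag_complex_def eq[symmetric] by auto
    next
      case False
      have "joined l (U # z) \<notin> ?R" for l z
        using False by (auto simp: joined_in_resolution order_chains_Cons visible_faces_def)
      then show ?thesis using False unfolding RY F_def by auto
    qed
  qed
  then show "acyclic_lists ?R \<longleftrightarrow> acyclic_lists F" "sphere_lists ?R n \<longleftrightarrow> sphere_lists F n"
    using acyclic_quotient_iff[OF convex_resolution sub acyc] sphere_quotient_iff[OF convex_resolution sub acyc] by simp_all
qed

text \<open>Induction on the total number of crossings. Each round strips off the support \<open>U\<close> of \<open>\<gamma>\<close>, which has to be a
  face of \<open>A\<close>; it reflects \<open>A\<close> in \<open>U\<close>, lowers \<open>\<gamma>\<close> by one on \<open>U\<close> and raises the degree by the rank of \<open>U\<close>. The ranks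
  add up to \<open>kappa\<close>. The shift by one is due to the length of a \<open>k\<close>-chain being \<open>k + 1\<close>.\<close>

theorem homology_tope_paths:
  assumes "\<gamma> \<in> nat_vectors E" "A \<in> topes E \<phi>" "W \<in> tope_faces E \<phi> A"
  shows "if level_set E \<gamma> 1 \<subseteq> W \<and> (\<forall>j\<ge>1. level_set E \<gamma> j \<in> tope_faces E \<phi> A)
    then sphere_lists (tope_paths E \<phi> A W \<gamma>) (Suc (kappa E \<phi> \<gamma>))
    else acyclic_lists (tope_paths E \<phi> A W \<gamma>)"
  using assms
proof (induction "\<Sum>e\<in>E. \<gamma> e" arbitrary: \<gamma> A W rule: less_induct)
  case less
  note A = less.prems(2) and W = less.prems(3)
  let ?T = "tope_paths E \<phi> A W \<gamma>"
  show ?case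
  proof (cases "\<gamma> = (\<lambda>_. 0)")
    case True
    have "?T = {[A]}"
    proof (intro equalityI subsetI)
      fix l assume l: "l \<in> ?T"
      have "crossing_vector E l e = 0" "e \<notin> Sep E (last l) A" for e
        using l True crossing_vector_snoc[of l E A e] by (auto simp: tope_paths_def split: if_splits)
      then have "length l \<le> 1" "Sep E (last l) A = {}"
        using length_le_crossings[OF finite_E[OF arrangement], of l \<phi>] l by (auto simp: tope_paths_def)
      moreover have "l \<noteq> []" "last l \<in> topes E \<phi>" using l by (auto simp: tope_paths_def)
      ultimately show "l \<in> {[A]}" using Sep_empty_iff[of "last l" E \<phi> A] A by (cases l) auto
    qed (use A True in \<open>auto simp: tope_paths_def crossing_vector_Cons_Cons\<close>)
    moreover have "level_set E \<gamma> j = {}" if "1 \<le> j" for j using True that by (auto simp: level_set_def)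
    moreover have "kappa E \<phi> \<gamma> = 0"
    proof -
      have "insert 0 (\<gamma> ` E) = {0}" using True by auto
      then have "max_entry E \<gamma> = 0" unfolding max_entry_def by (simp only:) simp
      then show ?thesis by (simp add: kappa_def)
    qed
    ultimately show ?thesis using sphere_singleton[of "[A]"] empty_face[OF arrangement A] by simp
  next
    case False
    define U where "U = level_set E \<gamma> 1"
    let ?\<gamma>' = "\<lambda>e. \<gamma> e - 1"
    obtain e0 where e0: "\<gamma> e0 \<noteq> 0" using False by (auto simp: fun_eq_iff)
    then have "e0 \<in> E" using less.prems(1) by (auto simp: nat_vectors_def)
    with e0 have "U \<noteq> {}" by (auto simp: U_def level_set_def)
    have smaller: "(\<Sum>e\<in>E. \<gamma> e - (if e \<in> Z then 1 else 0)) < (\<Sum>e\<in>E. \<gamma> e)" if Z: "Z \<subseteq> U" "Z \<noteq> {}" for Z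
    proof -
      obtain e where "e \<in> Z" using Z by blast
      then have "e \<in> E" "1 \<le> \<gamma> e" using Z by (auto simp: U_def level_set_def)
      then show ?thesis using \<open>e \<in> Z\<close> finite_E[OF arrangement]
        by (intro sum_strict_mono_ex1) (auto intro!: bexI[of _ e])
    qed
    have \<gamma>'U: "?\<gamma>' = (\<lambda>e. \<gamma> e - (if e \<in> U then 1 else 0))"
      using less.prems(1) by (force simp: U_def level_set_def nat_vectors_def)
    have nv: "(\<lambda>e. \<gamma> e - (if e \<in> Z then 1 else 0)) \<in> nat_vectors E" for Z
      using less.prems(1) by (simp add: nat_vectors_def)
    have IH: "acyclic_lists (tope_paths E \<phi> (flip A Z) Z (\<lambda>e. \<gamma> e - (if e \<in> Z then 1 else 0)))"
      if Z: "Z \<in> tope_faces E \<phi> A" "Z \<noteq> {}" "Z \<subset> level_set E \<gamma> 1" for Z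
    proof -
      obtain e where "e \<in> U" "e \<notin> Z" using Z U_def by blast
      then have "\<not> level_set E (\<lambda>e. \<gamma> e - (if e \<in> Z then 1 else 0)) 1 \<subseteq> Z"
        by (auto simp: level_set_def U_def)
      then show ?thesis
        using less.hyps[OF smaller[of Z] nv flip_face_tope[OF arrangement A Z(1)] flip_face_self[OF arrangement A Z(1)]]
          Z U_def by auto
    qed
    let ?X = "tope_paths E \<phi> (flip A U) U ?\<gamma>'"
    let ?Q = "if U \<in> tope_faces E \<phi> A \<and> U \<subseteq> W then flag_complex E (orient A \<phi>) ?X {} U else {}"
    have quasi: "acyclic_lists (resolution E \<phi> A W \<gamma>) \<longleftrightarrow> acyclic_lists ?Q"
      "sphere_lists (resolution E \<phi> A W \<gamma>) n \<longleftrightarrow> sphere_lists ?Q n" for n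
      unfolding U_def
      by (rule resolution_quasi_flags[OF A W less.prems(1) False], rule IH, assumption+)+
    show ?thesis
    proof (cases "U \<in> tope_faces E \<phi> A \<and> U \<subseteq> W")
      case False
      then have "acyclic_lists ?T"
        using quasi(1)[unfolded if_not_P[OF False]] resolution_quasi_paths(1)[OF A W, of \<gamma>]
        by (simp only: acyclic_empty)
      moreover have "\<not> (level_set E \<gamma> 1 \<subseteq> W \<and> (\<forall>j\<ge>1. level_set E \<gamma> j \<in> tope_faces E \<phi> A))"
        using False U_def by auto
      ultimately show ?thesis by (simp only: if_False)
    next
      case True
      note UF = conjunct1[OF True]
      let ?F = "flag_complex E (orient A \<phi>) ?X {} U"
      have lev: "level_set E ?\<gamma>' j = level_set E \<gamma> (Suc j)" if "1 \<le> j" for j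
        using that by (auto simp: level_set_def)
      have levU: "level_set E \<gamma> (Suc j) \<subseteq> U" for j by (auto simp: U_def level_set_def)
      have adm: "(\<forall>j\<ge>1. level_set E ?\<gamma>' j \<in> tope_faces E \<phi> (flip A U)) \<longleftrightarrow> (\<forall>j\<ge>1. level_set E \<gamma> j \<in> tope_faces E \<phi> A)"
      proof -
        have "(\<forall>j\<ge>1. level_set E ?\<gamma>' j \<in> tope_faces E \<phi> (flip A U)) \<longleftrightarrow> (\<forall>j\<ge>1. level_set E \<gamma> (Suc j) \<in> tope_faces E \<phi> A)"
          using lev flip_subface_iff[OF arrangement A UF levU] by auto
        also have "\<dots> \<longleftrightarrow> (\<forall>j\<ge>1. level_set E \<gamma> j \<in> tope_faces E \<phi> A)"
        proof
          assume R: "\<forall>j\<ge>1. level_set E \<gamma> (Suc j) \<in> tope_faces E \<phi> A"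
          show "\<forall>j\<ge>1. level_set E \<gamma> j \<in> tope_faces E \<phi> A"
          proof (intro allI impI)
            fix j :: nat assume "1 \<le> j"
            then consider "j = 1" | i where "j = Suc i" "1 \<le> i" by (cases j) (auto simp: Suc_le_eq)
            then show "level_set E \<gamma> j \<in> tope_faces E \<phi> A" using R UF U_def by cases auto
          qed
        qed auto
        finally show ?thesis .
      qed
      have IHX: "if \<forall>j\<ge>1. level_set E \<gamma> j \<in> tope_faces E \<phi> A
        then sphere_lists ?X (Suc (kappa E \<phi> ?\<gamma>')) else acyclic_lists ?X"
        using less.hyps[OF smaller[OF order_refl \<open>U \<noteq> {}\<close>] nv flip_face_tope[OF arrangement A UF] flip_face_self[OF arrangement A UF]]
          levU[of 1] lev[of 1] adm unfolding \<gamma>'U[symmetric] by auto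
      have finX: "finite ?X" by (rule finite_tope_paths[OF finite_E[OF arrangement]])
      show ?thesis
      proof (cases "\<forall>j\<ge>1. level_set E \<gamma> j \<in> tope_faces E \<phi> A")
        case adm: True
        have "sphere_lists ?F (Suc (kappa E \<phi> ?\<gamma>') + (matroid_rank (orient A \<phi>) U - matroid_rank (orient A \<phi>) {}))"
          by (rule conjunct2[OF sphere_flag_complex[OF finite_E[OF arrangement] _ finX convex_tope_paths _ empty_face[OF arrangement A] UF]])
             (use IHX adm linear_orient[OF arrangement] \<open>U \<noteq> {}\<close> in auto)
        moreover have "matroid_rank (orient A \<phi>) U = matroid_rank \<phi> U"
          by (rule matroid_rank_orient) (use tope_cases[OF A] U_def in \<open>auto simp: level_set_def\<close>)
        moreover have "matroid_rank (orient A \<phi>) {} = 0"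
        proof -
          have "functional.span ({} :: ('v \<Rightarrow> real) set) = functional.span {}" ..
          then show ?thesis unfolding matroid_rank_def
            using functional.dim_eq_card[of "{}" "functional.span {}"] functional.independent_empty by (simp add: functional.span_span)
        qed
        moreover have "kappa E \<phi> \<gamma> = matroid_rank \<phi> U + kappa E \<phi> ?\<gamma>'"
          unfolding U_def by (rule kappa_reduce[OF finite_E[OF arrangement]]) (use \<open>U \<noteq> {}\<close> U_def in simp)
        ultimately have "sphere_lists ?F (Suc (kappa E \<phi> \<gamma>))" by (simp add: add.commute)
        then have "sphere_lists ?T (Suc (kappa E \<phi> \<gamma>))"
          using quasi(2)[unfolded if_P[OF True]] resolution_quasi_paths(2)[OF A W, of \<gamma>] by blast
        then show ?thesis using adm True U_def by simp
      next
        case nadm: False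
        have X: "acyclic_lists ?X" using IHX unfolding if_not_P[OF nadm] .
        have "acyclic_lists ?F"
        proof (rule acyclic_by_right_part)
          show "finite ?F" by (rule finite_flag_complex[OF finite_E[OF arrangement] _ finX]) (rule linear_orient[OF arrangement])
          show "convex_lists ?F" by (rule convex_flag_complex[OF finite_E[OF arrangement] _ convex_tope_paths]) (rule linear_orient[OF arrangement])
          show "\<exists>x z. w = joined x z" if "w \<in> ?F" for w using that by (auto simp: flag_complex_def)
          fix z assume "z \<in> right_part ` ?F"
          then obtain z' where "z = U # z'" "z' \<in> order_chains (faces_between E (orient A \<phi>) {} U)" by (auto simp: flag_complex_def)
          then have "{x. joined x z \<in> ?F} = ?X" by (auto simp: flag_complex_def)
          then show "acyclic_lists {x. joined x z \<in> ?F}" using X by simp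
        qed
        then have "acyclic_lists ?T"
          using quasi(1)[unfolded if_P[OF True]] resolution_quasi_paths(1)[OF A W, of \<gamma>] by blast
        moreover have "\<not> (level_set E \<gamma> 1 \<subseteq> W \<and> (\<forall>j\<ge>1. level_set E \<gamma> j \<in> tope_faces E \<phi> A))" using nadm by blast
        ultimately show ?thesis by (simp only: if_False)
      qed
    qed
  qed
qed

end

section \<open>Magnitude chains as a complex of lists\<close>

lemma card_Sep: "finite E \<Longrightarrow> card (Sep E A B) = (\<Sum>e\<in>E. if e \<in> Sep E A B then 1 else 0)"
proof -
  assume "finite E"
  then have "(\<Sum>e\<in>E. if e \<in> Sep E A B then 1 else 0 :: nat) = card (E \<inter> {e. e \<in> Sep E A B})"
    by (simp add: sum.If_cases)
  moreover have "E \<inter> {e. e \<in> Sep E A B} = Sep E A B" by (auto simp: Sep_def)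
  ultimately show ?thesis by simp
qed

definition proper_tope_lists :: "'e set \<Rightarrow> ('e \<Rightarrow> 'v \<Rightarrow> real) \<Rightarrow> 'e sign_vector list set" where
  "proper_tope_lists E \<phi> = {l. l \<noteq> [] \<and> set l \<subseteq> topes E \<phi> \<and> distinct_adj l}"

lemma proper_chains_iff:
  "l \<in> proper_chains (topes E \<phi>) k \<longleftrightarrow> l \<in> proper_tope_lists E \<phi> \<and> length l = Suc k"
proof -
  have "(\<forall>i\<in>{1..k}. l ! (i - 1) \<noteq> l ! i) \<longleftrightarrow> distinct_adj l" if "length l = Suc k"
  proof -
    have "(\<forall>i\<in>{1..k}. l ! (i - 1) \<noteq> l ! i) \<longleftrightarrow> (\<forall>i<k. l ! i \<noteq> l ! Suc i)"
    proof
      assume R: "\<forall>i\<in>{1..k}. l ! (i - 1) \<noteq> l ! i"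
      show "\<forall>i<k. l ! i \<noteq> l ! Suc i"
      proof (intro allI impI)
        fix i assume "i < k" then show "l ! i \<noteq> l ! Suc i" using bspec[OF R, of "Suc i"] by simp
      qed
    next
      assume R: "\<forall>i<k. l ! i \<noteq> l ! Suc i"
      show "\<forall>i\<in>{1..k}. l ! (i - 1) \<noteq> l ! i"
      proof
        fix i assume "i \<in> {1..k}" then show "l ! (i - 1) \<noteq> l ! i" using R by (cases i) auto
      qed
    qed
    then show ?thesis using that by (simp add: distinct_adj_conv_nth)
  qed
  then show ?thesis by (auto simp: proper_chains_def proper_tope_lists_def)
qed

text \<open>A union of classes of chains with the same crossing vector and the same last entry, in which crossing vectors
  are pairwise equal or incomparable. This covers the chains of fixed crossing vector, with or without fixed end, and
  those of fixed length.\<close>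

definition homogeneous :: "'e set \<Rightarrow> ('e \<Rightarrow> 'v \<Rightarrow> real) \<Rightarrow> 'e sign_vector list set \<Rightarrow> bool" where
  "homogeneous E \<phi> C \<longleftrightarrow> C \<subseteq> proper_tope_lists E \<phi> \<and>
     (\<forall>l\<in>C. \<forall>l'\<in>proper_tope_lists E \<phi>.
        crossing_vector E l' = crossing_vector E l \<and> last l' = last l \<longrightarrow> l' \<in> C) \<and>
     (\<forall>l\<in>C. \<forall>l'\<in>C. (\<forall>e. crossing_vector E l' e \<le> crossing_vector E l e) \<longrightarrow>
        crossing_vector E l' = crossing_vector E l)"

context
  fixes E :: "'e set" and \<phi> :: "'e \<Rightarrow> 'v::real_vector \<Rightarrow> real"
  assumes arrangement: "central_arrangement E \<phi>"
begin

text \<open>By \<open>first_crossing\<close> with \<open>G = {}\<close>: in a simple arrangement, proportional functionals are equal, so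
  only one hyperplane is crossed first.\<close>

lemma tope_neighbour:
  assumes A: "A \<in> topes E \<phi>" and B: "B \<in> topes E \<phi>" and ne: "A \<noteq> B"
  obtains C where "C \<in> topes E \<phi>" "card (Sep E C B) = 1" "card (Sep E A C) = card (Sep E A B) - 1"
proof -
  let ?\<psi> = "orient A \<phi>"
  note fin = finite_E[OF arrangement]
  obtain x where x: "generic_on E ?\<psi> {} x" "negative_set E ?\<psi> x = Sep E B A"
    by (rule tope_generic[OF arrangement A B])
  have "Sep E B A \<noteq> {}" using Sep_empty_iff[OF B A] ne by auto
  then have nex: "negative_set E ?\<psi> x \<noteq> {}" using x by simp
  obtain T x' q where T: "T \<noteq> {}" "T \<subseteq> negative_set E ?\<psi> x"
    and x': "generic_on E ?\<psi> {} x'" "negative_set E ?\<psi> x' = negative_set E ?\<psi> x - T"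
    and par: "parallel_on ?\<psi> {} T" and q: "\<forall>e\<in>{} \<union> T. ?\<psi> e q = 0" "\<forall>e\<in>E - ({} \<union> T). sgn (?\<psi> e q) = sgn (?\<psi> e x)"
    by (rule first_crossing[OF fin _ empty_face[OF arrangement A] x(1) nex]) (rule linear_orient[OF arrangement])
  have TE: "T \<subseteq> E" using T(2) by (auto simp: negative_set_def)
  have single: "e = f" if "e \<in> T" "f \<in> T" for e f
  proof -
    have "?\<psi> e v = 0 \<longleftrightarrow> ?\<psi> f v = 0" for v using par that unfolding parallel_on_def by blast
    then have "{v. \<phi> e v = 0} = {v. \<phi> f v = 0}"
      using orient_zero_iff[OF arrangement A] that TE by auto
    moreover have "inj_on (\<lambda>e. {x. \<phi> e x = 0}) E" using arrangement by (simp add: central_arrangement_def)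
    ultimately show ?thesis using that TE by (auto dest: inj_onD)
  qed
  then obtain t where t: "T = {t}" using T(1) by blast
  let ?N = "Sep E B A - T"
  let ?C = "flip A ?N"
  have C: "?C \<in> topes E \<phi>" using generic_flip_tope[OF arrangement A x'(1)] x'(2) x(2) by simp
  have NE: "?N \<subseteq> E" by (auto simp: Sep_def)
  have "Sep E B ?C = T"
    using Sep_flip[OF B A NE] T(2) x(2) by auto
  then have "card (Sep E ?C B) = card {t}" unfolding Sep_commute[of E ?C B] using t by (simp only:)
  then have "card (Sep E ?C B) = 1" by simp
  moreover have "Sep E A ?C = Sep E A B - T"
    using Sep_flip[OF A A NE] by (auto simp: Sep_commute[of E A B])
  then have "card (Sep E A ?C) = card (Sep E A B) - 1"
    using t T(2) x(2) by (simp add: Sep_commute[of E A B])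
  ultimately show ?thesis using that C by blast
qed

text \<open>Each edge changes one coordinate, which bounds the distance from below, and \<open>tope_neighbour\<close>
  produces a path that never crosses a hyperplane twice.\<close>

lemma path_dist_tope_graph:
  assumes A: "A \<in> topes E \<phi>" and B: "B \<in> topes E \<phi>"
  shows "path_dist (tope_graph E \<phi>) A B = card (Sep E A B)"
  unfolding path_dist_def
proof (rule Least_equality)
  note fin = finite_E[OF arrangement]
  show "(A, B) \<in> tope_graph E \<phi> ^^ card (Sep E A B)"
    using B
  proof (induction "card (Sep E A B)" arbitrary: B)
    case 0
    then have "Sep E A B = {}" using fin by (simp add: Sep_def)
    then show ?case using 0 Sep_empty_iff[OF A 0(2)] by simp
  next
    case (Suc n)
    then have "A \<noteq> B" by (auto simp: Sep_def)
    then obtain C where C: "C \<in> topes E \<phi>" "card (Sep E C B) = 1" "card (Sep E A C) = card (Sep E A B) - 1"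
      using tope_neighbour[OF A Suc(3)] by blast
    then have n: "n = card (Sep E A C)" using Suc(2) by simp
    then have "(A, C) \<in> tope_graph E \<phi> ^^ n" using Suc(1)[OF n C(1)] by simp
    moreover have "(C, B) \<in> tope_graph E \<phi>" using C Suc(3) by (simp add: tope_graph_def)
    ultimately have "(A, B) \<in> tope_graph E \<phi> ^^ Suc n" by auto
    then show ?case using Suc(2) by simp
  qed
  fix n assume "(A, B) \<in> tope_graph E \<phi> ^^ n"
  then show "card (Sep E A B) \<le> n"
  proof (induction n arbitrary: B)
    case (Suc n)
    then obtain C where C: "(A, C) \<in> tope_graph E \<phi> ^^ n" "(C, B) \<in> tope_graph E \<phi>" by auto
    have "card (Sep E A B) \<le> card (Sep E A C \<union> Sep E C B)"
      by (intro card_mono Sep_triangle) (use fin in \<open>auto simp: Sep_def\<close>)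
    also have "\<dots> \<le> card (Sep E A C) + card (Sep E C B)" by (rule card_Un_le)
    also have "\<dots> \<le> Suc n" using Suc.IH[OF C(1)] C(2) by (simp add: tope_graph_def)
    finally show ?case .
  qed simp
qed

lemma chain_length_topes:
  assumes "l \<noteq> []" "set l \<subseteq> topes E \<phi>"
  shows "chain_length (tope_graph E \<phi>) l = (\<Sum>e\<in>E. crossing_vector E l e)"
proof -
  have "chain_length (tope_graph E \<phi>) l = (\<Sum>i=1..length l - 1. card (Sep E (l ! (i - 1)) (l ! i)))"
    unfolding chain_length_def
    by (intro sum.cong path_dist_tope_graph) (use assms in \<open>auto intro!: subsetD[OF assms(2)] nth_mem\<close>)
  also have "\<dots> = (\<Sum>i=1..length l - 1. \<Sum>e\<in>E. if e \<in> Sep E (l ! (i - 1)) (l ! i) then 1 else 0)"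
    by (simp add: card_Sep[OF finite_E[OF arrangement]])
  also have "\<dots> = (\<Sum>e\<in>E. crossing_vector E l e)"
    unfolding crossing_vector_def by (rule sum.swap)
  finally show ?thesis .
qed

text \<open>The magnitude boundary deletes an interior entry if the distances add up. As distances count separating
  hyperplanes, this happens exactly when the deletion preserves the crossing vector. Deleting an
  end point always loses crossings, so the two conditions on the position also match.\<close>

lemma geodesic_deletion_iff:
  assumes l: "l \<in> proper_tope_lists E \<phi>" and i: "i < length l"
  shows "delete_nth i l \<in> proper_tope_lists E \<phi> \<and> crossing_vector E (delete_nth i l) = crossing_vector E l \<longleftrightarrow>
    i \<in> {1..<length l - 1} \<and> path_dist (tope_graph E \<phi>) (l ! (i - 1)) (l ! (i + 1)) =
      path_dist (tope_graph E \<phi>) (l ! (i - 1)) (l ! i) + path_dist (tope_graph E \<phi>) (l ! i) (l ! (i + 1))"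
proof -
  note fin = finite_E[OF arrangement]
  obtain xs a ys where ll: "l = xs @ a # ys" "length xs = i" "delete_nth i l = xs @ ys"
    using split_at_delete_nth[OF i] by metis
  have tl: "set l \<subseteq> topes E \<phi>" "distinct_adj l" using l by (auto simp: proper_tope_lists_def)
  have nonempty: "\<exists>e. e \<in> Sep E x y" if "x \<noteq> y" "x \<in> set l" "y \<in> set l" for x y
    using Sep_empty_iff[of x E \<phi> y] that tl by blast
  consider "xs = [] \<and> ys = []" | y ys' where "xs = []" "ys = y # ys'" | x xs' where "ys = []" "xs = xs' @ [x]"
    | x xs' y ys' where "xs = xs' @ [x]" "ys = y # ys'"
    by (metis neq_Nil_conv rev_exhaust)
  then show ?thesis
  proof cases
    case 1
    then show ?thesis using ll by (auto simp: proper_tope_lists_def)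
  next
    case 2
    then have "a \<noteq> y" using tl ll by (simp add: distinct_adj_Cons)
    then obtain e where "e \<in> Sep E a y" using nonempty[of a y] ll 2 by auto
    then have "crossing_vector E (xs @ ys) e \<noteq> crossing_vector E l e" using 2 ll by (simp add: crossing_vector_Cons_Cons)
    then show ?thesis using 2 ll by auto
  next
    case 3
    then have "x \<noteq> a" using tl ll by (auto simp: distinct_adj_append_iff)
    then obtain e where "e \<in> Sep E x a" using nonempty[of x a] ll 3 by auto
    then have "crossing_vector E (xs @ ys) e \<noteq> crossing_vector E l e"
      using 3 ll crossing_vector_snoc[of xs E a e] by simp
    then show ?thesis using 3 ll by auto
  next
    case 4
    have nth: "l ! (i - 1) = x" "l ! i = a" "l ! (i + 1) = y" "i \<in> {1..<length l - 1}"
      using ll 4 by (auto simp: nth_append)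
    have topes: "x \<in> topes E \<phi>" "a \<in> topes E \<phi>" "y \<in> topes E \<phi>" using tl ll 4 by auto
    let ?s = "\<lambda>x y e. if e \<in> Sep E x y then 1 else 0 :: nat"
    have cross: "crossing_vector E l e + ?s x y e = crossing_vector E (delete_nth i l) e + ?s x a e + ?s a y e" for e
      using crossing_vector_delete_middle[of E xs' x a y ys' e] ll 4 by simp
    have "crossing_vector E (delete_nth i l) = crossing_vector E l \<longleftrightarrow> (\<forall>e. ?s x y e = ?s x a e + ?s a y e)"
    proof -
      have "crossing_vector E (delete_nth i l) e = crossing_vector E l e \<longleftrightarrow> ?s x y e = ?s x a e + ?s a y e" for e
        using cross[of e] by linarith
      then show ?thesis by (simp add: fun_eq_iff)
    qed
    also have "\<dots> \<longleftrightarrow> card (Sep E x y) = card (Sep E x a) + card (Sep E a y)"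
    proof
      assume "\<forall>e. ?s x y e = ?s x a e + ?s a y e"
      then show "card (Sep E x y) = card (Sep E x a) + card (Sep E a y)"
        by (simp only: card_Sep[OF fin] sum.distrib[symmetric])
    next
      assume "card (Sep E x y) = card (Sep E x a) + card (Sep E a y)"
      then have sums: "(\<Sum>e\<in>E. ?s x y e) = (\<Sum>e\<in>E. ?s x a e + ?s a y e)"
        by (simp only: card_Sep[OF fin] sum.distrib)
      have le: "?s x y e \<le> ?s x a e + ?s a y e" for e using Sep_triangle[of E x y a] by auto
      show "\<forall>e. ?s x y e = ?s x a e + ?s a y e"
      proof
        fix e show "?s x y e = ?s x a e + ?s a y e"
        proof (cases "e \<in> E")
          case True
          show ?thesis by (rule sum_mono_inv[OF sums le True fin])
        qed (simp add: Sep_def)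
      qed
    qed
    finally have iff: "crossing_vector E (delete_nth i l) = crossing_vector E l \<longleftrightarrow>
      card (Sep E x y) = card (Sep E x a) + card (Sep E a y)" .
    have "delete_nth i l \<in> proper_tope_lists E \<phi>" if "crossing_vector E (delete_nth i l) = crossing_vector E l"
    proof -
      have "distinct_adj (xs @ ys)"
        by (rule distinct_adj_delete[of xs a ys E \<phi> "[]"]) (use that tl ll in auto)
      then show ?thesis using tl ll 4 by (auto simp: proper_tope_lists_def)
    qed
    then show ?thesis using iff nth by (auto simp: path_dist_tope_graph topes)
  qed
qed

lemma homogeneous_deletion_iff:
  assumes C: "homogeneous E \<phi> C" and l: "l \<in> C" "i < length l"
  shows "delete_nth i l \<in> C \<longleftrightarrow>
    delete_nth i l \<in> proper_tope_lists E \<phi> \<and> crossing_vector E (delete_nth i l) = crossing_vector E l"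
proof
  assume d: "delete_nth i l \<in> C"
  obtain xs a ys where "l = xs @ a # ys" "delete_nth i l = xs @ ys" using split_at_delete_nth[OF l(2)] by metis
  then have "crossing_vector E (delete_nth i l) e \<le> crossing_vector E l e" for e
    using crossing_vector_delete_le by metis
  then show "delete_nth i l \<in> proper_tope_lists E \<phi> \<and> crossing_vector E (delete_nth i l) = crossing_vector E l"
    using C l d unfolding homogeneous_def by blast
next
  assume d: "delete_nth i l \<in> proper_tope_lists E \<phi> \<and> crossing_vector E (delete_nth i l) = crossing_vector E l"
  have lp: "l \<in> proper_tope_lists E \<phi>" using C l by (auto simp: homogeneous_def)
  have i: "i \<in> {1..<length l - 1}" using geodesic_deletion_iff[OF lp l(2)] d by blast
  have "last (delete_nth i l) = last l" using i by (auto simp: delete_nth_def last_drop last_append)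
  then show "delete_nth i l \<in> C" using C l d unfolding homogeneous_def by blast
qed

lemma convex_homogeneous:
  assumes C: "homogeneous E \<phi> C" shows "convex_lists C"
  unfolding convex_lists_def
proof (intro ballI allI impI)
  fix l i j assume l: "l \<in> C" "i < length l" and j: "j < length l - 1" and dd: "delete_nth j (delete_nth i l) \<in> C"
  obtain xs a ys where ll: "l = xs @ a # ys" "delete_nth i l = xs @ ys" using split_at_delete_nth[OF l(2)] by metis
  have j': "j < length (delete_nth i l)" using l j by (simp add: length_delete_nth)
  then obtain xs' a' ys' where ll': "delete_nth i l = xs' @ a' # ys'" "delete_nth j (delete_nth i l) = xs' @ ys'"
    using split_at_delete_nth[of j "delete_nth i l"] by metis
  have 1: "crossing_vector E (delete_nth i l) e \<le> crossing_vector E l e" for e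
    using crossing_vector_delete_le ll by metis
  have 2: "crossing_vector E (delete_nth j (delete_nth i l)) e \<le> crossing_vector E (delete_nth i l) e" for e
    using crossing_vector_delete_le ll' by metis
  have "crossing_vector E (delete_nth j (delete_nth i l)) = crossing_vector E l"
    using C l(1) dd order_trans[OF 2 1] unfolding homogeneous_def by blast
  then have eq: "crossing_vector E (delete_nth i l) = crossing_vector E l"
    using 1 2 by (metis antisym ext)
  have lp: "set l \<subseteq> topes E \<phi>" "distinct_adj l" using C l by (auto simp: homogeneous_def proper_tope_lists_def)
  have "distinct_adj (xs @ ys)"
    by (rule distinct_adj_delete[of xs a ys E \<phi> "[]"]) (use eq lp ll in auto)
  then have "delete_nth i l \<in> proper_tope_lists E \<phi>"
    using lp(1) ll(1) j' unfolding ll(2) by (auto simp: proper_tope_lists_def)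
  then show "delete_nth i l \<in> C" using homogeneous_deletion_iff[OF C l] eq by blast
qed

lemma magnitude_boundary_eq:
  assumes C: "homogeneous E \<phi> C" and c: "Poly_Mapping.keys c \<subseteq> C"
  shows "magnitude_boundary (tope_graph E \<phi>) c = deletion_boundary C c"
  unfolding magnitude_boundary_def deletion_boundary_def
proof (rule frag_extend_eq)
  fix l assume "l \<in> Poly_Mapping.keys c"
  then have l: "l \<in> C" using c by blast
  let ?R = "tope_graph E \<phi>"
  have lp: "l \<in> proper_tope_lists E \<phi>" using C l by (auto simp: homogeneous_def)
  have iff: "delete_nth i l \<in> C \<longleftrightarrow> i \<in> {1..<length l - 1} \<and>
     path_dist ?R (l ! (i - 1)) (l ! (i + 1)) = path_dist ?R (l ! (i - 1)) (l ! i) + path_dist ?R (l ! i) (l ! (i + 1))"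
    if "i < length l" for i
    using geodesic_deletion_iff[OF lp that] homogeneous_deletion_iff[OF C l that] by blast
  have "(\<Sum>i\<in>{1..<length l - 1}. frag_cmul ((-1) ^ i) (magnitude_face ?R i l)) =
     (\<Sum>i\<in>{1..<length l - 1}. if delete_nth i l \<in> C then frag_cmul ((-1) ^ i) (frag_of (delete_nth i l)) else 0)"
    by (intro sum.cong refl) (use iff in \<open>auto simp: magnitude_face_def\<close>)
  also have "\<dots> = (\<Sum>i<length l. if delete_nth i l \<in> C then frag_cmul ((-1) ^ i) (frag_of (delete_nth i l)) else 0)"
    by (rule sum.mono_neutral_left) (use iff in auto)
  finally show "(\<Sum>i\<in>{1..<length l - 1}. frag_cmul ((-1) ^ i) (magnitude_face ?R i l)) =
     (\<Sum>i<length l. if delete_nth i l \<in> C then frag_cmul ((-1) ^ i) (frag_of (delete_nth i l)) else 0)" .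
qed

end

section \<open>Torsion\<close>

definition torsion_free_at :: "'a list set \<Rightarrow> nat \<Rightarrow> bool" where
  "torsion_free_at X k \<longleftrightarrow> (\<forall>c\<in>list_chains X k. deletion_boundary X c = 0 \<longrightarrow>
     (\<forall>n>0. (\<exists>b\<in>list_chains X (Suc k). deletion_boundary X b = frag_cmul (int n) c) \<longrightarrow>
        (\<exists>b\<in>list_chains X (Suc k). deletion_boundary X b = c)))"

lemma exact_torsion_free: "exact_at X k \<Longrightarrow> torsion_free_at X k"
  by (auto simp: exact_at_def torsion_free_at_def)

text \<open>A cycle is \<open>m z\<close> up to a boundary; if a positive multiple of it bounds, then \<open>m = 0\<close>.\<close>

lemma sphere_torsion_free:
  assumes "sphere_lists X n" shows "torsion_free_at X k"
proof (cases "k = n")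
  case False
  then show ?thesis using assms exact_torsion_free by (auto simp: sphere_lists_def)
next
  case True
  obtain z where z: "z \<in> list_chains X n" "deletion_boundary X z = 0"
    and gen: "\<And>c. c \<in> list_chains X n \<Longrightarrow> deletion_boundary X c = 0 \<Longrightarrow>
           (\<exists>m. \<exists>b\<in>list_chains X (Suc n). c = frag_cmul m z + deletion_boundary X b)"
    and free: "\<And>m b. b\<in>list_chains X (Suc n) \<Longrightarrow> frag_cmul m z = deletion_boundary X b \<Longrightarrow> m = 0"
    using sphere_listsE[OF assms] by blast
  show ?thesis
    unfolding torsion_free_at_def True
  proof (intro ballI allI impI)
    fix c and r :: nat
    assume c: "c \<in> list_chains X n" "deletion_boundary X c = 0" "0 < r"
      and "\<exists>b\<in>list_chains X (Suc n). deletion_boundary X b = frag_cmul (int r) c"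
    then obtain b where b: "b \<in> list_chains X (Suc n)" "deletion_boundary X b = frag_cmul (int r) c" by blast
    obtain m b' where b': "b' \<in> list_chains X (Suc n)" "c = frag_cmul m z + deletion_boundary X b'"
      using gen[OF c(1,2)] by blast
    have "frag_cmul (int r * m) z = deletion_boundary X (b - frag_cmul (int r) b')"
      using b(2) b'(2) by (simp add: frag_cmul_distrib2)
    then have "int r * m = 0" using free b(1) b'(1) by (meson list_chains_closed(3,4))
    then have "c = deletion_boundary X b'" using b'(2) c(3) by simp
    then show "\<exists>b\<in>list_chains X (Suc n). deletion_boundary X b = c" using b'(1) by blast
  qed
qed

lemma sum_in_list_chains: "(\<And>i. i \<in> I \<Longrightarrow> d i \<in> list_chains X k) \<Longrightarrow> sum d I \<in> list_chains X k"
  by (induction I rule: infinite_finite_induct) auto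

text \<open>If the key is invariant under deletion, the complex is the direct sum of the fibres.\<close>

lemma torsion_free_by_key:
  assumes inv: "\<And>l i. l \<in> X \<Longrightarrow> i < length l \<Longrightarrow> delete_nth i l \<in> X \<Longrightarrow> g (delete_nth i l) = g l"
    and fibres: "\<And>l. l \<in> X \<Longrightarrow> torsion_free_at {l' \<in> X. g l' = g l} k"
  shows "torsion_free_at X k"
  unfolding torsion_free_at_def
proof (intro ballI allI impI)
  fix c and r :: nat
  assume c: "c \<in> list_chains X k" "deletion_boundary X c = 0" "0 < r"
    and "\<exists>b\<in>list_chains X (Suc k). deletion_boundary X b = frag_cmul (int r) c"
  then obtain b where b: "b \<in> list_chains X (Suc k)" "deletion_boundary X b = frag_cmul (int r) c" by blast
  let ?F = "\<lambda>\<kappa>. {l \<in> X. g l = \<kappa>}"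
  have sub: "subcomplex (?F \<kappa>) X" "subcomplex (X - ?F \<kappa>) X" for \<kappa>
    using inv by (auto simp: subcomplex_def)
  have FF: "X - (X - ?F \<kappa>) = ?F \<kappa>" for \<kappa> by auto
  have comm: "deletion_boundary (?F \<kappa>) (restrict_chain (?F \<kappa>) a) = restrict_chain (?F \<kappa>) (deletion_boundary X a)"
    if "Poly_Mapping.keys a \<subseteq> X" for a \<kappa>
    using deletion_boundary_quotient[OF sub(2) that, of \<kappa>] unfolding FF by simp
  have res: "restrict_chain (?F \<kappa>) a \<in> list_chains (?F \<kappa>) j" if "a \<in> list_chains X j" for a j \<kappa>
  proof -
    have "X \<inter> ?F \<kappa> = ?F \<kappa>" by auto
    then show ?thesis using restrict_chains[OF that, of "?F \<kappa>"] by simp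
  qed
  have "\<exists>d\<in>list_chains X (Suc k). deletion_boundary X d = restrict_chain (?F \<kappa>) c" if \<kappa>: "\<kappa> \<in> g ` Poly_Mapping.keys c" for \<kappa>
  proof -
    obtain l where l: "l \<in> X" "g l = \<kappa>" using \<kappa> chains_keys[OF c(1)] by auto
    have "deletion_boundary (?F \<kappa>) (restrict_chain (?F \<kappa>) c) = 0"
      using comm[OF chains_keys[OF c(1)]] c(2) by simp
    moreover have "deletion_boundary (?F \<kappa>) (restrict_chain (?F \<kappa>) b) = frag_cmul (int r) (restrict_chain (?F \<kappa>) c)"
      using comm[OF chains_keys[OF b(1)]] b(2) by simp
    ultimately obtain d where d: "d \<in> list_chains (?F \<kappa>) (Suc k)" "deletion_boundary (?F \<kappa>) d = restrict_chain (?F \<kappa>) c"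
      using fibres[OF l(1)] res[OF c(1)] res[OF b(1)] c(3) l(2) unfolding torsion_free_at_def by blast
    have "deletion_boundary X d = deletion_boundary (?F \<kappa>) d"
      by (rule deletion_boundary_subcomplex[OF sub(1) chains_keys[OF d(1)]])
    moreover have "d \<in> list_chains X (Suc k)" using d(1) chains_mono[of "?F \<kappa>" X] by auto
    ultimately show ?thesis using d(2) by auto
  qed
  then obtain d where d: "\<And>\<kappa>. \<kappa> \<in> g ` Poly_Mapping.keys c \<Longrightarrow> d \<kappa> \<in> list_chains X (Suc k)"
    "\<And>\<kappa>. \<kappa> \<in> g ` Poly_Mapping.keys c \<Longrightarrow> deletion_boundary X (d \<kappa>) = restrict_chain (?F \<kappa>) c" by metis
  let ?d = "\<Sum>\<kappa>\<in>g ` Poly_Mapping.keys c. d \<kappa>"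
  have "?d \<in> list_chains X (Suc k)"
    by (rule sum_in_list_chains) (use d(1) in auto)
  moreover have "deletion_boundary X ?d = c"
  proof -
    have "deletion_boundary X ?d = (\<Sum>\<kappa>\<in>g ` Poly_Mapping.keys c. restrict_chain (?F \<kappa>) c)"
      using d(2) by (simp add: deletion_boundary_sum)
    also have "\<dots> = c"
    proof (rule poly_mapping_eqI)
      fix l
      have "Poly_Mapping.lookup (\<Sum>\<kappa>\<in>g ` Poly_Mapping.keys c. restrict_chain (?F \<kappa>) c) l =
        (\<Sum>\<kappa>\<in>g ` Poly_Mapping.keys c. if g l = \<kappa> then Poly_Mapping.lookup c l else 0)"
        unfolding lookup_sum
        by (rule sum.cong) (use chains_keys[OF c(1)] in \<open>auto simp: lookup_restrict_chain in_keys_iff\<close>)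
      also have "\<dots> = Poly_Mapping.lookup c l"
        by (simp add: in_keys_iff image_iff) (metis in_keys_iff)
      finally show "Poly_Mapping.lookup (\<Sum>\<kappa>\<in>g ` Poly_Mapping.keys c. restrict_chain (?F \<kappa>) c) l = Poly_Mapping.lookup c l" .
    qed
    finally show ?thesis .
  qed
  ultimately show "\<exists>b\<in>list_chains X (Suc k). deletion_boundary X b = c" by blast
qed

section \<open>From complexes to homology groups\<close>

context
  fixes E :: "'e set" and \<phi> :: "'e \<Rightarrow> 'v::real_vector \<Rightarrow> real" and C :: "'e sign_vector list set" and k :: nat
  assumes arrangement: "central_arrangement E \<phi>" and C: "homogeneous E \<phi> C"
begin

private abbreviation (input) "free \<equiv> free_Abelian_group {l \<in> C. length l = Suc k}"
private abbreviation (input) "cycles \<equiv> {c \<in> list_chains C (Suc k). deletion_boundary C c = 0}"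
private abbreviation (input) "boundaries \<equiv> deletion_boundary C ` list_chains C (Suc (Suc k))"
private abbreviation (input) "cycle_group \<equiv> subgroup_generated free cycles"
private abbreviation (input) "homology \<equiv>
  magnitude_homology (tope_graph E \<phi>) (\<lambda>j. {l \<in> C. length l = Suc j}) k"

private lemma carrier_free: "carrier (free_Abelian_group {l \<in> C. length l = j}) = list_chains C j"
  by (auto simp: list_chains_def)

private lemma homology_eq: "homology = cycle_group Mod boundaries"
proof -
  have "{c \<in> carrier free. magnitude_boundary (tope_graph E \<phi>) c = 0} = cycles"
    using magnitude_boundary_eq[OF arrangement C chains_keys] unfolding carrier_free by auto
  moreover have "magnitude_boundary (tope_graph E \<phi>) ` carrier (free_Abelian_group {l \<in> C. length l = Suc (Suc k)}) = boundaries"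
    unfolding carrier_free by (rule image_cong[OF refl magnitude_boundary_eq[OF arrangement C chains_keys]])
  ultimately show ?thesis by (simp only: magnitude_homology_def)
qed

private lemma mem_free: "c \<in> list_chains C j \<longleftrightarrow> Poly_Mapping.keys c \<subseteq> {l \<in> C. length l = j}"
  by (simp add: list_chains_def)

private lemma cycles_subgroup: "subgroup cycles free"
proof (rule group.subgroupI)
  show "cycles \<noteq> {}" using list_chains_closed(1) deletion_boundary_linear(1) by blast
  show "inv\<^bsub>free\<^esub> a \<in> cycles" if "a \<in> cycles" for a
    using that list_chains_closed(5)[of a C "Suc k"] by (simp add: mem_free)
  show "a \<otimes>\<^bsub>free\<^esub> b \<in> cycles" if "a \<in> cycles" "b \<in> cycles" for a b
    using that list_chains_closed(2)[of a C "Suc k" b] by simp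
qed (auto simp: mem_free)

private lemma carrier_cycle_group: "carrier cycle_group = cycles"
  by (rule subgroup.carrier_subgroup_generated_subgroup[OF cycles_subgroup])

private lemma comm_cycle_group: "comm_group cycle_group"
  using group.abelian_subgroup_generated[OF group_free_Abelian_group abelian_free_Abelian_group] .

private lemma group_cycle_group: "group cycle_group"
  using comm_cycle_group by (simp add: comm_group.axioms)

private lemma boundaries_cycles: "boundaries \<subseteq> cycles"
  using deletion_boundary_chains deletion_boundary_square[OF convex_homogeneous[OF arrangement C] chains_keys] by auto

private lemma boundaries_subgroup: "subgroup boundaries cycle_group"
proof (rule group.subgroupI[OF group_cycle_group])
  show "boundaries \<subseteq> carrier cycle_group" using boundaries_cycles carrier_cycle_group by simp
  show "boundaries \<noteq> {}" using list_chains_closed(1) by blast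
  show "inv\<^bsub>cycle_group\<^esub> a \<in> boundaries" if a: "a \<in> boundaries" for a
  proof -
    have ac: "a \<in> carrier cycle_group" using a boundaries_cycles carrier_cycle_group by auto
    then have "a \<in> carrier free" using carrier_cycle_group carrier_free by auto
    then have "inv\<^bsub>cycle_group\<^esub> a = - a"
      using group.inv_subgroup_generated[OF group_free_Abelian_group ac] by simp
    moreover obtain b where b: "b \<in> list_chains C (Suc (Suc k))" "a = deletion_boundary C b" using a by blast
    moreover have "- a = deletion_boundary C (- b)" using b(2) by simp
    ultimately show ?thesis using list_chains_closed(5)[OF b(1)] by (simp only: image_eqI)
  qed
  show "a \<otimes>\<^bsub>cycle_group\<^esub> b \<in> boundaries" if ab: "a \<in> boundaries" "b \<in> boundaries" for a b
  proof -
    obtain a' where a': "a' \<in> list_chains C (Suc (Suc k))" "a = deletion_boundary C a'" using ab(1) by blast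
    obtain b' where b': "b' \<in> list_chains C (Suc (Suc k))" "b = deletion_boundary C b'" using ab(2) by blast
    have "a \<otimes>\<^bsub>cycle_group\<^esub> b = deletion_boundary C (a' + b')" using a' b' by simp
    then show ?thesis using list_chains_closed(2)[OF a'(1) b'(1)] by (rule image_eqI)
  qed
qed

private lemma boundaries_normal: "boundaries \<lhd> cycle_group"
  using comm_group.subgroup_imp_normal[OF comm_cycle_group boundaries_subgroup] .

lemma magnitude_homology_trivial:
  assumes "exact_at C (Suc k)" shows "trivial_group homology"
proof -
  have eq: "boundaries = carrier cycle_group"
    using assms boundaries_cycles unfolding carrier_cycle_group exact_at_def by blast
  have "boundaries #>\<^bsub>cycle_group\<^esub> x = boundaries" if "x \<in> carrier cycle_group" for x
    using group.coset_join2[OF group_cycle_group that boundaries_subgroup] that eq by simp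
  then have "carrier homology \<subseteq> {\<one>\<^bsub>homology\<^esub>}"
    unfolding homology_eq carrier_FactGroup one_FactGroup by auto
  moreover have "group homology"
    unfolding homology_eq by (rule normal.factorgroup_is_group[OF boundaries_normal])
  ultimately show ?thesis using group.trivial_group_subset by blast
qed

text \<open>The coefficient of a cycle at \<open>z\<close> is a surjective homomorphism whose kernel consists of the boundaries.\<close>

lemma magnitude_homology_integer:
  assumes "sphere_lists C (Suc k)" shows "homology \<cong> integer_group"
proof -
  obtain z where z: "z \<in> list_chains C (Suc k)" "deletion_boundary C z = 0"
    and gen: "\<And>c. c \<in> list_chains C (Suc k) \<Longrightarrow> deletion_boundary C c = 0 \<Longrightarrow>
           (\<exists>m. \<exists>b\<in>list_chains C (Suc (Suc k)). c = frag_cmul m z + deletion_boundary C b)"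
    and indep: "\<And>m b. b\<in>list_chains C (Suc (Suc k)) \<Longrightarrow> frag_cmul m z = deletion_boundary C b \<Longrightarrow> m = 0"
    using sphere_listsE[OF assms] by blast
  define P where "P c m \<longleftrightarrow> (\<exists>b\<in>list_chains C (Suc (Suc k)). c = frag_cmul m z + deletion_boundary C b)" for c m
  have unique: "m = m'" if PP: "P c m" "P c m'" for c m m'
  proof -
    obtain b where b1: "b \<in> list_chains C (Suc (Suc k))" "c = frag_cmul m z + deletion_boundary C b"
      using PP(1) unfolding P_def by blast
    obtain b' where b2: "b' \<in> list_chains C (Suc (Suc k))" "c = frag_cmul m' z + deletion_boundary C b'"
      using PP(2) unfolding P_def by blast
    note b = b1 b2
    then have "frag_cmul (m - m') z = deletion_boundary C (b' - b)"
      by (simp add: frag_cmul_diff_distrib algebra_simps)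
    then have "m - m' = 0" using indep list_chains_closed(3)[OF b(3,1)] by blast
    then show ?thesis by simp
  qed
  define h where "h c = (THE m. P c m)" for c
  have h: "h c = m" if "P c m" for c m
    unfolding h_def using that unique by (intro the_equality) auto
  have Ph: "P c (h c)" if "c \<in> cycles" for c
  proof -
    have "\<exists>m. P c m" unfolding P_def by (rule gen) (use that in auto)
    then show ?thesis using h by blast
  qed
  have add: "P (c + c') (m + m')" if PP: "P c m" "P c' m'" for c c' m m'
  proof -
    obtain b where b1: "b \<in> list_chains C (Suc (Suc k))" "c = frag_cmul m z + deletion_boundary C b"
      using PP(1) unfolding P_def by blast
    obtain b' where b2: "b' \<in> list_chains C (Suc (Suc k))" "c' = frag_cmul m' z + deletion_boundary C b'"
      using PP(2) unfolding P_def by blast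
    note b = b1 b2
    then have "c + c' = frag_cmul (m + m') z + deletion_boundary C (b + b')" by (simp add: frag_cmul_distrib algebra_simps)
    then show ?thesis using list_chains_closed(2)[OF b(1,3)] unfolding P_def by blast
  qed
  have hom: "h \<in> hom cycle_group integer_group"
    unfolding hom_def carrier_cycle_group using h[OF add[OF Ph Ph]] by auto
  interpret group_hom cycle_group integer_group h
    using group_cycle_group hom by (simp add: group_hom_def group_hom_axioms_def)
  have hz: "h (frag_cmul m z) = m" for m
  proof (rule h)
    have "frag_cmul m z = frag_cmul m z + deletion_boundary C 0" by simp
    then show "P (frag_cmul m z) m" unfolding P_def using list_chains_closed(1) by (rule bexI)
  qed
  have zc: "frag_cmul m z \<in> cycles" for m using z by auto
  have "m \<in> h ` cycles" for m using imageI[OF zc, of h m] unfolding hz .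
  then have "h ` carrier cycle_group = carrier integer_group"
    unfolding carrier_cycle_group by auto
  then have "cycle_group Mod kernel cycle_group integer_group h \<cong> integer_group" by (rule FactGroup_iso)
  moreover have "kernel cycle_group integer_group h = boundaries"
  proof (intro equalityI subsetI)
    fix c assume "c \<in> kernel cycle_group integer_group h"
    then have "P c 0" using Ph by (force simp: kernel_def carrier_cycle_group)
    then show "c \<in> boundaries" by (auto simp: P_def)
  next
    fix c assume c: "c \<in> boundaries"
    then have "P c 0" by (auto simp: P_def)
    then show "c \<in> kernel cycle_group integer_group h"
      using c h boundaries_cycles by (auto simp: kernel_def carrier_cycle_group)
  qed
  ultimately show ?thesis unfolding homology_eq by simp
qed

lemma magnitude_homology_torsion_free:
  assumes "torsion_free_at C (Suc k)" shows "torsion_free homology"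
  unfolding torsion_free_def homology_eq
proof (intro ballI allI impI)
  fix x and n :: nat
  assume x: "x \<in> carrier (cycle_group Mod boundaries)" and n: "0 < n"
    and pow: "x [^]\<^bsub>cycle_group Mod boundaries\<^esub> n = \<one>\<^bsub>cycle_group Mod boundaries\<^esub>"
  obtain c where c: "c \<in> carrier cycle_group" "x = boundaries #>\<^bsub>cycle_group\<^esub> c"
    using x unfolding carrier_FactGroup by blast
  have cc: "c \<in> cycles" using c(1) carrier_cycle_group by simp
  have pw: "c [^]\<^bsub>cycle_group\<^esub> n = frag_cmul (int n) c"
    by (simp add: pow_subgroup_generated)
  have "frag_cmul (int n) c \<in> carrier cycle_group"
    using cc unfolding carrier_cycle_group by auto
  moreover have "boundaries #>\<^bsub>cycle_group\<^esub> frag_cmul (int n) c = boundaries"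
    using pow normal.FactGroup_pow[OF boundaries_normal c(1), of n] c(2) pw by simp
  ultimately have "frag_cmul (int n) c \<in> boundaries"
    using group.coset_join1[OF group_cycle_group _ _ boundaries_subgroup] by blast
  then have "\<exists>b\<in>list_chains C (Suc (Suc k)). deletion_boundary C b = frag_cmul (int n) c" by auto
  then have "c \<in> boundaries" using assms cc n unfolding torsion_free_at_def by blast
  then show "x = \<one>\<^bsub>cycle_group Mod boundaries\<^esub>"
    using group.coset_join2[OF group_cycle_group c(1) boundaries_subgroup] c(2) by simp
qed

end

section \<open>Magnitude homology of the tope graph\<close>

context
  fixes E :: "'e set" and \<phi> :: "'e \<Rightarrow> 'v::real_vector \<Rightarrow> real"
  assumes arrangement: "central_arrangement E \<phi>"
begin

lemma paths_to_tope:
  assumes B: "B \<in> topes E \<phi>"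
  shows "{l \<in> proper_tope_lists E \<phi>. crossing_vector E l = \<alpha> \<and> last l = B} = tope_paths E \<phi> B E \<alpha>"
proof -
  have "crossing_vector E l = \<alpha> \<and> last l = B \<longleftrightarrow> crossing_vector E (l @ [B]) = \<alpha> \<and> Sep E (last l) B \<inter> E = {}"
    if l: "l \<noteq> []" "set l \<subseteq> topes E \<phi>" for l
  proof -
    have "last l \<in> topes E \<phi>" using l by auto
    then have "Sep E (last l) B \<inter> E = {} \<longleftrightarrow> last l = B"
      using Sep_empty_iff[of "last l" E \<phi> B] B by (auto simp: Sep_def)
    moreover have "crossing_vector E (l @ [B]) = crossing_vector E l" if "last l = B"
      by (rule ext) (simp add: crossing_vector_snoc[OF l(1)] that)
    ultimately show ?thesis by auto
  qed
  then show ?thesis unfolding proper_tope_lists_def tope_paths_def by blast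
qed

text \<open>Faces are flats, since a point in the relative interior separates the span of the face from the other
  functionals. Levels above the maximum are empty, and the empty set is always a face.\<close>

lemma tope_admissible_iff:
  assumes B: "B \<in> topes E \<phi>"
  shows "tope_admissible E \<phi> \<alpha> B \<longleftrightarrow> (\<forall>j\<ge>1. level_set E \<alpha> j \<in> tope_faces E \<phi> B)"
proof -
  note fin = finite_E[OF arrangement]
  have face: "level_set E \<alpha> j \<in> tope_faces E \<phi> B \<longleftrightarrow> zero_on B (level_set E \<alpha> j) \<in> covectors E \<phi>" for j
    by (auto simp: tope_faces_iff[OF arrangement B] level_set_def)
  have flat: "flat E \<phi> F" if F: "F \<in> tope_faces E \<phi> B" for F
    unfolding flat_def
  proof (intro conjI ballI)
    obtain y where y: "\<forall>e\<in>F. orient B \<phi> e y = 0" "\<forall>e\<in>E - F. 0 < orient B \<phi> e y" and FE: "F \<subseteq> E"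
      using F by (auto simp: faces_def)
    show "F \<subseteq> E" by (rule FE)
    fix e assume e: "e \<in> E - F"
    have "matroid_rank \<phi> (F \<union> {e}) = Suc (matroid_rank \<phi> F)"
    proof (rule matroid_rank_step[OF fin _ FE])
      show "\<forall>g\<in>F. \<phi> g y = 0" using y(1) orient_zero_iff[OF arrangement B] FE by blast
      have "orient B \<phi> e y \<noteq> 0" using y(2) e by force
      then show "\<forall>e\<in>{e}. \<phi> e y \<noteq> 0" using orient_zero_iff[OF arrangement B, of e y] e by simp
    qed (use e linear_phi[OF arrangement] in \<open>auto simp: parallel_on_def\<close>)
    then show "matroid_rank \<phi> F < matroid_rank \<phi> (insert e F)" by simp
  qed
  have high: "level_set E \<alpha> j \<in> tope_faces E \<phi> B" if j: "max_entry E \<alpha> < j" for j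
  proof -
    have "\<alpha> e \<le> max_entry E \<alpha>" if "e \<in> E" for e
      unfolding max_entry_def by (rule Max_ge) (use fin that in auto)
    then have "level_set E \<alpha> j = {}" using j by (fastforce simp: level_set_def)
    then show ?thesis using empty_face[OF arrangement B] by simp
  qed
  show ?thesis
  proof
    assume "tope_admissible E \<phi> \<alpha> B"
    then have "\<forall>j\<in>{1..max_entry E \<alpha>}. level_set E \<alpha> j \<in> tope_faces E \<phi> B"
      using face by (simp add: tope_admissible_def)
    then show "\<forall>j\<ge>1. level_set E \<alpha> j \<in> tope_faces E \<phi> B" using high by (metis atLeastAtMost_iff not_less)
  next
    assume R: "\<forall>j\<ge>1. level_set E \<alpha> j \<in> tope_faces E \<phi> B"
    show "tope_admissible E \<phi> \<alpha> B"
      unfolding tope_admissible_def matroid_admissible_def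
    proof (intro conjI ballI impI)
      fix j assume "j \<in> {1..max_entry E \<alpha>}"
      then have F: "level_set E \<alpha> j \<in> tope_faces E \<phi> B" using R by simp
      show "flat E \<phi> (level_set E \<alpha> j)" by (rule flat[OF F])
      show "zero_on B (level_set E \<alpha> j) \<in> covectors E \<phi>" using F face by simp
    qed
  qed
qed

theorem homology_paths_to_tope:
  assumes \<alpha>: "\<alpha> \<in> nat_vectors E" and B: "B \<in> topes E \<phi>"
  defines "C \<equiv> {l \<in> proper_tope_lists E \<phi>. crossing_vector E l = \<alpha> \<and> last l = B}"
  shows "if tope_admissible E \<phi> \<alpha> B then sphere_lists C (Suc (kappa E \<phi> \<alpha>)) else acyclic_lists C"
  using homology_tope_paths[OF arrangement \<alpha> B full_face[OF arrangement]]
  unfolding C_def paths_to_tope[OF B] tope_admissible_iff[OF B] by (auto simp: level_set_def split: if_splits)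

text \<open>Deletions preserve the crossing vector and the last entry, so a homogeneous complex splits into pieces
  that are acyclic or have infinite cyclic homology.\<close>

lemma homogeneous_torsion_free:
  assumes C: "homogeneous E \<phi> C" shows "torsion_free_at C k"
proof (rule torsion_free_by_key[where g = "\<lambda>l. (crossing_vector E l, last l)"])
  fix l i assume l: "l \<in> C" "i < length l" "delete_nth i l \<in> C"
  then have d: "delete_nth i l \<in> proper_tope_lists E \<phi> \<and> crossing_vector E (delete_nth i l) = crossing_vector E l"
    using homogeneous_deletion_iff[OF arrangement C] by blast
  have lp: "l \<in> proper_tope_lists E \<phi>" using C l by (auto simp: homogeneous_def)
  have "i \<in> {1..<length l - 1}" using geodesic_deletion_iff[OF arrangement lp l(2)] d by blast
  then have "last (delete_nth i l) = last l" by (auto simp: delete_nth_def last_drop last_append)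
  then show "(crossing_vector E (delete_nth i l), last (delete_nth i l)) = (crossing_vector E l, last l)" using d by simp
next
  fix l assume l: "l \<in> C"
  let ?F = "{l' \<in> proper_tope_lists E \<phi>. crossing_vector E l' = crossing_vector E l \<and> last l' = last l}"
  have lp: "l \<in> proper_tope_lists E \<phi>" "C \<subseteq> proper_tope_lists E \<phi>" using C l by (auto simp: homogeneous_def)
  have F: "{l' \<in> C. (crossing_vector E l', last l') = (crossing_vector E l, last l)} = ?F"
    using C l unfolding homogeneous_def by auto
  have "last l \<in> topes E \<phi>" using lp by (auto simp: proper_tope_lists_def)
  moreover have "crossing_vector E l \<in> nat_vectors E" by (simp add: nat_vectors_def crossing_vector_outside)
  ultimately have hom: "if tope_admissible E \<phi> (crossing_vector E l) (last l)
    then sphere_lists ?F (Suc (kappa E \<phi> (crossing_vector E l))) else acyclic_lists ?F"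
    by (rule homology_paths_to_tope[rotated])
  have "torsion_free_at ?F k"
  proof (cases "tope_admissible E \<phi> (crossing_vector E l) (last l)")
    case True
    show ?thesis by (rule sphere_torsion_free[OF hom[unfolded if_P[OF True]]])
  next
    case False
    show ?thesis
      by (rule exact_torsion_free[OF hom[unfolded if_not_P[OF False] acyclic_lists_def, rule_format]])
  qed
  then show "torsion_free_at {l' \<in> C. (crossing_vector E l', last l') = (crossing_vector E l, last l)} k"
    by (simp only: F)
qed

end

theorem theorem4p3:
  fixes E :: "'e set" and \<phi> :: "'e \<Rightarrow> 'v::real_vector \<Rightarrow> real"
  assumes "central_arrangement E \<phi>"
  shows "(\<forall>\<alpha>\<in>nat_vectors E. \<forall>B\<in>topes E \<phi>. \<forall>k.
            if k = kappa E \<phi> \<alpha> \<and> tope_admissible E \<phi> \<alpha> B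
            then MH_crossing_to E \<phi> k \<alpha> B \<cong> integer_group
            else trivial_group (MH_crossing_to E \<phi> k \<alpha> B)) \<and>
         (\<forall>\<alpha>\<in>nat_vectors E. \<forall>k. torsion_free (MH_crossing E \<phi> k \<alpha>)) \<and>
         (\<forall>k l. torsion_free (MH_length E \<phi> k l))"
proof (intro conjI ballI allI)
  note fin = finite_E[OF assms]
  fix \<alpha> B k assume \<alpha>: "\<alpha> \<in> nat_vectors E" and B: "B \<in> topes E \<phi>"
  define C where "C = {l \<in> proper_tope_lists E \<phi>. crossing_vector E l = \<alpha> \<and> last l = B}"
  have C: "homogeneous E \<phi> C" by (auto simp: homogeneous_def C_def)
  have "{A \<in> proper_chains (topes E \<phi>) j. crossing_vector E A = \<alpha> \<and> last A = B} = {l \<in> C. length l = Suc j}" for j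
    by (auto simp: proper_chains_iff C_def)
  then have H: "MH_crossing_to E \<phi> k \<alpha> B = magnitude_homology (tope_graph E \<phi>) (\<lambda>j. {l \<in> C. length l = Suc j}) k"
    unfolding MH_crossing_to_def by simp
  note homology = homology_paths_to_tope[OF assms \<alpha> B, folded C_def]
  show "if k = kappa E \<phi> \<alpha> \<and> tope_admissible E \<phi> \<alpha> B
            then MH_crossing_to E \<phi> k \<alpha> B \<cong> integer_group
            else trivial_group (MH_crossing_to E \<phi> k \<alpha> B)"
  proof (cases "k = kappa E \<phi> \<alpha> \<and> tope_admissible E \<phi> \<alpha> B")
    case True
    then have "sphere_lists C (Suc k)" using homology by simp
    then show ?thesis using magnitude_homology_integer[OF assms C] True H by simp
  next
    case False
    then have exact: "exact_at C (Suc k)"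
      using homology unfolding acyclic_lists_def sphere_lists_def by (metis Suc_inject)
    show ?thesis
      unfolding if_not_P[OF False] H by (rule magnitude_homology_trivial[OF assms C exact])
  qed
next
  fix \<alpha> k
  let ?C = "{l \<in> proper_tope_lists E \<phi>. crossing_vector E l = \<alpha>}"
  have C: "homogeneous E \<phi> ?C" by (auto simp: homogeneous_def)
  have "{A \<in> proper_chains (topes E \<phi>) j. crossing_vector E A = \<alpha>} = {l \<in> ?C. length l = Suc j}" for j
    by (auto simp: proper_chains_iff)
  then have "MH_crossing E \<phi> k \<alpha> = magnitude_homology (tope_graph E \<phi>) (\<lambda>j. {l \<in> ?C. length l = Suc j}) k"
    unfolding MH_crossing_def by simp
  then show "torsion_free (MH_crossing E \<phi> k \<alpha>)"
    using magnitude_homology_torsion_free[OF assms C homogeneous_torsion_free[OF assms C]] by simp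
next
  fix k n
  let ?C = "{l \<in> proper_tope_lists E \<phi>. (\<Sum>e\<in>E. crossing_vector E l e) = n}"
  have C: "homogeneous E \<phi> ?C"
    unfolding homogeneous_def
  proof (intro conjI ballI impI)
    fix l l' assume l: "l \<in> ?C" "l' \<in> ?C" and le: "\<forall>e. crossing_vector E l' e \<le> crossing_vector E l e"
    have "crossing_vector E l' e = crossing_vector E l e" for e
    proof (cases "e \<in> E")
      case True
      show ?thesis
        by (rule sum_mono_inv[of "crossing_vector E l'" E "crossing_vector E l"]) (use l le True finite_E[OF assms] in auto)
    qed (simp add: crossing_vector_outside)
    then show "crossing_vector E l' = crossing_vector E l" by blast
  qed auto
  have "{A \<in> proper_chains (topes E \<phi>) j. chain_length (tope_graph E \<phi>) A = n} = {l \<in> ?C. length l = Suc j}" for j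
    using chain_length_topes[OF assms] by (auto simp: proper_chains_iff proper_tope_lists_def)
  then have "MH_length E \<phi> k n = magnitude_homology (tope_graph E \<phi>) (\<lambda>j. {l \<in> ?C. length l = Suc j}) k"
    unfolding MH_length_def by simp
  then show "torsion_free (MH_length E \<phi> k n)"
    using magnitude_homology_torsion_free[OF assms C homogeneous_torsion_free[OF assms C]] by simp
qed

end
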